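(* Let $c,q\in C^\infty(\mathbb{T}^1)$ be complex-valued smooth functions and let $L=\partial_t+c(t)\partial_x+q(t)$ on $\mathbb{T}^1\times\mathbb{R}$. Set $c_0=\frac{1}{2\pi}\int_0^{2\pi}c(t)\,dt$, $q_0=\frac{1}{2\pi}\int_0^{2\pi}q(t)\,dt$ and $b=\operatorname{Im}(c)$. Then: (i) if $c_0=0$, $q$ is a constant function whose value lies in $i\mathbb{Z}$, and for every $r\in\mathbb{R}$ the sublevel set $$\Omega_r=\Big\{t\in\mathbb{T}^1 : \int_0^t b(\tau)\,d\tau<r\Big\}$$ is connected, then $L$ is Schwartz globally solvable; (ii) if $b\not\equiv 0$ and ($c_0\neq 0$ or $q_0\notin i\mathbb{Z}$), then $L$ is Schwartz globally solvable if and only if $b$ does not change sign on $\mathbb{T}^1$.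
   Context: $\mathbb{T}^1=\mathbb{R}/2\pi\mathbb{Z}$, identified with $[0,2\pi)$; functions on $\mathbb{T}^1$ are $2\pi$-periodic functions on $\mathbb{R}$. $\mathcal{S}(\mathbb{T}^1\times\mathbb{R})$ is the space of $f\in C^\infty(\mathbb{T}^1\times\mathbb{R})$ with $\sup_{t,x}|x^\gamma\partial_t^\alpha\partial_x^\beta f(t,x)|<\infty$ for all $\alpha,\beta,\gamma\in\mathbb{N}_0$ (Fréchet topology from these seminorms), and $\mathcal{S}'(\mathbb{T}^1\times\mathbb{R})$ its dual, with pairing $\langle v,f\rangle$. The transpose of $L$ is the operator $L^t$ on $\mathcal{S}'(\mathbb{T}^1\times\mathbb{R})$ defined by $\langle L^tv,\varphi\rangle=\langle v,L\varphi\rangle$, i.e. $L^tv=-\partial_tv-c(t)\partial_xv+q(t)v$. Let $\ker L^t=\{v\in\mathcal{S}'(\mathbb{T}^1\times\mathbb{R}):L^tv=0\}$ and $(\ker L^t)^0=\{f\in\mathcal{S}(\mathbb{T}^1\times\mathbb{R}):\langle v,f\rangle=0\ \forall v\in\ker L^t\}$. $L$ is (Schwartz) globally solvable if for every $f\in(\ker L^t)^0$ there exists $u\in\mathcal{S}(\mathbb{T}^1\times\mathbb{R})$ with $Lu=f$. *)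

theory Defs
  imports "HOL-Analysis.Analysis"
begin

type_synonym tfun = "real \<Rightarrow> real \<Rightarrow> complex"
  (* functions on T^1 x R, as functions of (t,x) on R x R, 2pi-periodic in t *)

definition pdt :: "tfun \<Rightarrow> tfun" where
  "pdt f = (\<lambda>t x. vector_derivative (\<lambda>s. f s x) (at t))"

definition pdx :: "tfun \<Rightarrow> tfun" where
  "pdx f = (\<lambda>t x. vector_derivative (\<lambda>y. f t y) (at x))"

fun apply_partials :: "bool list \<Rightarrow> tfun \<Rightarrow> tfun" where
  "apply_partials [] f = f"
| "apply_partials (b # bs) f = (if b then pdt else pdx) (apply_partials bs f)"

definition smooth2 :: "tfun \<Rightarrow> bool" where
  "smooth2 f \<longleftrightarrow>
     (\<forall>ws t x. (\<lambda>s. apply_partials ws f s x) differentiable (at t)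
             \<and> (\<lambda>y. apply_partials ws f t y) differentiable (at x))
   \<and> (\<forall>ws. continuous_on UNIV (\<lambda>p. apply_partials ws f (fst p) (snd p)))"

definition periodic_t :: "tfun \<Rightarrow> bool" where
  "periodic_t f \<longleftrightarrow> (\<forall>t x. f (t + 2 * pi) x = f t x)"

definition schwartz_term :: "nat \<Rightarrow> nat \<Rightarrow> nat \<Rightarrow> tfun \<Rightarrow> real \<times> real \<Rightarrow> real" where
  "schwartz_term \<alpha> \<beta> \<gamma> f p =
     norm (complex_of_real (snd p) ^ \<gamma> * (pdt ^^ \<alpha>) ((pdx ^^ \<beta>) f) (fst p) (snd p))"

definition schwartz_seminorm :: "nat \<Rightarrow> nat \<Rightarrow> nat \<Rightarrow> tfun \<Rightarrow> real" where
  "schwartz_seminorm \<alpha> \<beta> \<gamma> f = (SUP p\<in>UNIV. schwartz_term \<alpha> \<beta> \<gamma> f p)"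

definition schwartz :: "tfun set" where
  "schwartz = {f. smooth2 f \<and> periodic_t f \<and>
                  (\<forall>\<alpha> \<beta> \<gamma>. bdd_above (range (schwartz_term \<alpha> \<beta> \<gamma> f)))}"

text \<open>S'(T^1 x R): linear functionals on S, continuous for the Frechet topology
  defined by the seminorms (equivalently: bounded by finitely many seminorms).\<close>
definition tempered :: "(tfun \<Rightarrow> complex) set" where
  "tempered = {v.
     (\<forall>f\<in>schwartz. \<forall>g\<in>schwartz. v (\<lambda>t x. f t x + g t x) = v f + v g)
   \<and> (\<forall>a. \<forall>f\<in>schwartz. v (\<lambda>t x. a * f t x) = a * v f)
   \<and> (\<exists>C N. \<forall>f\<in>schwartz. norm (v f) \<le>
          C * (\<Sum>\<alpha>\<le>N. \<Sum>\<beta>\<le>N. \<Sum>\<gamma>\<le>N. schwartz_seminorm \<alpha> \<beta> \<gamma> f))}"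

definition smooth_periodic :: "(real \<Rightarrow> complex) \<Rightarrow> bool" where
  "smooth_periodic c \<longleftrightarrow>
     (\<forall>n t. (((\<lambda>g s. vector_derivative g (at s)) ^^ n) c) differentiable (at t))
   \<and> (\<forall>t. c (t + 2 * pi) = c t)"

definition mean :: "(real \<Rightarrow> complex) \<Rightarrow> complex" where
  "mean c = integral {0..2 * pi} c / complex_of_real (2 * pi)"

definition opL :: "(real \<Rightarrow> complex) \<Rightarrow> (real \<Rightarrow> complex) \<Rightarrow> tfun \<Rightarrow> tfun" where
  "opL c q u = (\<lambda>t x. pdt u t x + c t * pdx u t x + q t * u t x)"

text \<open>ker L^t: L^t v = 0 iff <v, L phi> = 0 for all phi in S.\<close>
definition ker_Lt :: "(real \<Rightarrow> complex) \<Rightarrow> (real \<Rightarrow> complex) \<Rightarrow> (tfun \<Rightarrow> complex) set" where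
  "ker_Lt c q = {v \<in> tempered. \<forall>\<phi>\<in>schwartz. v (opL c q \<phi>) = 0}"

definition globally_solvable :: "(real \<Rightarrow> complex) \<Rightarrow> (real \<Rightarrow> complex) \<Rightarrow> bool" where
  "globally_solvable c q \<longleftrightarrow>
     (\<forall>f\<in>schwartz. (\<forall>v\<in>ker_Lt c q. v f = 0) \<longrightarrow> (\<exists>u\<in>schwartz. opL c q u = f))"

end

theory Submission
  imports Defs "HOL-Probability.Probability"
begin

text \<open>A partial Fourier transform in \<open>x\<close> turns \<open>L u = f\<close> into a periodic linear ordinary differential equation in
  \<open>t\<close> for each frequency \<open>\<xi>\<close>, whose solutions grow like \<open>exp (\<xi> * \<integral> b)\<close>. Orthogonality to the kernel of
  the transpose is the solvability condition at the resonant frequencies. If \<open>b\<close> has constant sign, the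
  equation can be integrated in a damped direction of \<open>t\<close>. If the sublevel sets are connected, every point is joined to
  the maximum (minimum) of \<open>\<integral> b\<close> by an arc on which the kernel stays bounded for positive (negative) \<open>\<xi>\<close>.
  If \<open>b\<close> changes sign, a wave packet concentrated at a local maximum of \<open>\<integral> b\<close> does not decay in \<open>\<xi>\<close>
  although its image under the equation does; this image lies in the closure of the range of \<open>L\<close>, but not in the
  range.\<close>

section \<open>Function classes with growth conditions\<close>

text \<open>Everything is governed by the monodromy factor
  \<open>exp (phase c q () (2 * pi) \<xi>)\<close>. Where it differs from 1, the periodic solution
  is unique; where it equals 1, an initial value may be chosen freely, at the price of one linear
  condition on the data. If \<open>Im c\<close> has constant sign and is not identically 0, at most
  one frequency is resonant, and the factor minus 1 has a simple zero there, so division by it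
  preserves smoothness. If \<open>mean c = 0\<close> and \<open>q\<close> is a constant in i Z,
  every frequency is resonant, and the freedom is spent on making the solution vanish at a good
  point; this point depends on the sign of \<xi>, so the frequencies are split by a cutoff. In the
  negative result, nonresonance at arbitrarily large frequencies forces any Schwartz solution to
  coincide there with the packet that does not decay. The technical obstacle is that all derivatives
  must be controlled. Solutions are therefore built in an unrestricted smooth class, and a single
  sup bound is then shown to reproduce itself under differentiation.\<close>

definition cont2 :: "('i \<Rightarrow> tfun) \<Rightarrow> bool" where
  "cont2 f \<longleftrightarrow> (\<forall>i. continuous_on UNIV (\<lambda>p. f i (fst p) (snd p)))"

definition partials :: "('i \<Rightarrow> tfun) \<Rightarrow> ('i \<Rightarrow> tfun) \<Rightarrow> ('i \<Rightarrow> tfun) \<Rightarrow> bool" where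
  "partials f g h \<longleftrightarrow> (\<forall>i t x. ((\<lambda>s. f i s x) has_vector_derivative g i t x) (at t)
     \<and> ((\<lambda>y. f i t y) has_vector_derivative h i t x) (at x))"

text \<open>The growth condition \<open>B\<close> is imposed on a whole family, so that bounds are uniform in the
  index. This yields the boundedness of families of Schwartz functions in every seminorm, and with a
  one-element index type the Schwartz class itself.\<close>

primrec ck :: "(('i \<Rightarrow> tfun) \<Rightarrow> bool) \<Rightarrow> nat \<Rightarrow> ('i \<Rightarrow> tfun) \<Rightarrow> bool" where
  "ck B 0 f \<longleftrightarrow> B f \<and> cont2 f"
| "ck B (Suc n) f \<longleftrightarrow> B f \<and> cont2 f \<and> (\<exists>g h. partials f g h \<and> ck B n g \<and> ck B n h)"

definition cinf :: "(('i \<Rightarrow> tfun) \<Rightarrow> bool) \<Rightarrow> ('i \<Rightarrow> tfun) \<Rightarrow> bool" where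
  "cinf B f \<longleftrightarrow> (\<forall>n. ck B n f)"

definition unconstrained :: "('i \<Rightarrow> tfun) \<Rightarrow> bool" where
  "unconstrained f \<longleftrightarrow> True"

text \<open>The bounds are uniform in \<open>t\<close> as well as in the index. Periodicity is not
  part of the classes and is carried along separately.\<close>

definition moderate :: "('i \<Rightarrow> tfun) \<Rightarrow> bool" where
  "moderate f \<longleftrightarrow> (\<exists>N C. \<forall>i t x. norm (f i t x) \<le> C * (1 + \<bar>x\<bar>) ^ N)"

definition rapid :: "('i \<Rightarrow> tfun) \<Rightarrow> bool" where
  "rapid f \<longleftrightarrow> (\<forall>N. \<exists>C. \<forall>i t x. norm (f i t x) * (1 + \<bar>x\<bar>) ^ N \<le> C)"

text \<open>This is what the Leibniz rule needs: \<open>B\<close> is closed under sums and absorbs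
  factors from \<open>M\<close>. The pairs in use are unconstrained/unconstrained, moderate/moderate
  and rapid/moderate.\<close>

definition growth_module :: "(('i \<Rightarrow> tfun) \<Rightarrow> bool) \<Rightarrow> (('i \<Rightarrow> tfun) \<Rightarrow> bool) \<Rightarrow> bool" where
  "growth_module B M \<longleftrightarrow> (\<forall>f g. B f \<longrightarrow> B g \<longrightarrow> B (\<lambda>i t x. f i t x + g i t x))
     \<and> (\<forall>f g. M f \<longrightarrow> B g \<longrightarrow> B (\<lambda>i t x. f i t x * g i t x))"

lemma growth_module_unconstrained: "growth_module unconstrained unconstrained"
  by (simp add: growth_module_def unconstrained_def)

lemma moderate_add:
  assumes "moderate f" "moderate g"
  shows "moderate (\<lambda>i t x. f i t x + g i t x)"
proof -
  obtain N C where f: "\<And>i t x. norm (f i t x) \<le> C * (1 + \<bar>x\<bar>) ^ N"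
    using assms(1) unfolding moderate_def by blast
  obtain M D where g: "\<And>i t x. norm (g i t x) \<le> D * (1 + \<bar>x\<bar>) ^ M"
    using assms(2) unfolding moderate_def by blast
  have "norm (f i t x + g i t x) \<le> (\<bar>C\<bar> + \<bar>D\<bar>) * (1 + \<bar>x\<bar>) ^ (N + M)" for i t x
  proof -
    have "norm (f i t x) \<le> \<bar>C\<bar> * (1 + \<bar>x\<bar>) ^ (N + M)"
      by (rule order_trans[OF f]) (intro mult_mono power_increasing, auto)
    moreover have "norm (g i t x) \<le> \<bar>D\<bar> * (1 + \<bar>x\<bar>) ^ (N + M)"
      by (rule order_trans[OF g]) (intro mult_mono power_increasing, auto)
    ultimately show ?thesis
      using norm_triangle_ineq[of "f i t x" "g i t x"] by (simp add: algebra_simps)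
  qed
  then show ?thesis unfolding moderate_def by blast
qed

lemma moderate_mult:
  assumes "moderate f" "moderate g"
  shows "moderate (\<lambda>i t x. f i t x * g i t x)"
proof -
  obtain N C where f: "\<And>i t x. norm (f i t x) \<le> C * (1 + \<bar>x\<bar>) ^ N"
    using assms(1) unfolding moderate_def by blast
  obtain M D where g: "\<And>i t x. norm (g i t x) \<le> D * (1 + \<bar>x\<bar>) ^ M"
    using assms(2) unfolding moderate_def by blast
  have "norm (f i t x * g i t x) \<le> (C * D) * (1 + \<bar>x\<bar>) ^ (N + M)" for i t x
  proof -
    have "norm (f i t x) * norm (g i t x) \<le> (C * (1 + \<bar>x\<bar>) ^ N) * (D * (1 + \<bar>x\<bar>) ^ M)"
      using f g by (intro mult_mono) (auto intro: order_trans[OF norm_ge_zero])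
    then show ?thesis by (simp add: norm_mult power_add mult_ac)
  qed
  then show ?thesis unfolding moderate_def by blast
qed

lemma growth_module_moderate: "growth_module moderate moderate"
  by (simp add: growth_module_def moderate_add moderate_mult)

lemma growth_module_rapid: "growth_module rapid moderate"
  unfolding growth_module_def
proof (intro conjI allI impI)
  fix f g :: "'a \<Rightarrow> tfun" assume f: "rapid f" and g: "rapid g"
  show "rapid (\<lambda>i t x. f i t x + g i t x)"
    unfolding rapid_def
  proof
    fix N
    obtain C D where
      C: "\<And>i t x. norm (f i t x) * (1 + \<bar>x\<bar>) ^ N \<le> C" and D: "\<And>i t x. norm (g i t x) * (1 + \<bar>x\<bar>) ^ N \<le> D"
      using f g unfolding rapid_def by metis
    have "norm (f i t x + g i t x) * (1 + \<bar>x\<bar>) ^ N \<le> C + D" for i t x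
    proof -
      have "norm (f i t x + g i t x) * (1 + \<bar>x\<bar>) ^ N \<le> (norm (f i t x) + norm (g i t x)) * (1 + \<bar>x\<bar>) ^ N"
        by (intro mult_right_mono norm_triangle_ineq) auto
      then show ?thesis using C[of i t x] D[of i t x] by (simp add: algebra_simps)
    qed
    then show "\<exists>C. \<forall>i t x. norm (f i t x + g i t x) * (1 + \<bar>x\<bar>) ^ N \<le> C" by blast
  qed
next
  fix f g :: "'a \<Rightarrow> tfun" assume f: "moderate f" and g: "rapid g"
  obtain M D where fM: "\<And>i t x. norm (f i t x) \<le> D * (1 + \<bar>x\<bar>) ^ M"
    using f unfolding moderate_def by blast
  have D0: "0 \<le> D" using order_trans[OF norm_ge_zero fM[of undefined 0 0]] by simp
  show "rapid (\<lambda>i t x. f i t x * g i t x)"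
    unfolding rapid_def
  proof
    fix N
    obtain C where C: "\<And>i t x. norm (g i t x) * (1 + \<bar>x\<bar>) ^ (N + M) \<le> C"
      using g unfolding rapid_def by metis
    have "norm (f i t x * g i t x) * (1 + \<bar>x\<bar>) ^ N \<le> D * C" for i t x
    proof -
      have "norm (f i t x) * (norm (g i t x) * (1 + \<bar>x\<bar>) ^ N)
          \<le> (D * (1 + \<bar>x\<bar>) ^ M) * (norm (g i t x) * (1 + \<bar>x\<bar>) ^ N)"
        by (intro mult_right_mono fM) auto
      also have "\<dots> = D * (norm (g i t x) * (1 + \<bar>x\<bar>) ^ (N + M))" by (simp add: power_add mult_ac)
      also have "\<dots> \<le> D * C" by (intro mult_left_mono C D0)
      finally show ?thesis by (simp add: norm_mult mult_ac)
    qed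
    then show "\<exists>C. \<forall>i t x. norm (f i t x * g i t x) * (1 + \<bar>x\<bar>) ^ N \<le> C" by blast
  qed
qed

lemma moderateI: "(\<And>i t x. norm (f i t x) \<le> C * (1 + \<bar>x\<bar>) ^ N) \<Longrightarrow> moderate f"
  unfolding moderate_def by blast

lemma moderate_bounded: "(\<And>i t x. norm (f i t x) \<le> C) \<Longrightarrow> moderate f"
  using moderateI[of f C 0] by simp

section \<open>Closure of the smooth classes under algebraic operations\<close>

lemma ck_SucI: "B f \<Longrightarrow> cont2 f \<Longrightarrow> partials f g h \<Longrightarrow> ck B n g \<Longrightarrow> ck B n h \<Longrightarrow> ck B (Suc n) f"
  by auto

lemma ck_growth: "ck B n f \<Longrightarrow> B f"
  by (cases n) auto

lemma ck_cont2: "ck B n f \<Longrightarrow> cont2 f"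
  by (cases n) auto

lemma ck_SucD: "ck B (Suc n) f \<Longrightarrow> ck B n f"
proof (induction n arbitrary: f)
  case (Suc n)
  then show ?case by (subst ck.simps(2)) (metis ck.simps(2))
qed auto

lemma ck_mono_growth: "(\<And>f. B f \<Longrightarrow> B' f) \<Longrightarrow> ck B n f \<Longrightarrow> ck B' n f"
  by (induction n arbitrary: f) (fastforce simp: ck.simps)+

lemma ck_unconstrained: "ck B n f \<Longrightarrow> ck unconstrained n f"
  by (rule ck_mono_growth[of B]) (auto simp: unconstrained_def)

lemma partials_add: "partials f f1 f2 \<Longrightarrow> partials g g1 g2 \<Longrightarrow>
   partials (\<lambda>i t x. f i t x + g i t x) (\<lambda>i t x. f1 i t x + g1 i t x) (\<lambda>i t x. f2 i t x + g2 i t x)"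
  by (auto simp: partials_def intro!: has_vector_derivative_add)

lemma partials_mult: "partials f f1 f2 \<Longrightarrow> partials g g1 g2 \<Longrightarrow>
   partials (\<lambda>i t x. f i t x * g i t x) (\<lambda>i t x. f i t x * g1 i t x + f1 i t x * g i t x)
     (\<lambda>i t x. f i t x * g2 i t x + f2 i t x * g i t x)"
  by (auto simp: partials_def intro!: has_vector_derivative_mult)

lemma cont2_add: "cont2 f \<Longrightarrow> cont2 g \<Longrightarrow> cont2 (\<lambda>i t x. f i t x + g i t x)"
  by (auto simp: cont2_def intro!: continuous_intros)

lemma cont2_mult: "cont2 f \<Longrightarrow> cont2 g \<Longrightarrow> cont2 (\<lambda>i t x. f i t x * g i t x)"
  by (auto simp: cont2_def intro!: continuous_intros)

lemma ck_add:
  assumes "growth_module B M" "ck B n f" "ck B n g"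
  shows "ck B n (\<lambda>i t x. f i t x + g i t x)"
  using assms(2,3)
proof (induction n arbitrary: f g)
  case 0
  then show ?case using assms(1) by (auto simp: growth_module_def cont2_add)
next
  case (Suc n)
  obtain f1 f2 g1 g2 where "partials f f1 f2" "partials g g1 g2" "ck B n f1" "ck B n f2" "ck B n g1" "ck B n g2"
    using Suc.prems by auto
  show ?case
  proof (rule ck_SucI)
    show "B (\<lambda>i t x. f i t x + g i t x)"
      using Suc.prems assms(1) by (auto simp: growth_module_def)
    show "cont2 (\<lambda>i t x. f i t x + g i t x)" using Suc.prems by (auto intro: cont2_add)
    show "partials (\<lambda>i t x. f i t x + g i t x) (\<lambda>i t x. f1 i t x + g1 i t x) (\<lambda>i t x. f2 i t x + g2 i t x)"
      by (rule partials_add) fact+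
    show "ck B n (\<lambda>i t x. f1 i t x + g1 i t x)" "ck B n (\<lambda>i t x. f2 i t x + g2 i t x)"
      by (rule Suc.IH; fact)+
  qed
qed

lemma ck_mult:
  assumes "growth_module B M" "ck M n f" "ck B n g"
  shows "ck B n (\<lambda>i t x. f i t x * g i t x)"
  using assms(2,3)
proof (induction n arbitrary: f g)
  case 0
  then show ?case using assms(1) by (auto simp: growth_module_def cont2_mult)
next
  case (Suc n)
  obtain f1 f2 g1 g2 where *: "partials f f1 f2" "partials g g1 g2" "ck M n f1" "ck M n f2" "ck B n g1" "ck B n g2"
    using Suc.prems by auto
  have "ck M n f" "ck B n g" using Suc.prems ck_SucD by blast+
  show ?case
  proof (rule ck_SucI)
    show "B (\<lambda>i t x. f i t x * g i t x)"
      using Suc.prems assms(1) by (auto simp: growth_module_def)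
    show "cont2 (\<lambda>i t x. f i t x * g i t x)" using Suc.prems by (auto intro: cont2_mult)
    show "partials (\<lambda>i t x. f i t x * g i t x) (\<lambda>i t x. f i t x * g1 i t x + f1 i t x * g i t x)
     (\<lambda>i t x. f i t x * g2 i t x + f2 i t x * g i t x)"
      by (rule partials_mult) fact+
    show "ck B n (\<lambda>i t x. f i t x * g1 i t x + f1 i t x * g i t x)"
      by (rule ck_add[OF assms(1)]; rule Suc.IH; fact)
    show "ck B n (\<lambda>i t x. f i t x * g2 i t x + f2 i t x * g i t x)"
      by (rule ck_add[OF assms(1)]; rule Suc.IH; fact)
  qed
qed

lemma ck_const:
  assumes "B (\<lambda>i t x. c i)" "B (\<lambda>i t x. 0)"
  shows "ck B n (\<lambda>i t x. c i)"
  using assms(1)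
proof (induction n arbitrary: c)
  case 0 then show ?case by (simp add: cont2_def)
next
  case (Suc n)
  have "partials (\<lambda>i t x. c i) (\<lambda>i t x. 0) (\<lambda>i t x. 0)" by (simp add: partials_def)
  then show ?case
    using Suc.prems Suc.IH[of "\<lambda>_. 0"] assms(2) by (intro ck_SucI) (assumption | simp add: cont2_def)+
qed

text \<open>Only the exponential itself has to satisfy the bound \<open>B\<close>: each derivative
  multiplies it by a derivative of \<open>f\<close>, which lies in \<open>M\<close>.\<close>

lemma ck_exp:
  assumes B: "growth_module B M" and e: "B (\<lambda>i t x. exp (f i t x))" and f: "ck M n f"
  shows "ck B n (\<lambda>i t x. exp (f i t x))"
  using f
proof (induction n)
  case 0
  then show ?case using e by (auto simp: cont2_def intro!: continuous_intros)
next
  case (Suc n)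
  obtain f1 f2 where *: "partials f f1 f2" "ck M n f1" "ck M n f2" using Suc.prems by auto
  have IH: "ck B n (\<lambda>i t x. exp (f i t x))" using Suc ck_SucD by blast
  have "cont2 f" using Suc.prems by simp
  show ?case
  proof (rule ck_SucI)
    show "cont2 (\<lambda>i t x. exp (f i t x))"
      using \<open>cont2 f\<close> by (auto simp: cont2_def intro!: continuous_intros)
    show "partials (\<lambda>i t x. exp (f i t x)) (\<lambda>i t x. f1 i t x * exp (f i t x)) (\<lambda>i t x. f2 i t x * exp (f i t x))"
      using *(1) unfolding partials_def
      by (auto intro!: field_vector_diff_chain_at[of _ _ _ exp, unfolded o_def] derivative_eq_intros)
  qed (use e * IH ck_mult[OF B] in auto)
qed

lemma ck_reindex:
  assumes "\<And>f. B f \<Longrightarrow> B' (\<lambda>j. f (r j))" "ck B n f"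
  shows "ck B' n (\<lambda>j. f (r j))"
  using assms(2)
proof (induction n arbitrary: f)
  case 0
  then show ?case using assms(1) by (auto simp: cont2_def)
next
  case (Suc n)
  then obtain g h where *: "partials f g h" "ck B n g" "ck B n h" by auto
  show ?case
  proof (rule ck_SucI)
    show "B' (\<lambda>j. f (r j))" "cont2 (\<lambda>j. f (r j))" using Suc.prems assms(1) by (auto simp: cont2_def)
    show "partials (\<lambda>j. f (r j)) (\<lambda>j. g (r j)) (\<lambda>j. h (r j))" using *(1) by (auto simp: partials_def)
    show "ck B' n (\<lambda>j. g (r j))" "ck B' n (\<lambda>j. h (r j))" using Suc.IH * by auto
  qed
qed

lemma partials_pd: "partials f g h \<Longrightarrow> g = (\<lambda>i. pdt (f i)) \<and> h = (\<lambda>i. pdx (f i))"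
  unfolding partials_def pdt_def pdx_def by (intro conjI ext; metis vector_derivative_at)

text \<open>The witnesses hidden in \<open>ck\<close> could vary with the order. Uniqueness of
  derivatives identifies all of them with \<open>pdt\<close> and \<open>pdx\<close>, so the
  conditions of all orders pass to the partial derivatives.\<close>

lemma cinf_partials:
  assumes "cinf B f"
  shows "partials f (\<lambda>i. pdt (f i)) (\<lambda>i. pdx (f i))" "cinf B (\<lambda>i. pdt (f i))" "cinf B (\<lambda>i. pdx (f i))"
proof -
  have *: "partials f (\<lambda>i. pdt (f i)) (\<lambda>i. pdx (f i)) \<and> ck B n (\<lambda>i. pdt (f i)) \<and> ck B n (\<lambda>i. pdx (f i))" for n
  proof -
    have "ck B (Suc n) f" using assms unfolding cinf_def by blast
    then obtain g h where "partials f g h" "ck B n g" "ck B n h" by auto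
    with partials_pd[OF this(1)] show ?thesis by simp
  qed
  then show "partials f (\<lambda>i. pdt (f i)) (\<lambda>i. pdx (f i))" "cinf B (\<lambda>i. pdt (f i))" "cinf B (\<lambda>i. pdx (f i))"
    by (auto simp: cinf_def)
qed

lemma cinf_deriv:
  assumes "cinf B f"
  shows "((\<lambda>s. f i s x) has_vector_derivative pdt (f i) t x) (at t)"
        "((\<lambda>y. f i t y) has_vector_derivative pdx (f i) t x) (at x)"
  using cinf_partials(1)[OF assms] by (auto simp: partials_def)

lemma cinf_growth: "cinf B f \<Longrightarrow> B f"
  and cinf_cont2: "cinf B f \<Longrightarrow> cont2 f"
  and cinf_unconstrained: "cinf B f \<Longrightarrow> cinf unconstrained f"
  by (auto simp: cinf_def intro: ck_growth ck_cont2 ck_unconstrained)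

lemma cinf_add: "growth_module B M \<Longrightarrow> cinf B f \<Longrightarrow> cinf B g \<Longrightarrow> cinf B (\<lambda>i t x. f i t x + g i t x)"
  and cinf_mult: "growth_module B M \<Longrightarrow> cinf M f \<Longrightarrow> cinf B g \<Longrightarrow> cinf B (\<lambda>i t x. f i t x * g i t x)"
  and cinf_exp: "growth_module B M \<Longrightarrow> B (\<lambda>i t x. exp (f i t x)) \<Longrightarrow> cinf M f \<Longrightarrow> cinf B (\<lambda>i t x. exp (f i t x))"
  by (auto simp: cinf_def intro: ck_add ck_mult ck_exp)

lemma ck_moderate_const: "ck moderate n (\<lambda>i t x. c)"
  by (rule ck_const) (auto intro: moderate_bounded[of _ "norm c"])

lemma ck_moderate_x: "ck moderate n (\<lambda>i t x. complex_of_real x)"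
proof -
  have "moderate (\<lambda>i t x. complex_of_real x)" by (rule moderateI[of _ 1 1]) auto
  moreover have "cont2 (\<lambda>i t x. complex_of_real x)" by (auto simp: cont2_def intro!: continuous_intros)
  moreover have "partials (\<lambda>i t x. complex_of_real x) (\<lambda>i t x. 0) (\<lambda>i t x. 1)"
    by (auto simp: partials_def intro!: derivative_eq_intros has_vector_derivative_of_real[of "\<lambda>x. x" 1, simplified])
  ultimately show ?thesis
    by (cases n) (auto intro: ck_moderate_const simp del: ck.simps(2) intro!: ck_SucI)
qed

lemma cinf_moderate_const: "cinf moderate (\<lambda>i t x. c)"
  and cinf_moderate_x: "cinf moderate (\<lambda>i t x. complex_of_real x)"
  by (auto simp: cinf_def ck_moderate_const ck_moderate_x)

section \<open>Schwartz functions\<close>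

lemma leibniz_interval:
  fixes f :: "real \<Rightarrow> real \<Rightarrow> complex"
  assumes "\<And>x s. ((\<lambda>x. f x s) has_vector_derivative f' x s) (at x)"
    and "continuous_on UNIV (\<lambda>p. f' (fst p) (snd p))"
    and "\<And>x. continuous_on UNIV (f x)"
  shows "((\<lambda>x. integral {a..b} (f x)) has_vector_derivative integral {a..b} (f' x0)) (at x0)"
proof -
  have "((\<lambda>x. integral (cbox a b) (f x)) has_vector_derivative integral (cbox a b) (f' x0)) (at x0 within UNIV)"
  proof (rule leibniz_rule_vector_derivative)
    show "(f x) integrable_on cbox a b" for x
      using assms(3) by (auto intro: integrable_continuous_real continuous_on_subset)
    show "continuous_on (UNIV \<times> cbox a b) (\<lambda>(x, t). f' x t)"
      using assms(2) by (auto simp: split_beta intro: continuous_on_subset)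
  qed (use assms in auto)
  then show ?thesis by simp
qed

lemma continuous_integral_param:
  fixes f :: "real \<times> real \<Rightarrow> real \<Rightarrow> complex"
  assumes "continuous_on UNIV (\<lambda>p. f (fst p) (snd p))"
  shows "continuous_on UNIV (\<lambda>p. integral {a..b} (f p))"
proof -
  have "continuous_on (UNIV \<times> cbox a b) (\<lambda>(x, t). f x t)"
    using assms by (auto simp: split_beta intro: continuous_on_subset)
  from integral_continuous_on_param[OF this] show ?thesis by simp
qed

lemma cont2_compose:
  assumes "cont2 f" "continuous_on UNIV a" "continuous_on UNIV b"
  shows "continuous_on UNIV (\<lambda>p. f i (a p) (b p))"
proof -
  have "continuous_on UNIV (\<lambda>p. f i (fst p) (snd p))" using assms by (simp add: cont2_def)
  from continuous_on_compose2[OF this, of UNIV "\<lambda>p. (a p, b p)"] assms show ?thesis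
    by (auto intro!: continuous_intros)
qed

text \<open>The existence of the \<open>t\<close>-derivative of \<open>fx\<close> is part of the
  conclusion. Writing \<open>f\<close> as an integral of \<open>ft\<close> over \<open>t\<close> and
  differentiating under the integral in \<open>x\<close> exhibits \<open>fx\<close> as an integral
  of \<open>ftx\<close>.\<close>

lemma clairaut:
  fixes f :: tfun
  assumes ft: "\<And>t x. ((\<lambda>s. f s x) has_vector_derivative ft t x) (at t)"
    and fx: "\<And>t x. ((\<lambda>y. f t y) has_vector_derivative fx t x) (at x)"
    and ftx: "\<And>t x. ((\<lambda>y. ft t y) has_vector_derivative ftx t x) (at x)"
    and cont: "continuous_on UNIV (\<lambda>p. ft (fst p) (snd p))" "continuous_on UNIV (\<lambda>p. ftx (fst p) (snd p))"
  shows "((\<lambda>s. fx s x) has_vector_derivative ftx t x) (at t)"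
proof -
  \<comment> \<open>Any base point strictly to the left of \<open>t\<close> would do: the integrals
    over \<open>{a..s}\<close> then represent \<open>fx\<close> in a whole neighbourhood of
    \<open>t\<close>.\<close>
  define a where "a = t - 1"
  have c1: "continuous_on UNIV (\<lambda>s. ft s y)" for y
    using continuous_on_compose2[OF cont(1), of UNIV "\<lambda>s. (s, y)"] by (simp add: continuous_on_Pair)
  have c2: "continuous_on UNIV (\<lambda>s. ftx s y)" for y
    using continuous_on_compose2[OF cont(2), of UNIV "\<lambda>s. (s, y)"] by (simp add: continuous_on_Pair)
  have c3: "continuous_on UNIV (\<lambda>p. ftx (snd p) (fst p))"
    using continuous_on_compose2[OF cont(2), of UNIV "\<lambda>p. (snd p, fst p)"] by (simp add: continuous_on_Pair continuous_on_fst continuous_on_snd)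
  have eq: "fx s x = fx a x + integral {a..s} (\<lambda>r. ftx r x)" if "a \<le> s" for s
  proof -
    have "f s y = f a y + integral {a..s} (\<lambda>r. ft r y)" for y
      using integral_unique[OF fundamental_theorem_of_calculus[OF that has_vector_derivative_at_within[OF ft]]]
      by simp
    then have "((\<lambda>y. f s y) has_vector_derivative (fx a x + integral {a..s} (\<lambda>r. ftx r x))) (at x)"
      using has_vector_derivative_add[OF fx[of a x] leibniz_interval[of "\<lambda>y r. ft r y" "\<lambda>y r. ftx r y" a s x, OF ftx c3 c1]]
      by simp
    with fx[of s x] show ?thesis by (rule vector_derivative_unique_at)
  qed
  have "((\<lambda>s. integral {a..s} (\<lambda>r. ftx r x)) has_vector_derivative ftx t x) (at t within {a..t+1})"
    by (rule integral_has_vector_derivative) (auto simp: a_def intro: continuous_on_subset[OF c2])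
  then have "((\<lambda>s. integral {a..s} (\<lambda>r. ftx r x)) has_vector_derivative ftx t x) (at t)"
    by (subst (asm) at_within_interior) (auto simp: a_def)
  from has_vector_derivative_add[OF has_vector_derivative_const this, of "fx a x"]
  have "((\<lambda>s. fx a x + integral {a..s} (\<lambda>r. ftx r x)) has_vector_derivative ftx t x) (at t)" by simp
  then show ?thesis
  proof (rule has_vector_derivative_transform_within_open)
    show "open {a<..}" "t \<in> {a<..}" by (auto simp: a_def)
    show "fx a x + integral {a..s} (\<lambda>r. ftx r x) = fx s x" if "s \<in> {a<..}" for s
      using eq[of s] that by simp
  qed
qed

lemma cinf_clairaut:
  assumes "cinf B f"
  shows "pdt (pdx (f i)) = pdx (pdt (f i))"
proof (intro ext)
  fix t x
  note A = cinf_partials[OF assms]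
  have "((\<lambda>s. pdx (f i) s x) has_vector_derivative pdx (pdt (f i)) t x) (at t)"
    by (rule clairaut[OF cinf_deriv[OF assms] cinf_deriv(2)[OF A(2)]])
      (use cinf_cont2[OF A(2)] cinf_cont2[OF cinf_partials(3)[OF A(2)]] in \<open>auto simp: cont2_def\<close>)
  then show "pdt (pdx (f i)) t x = pdx (pdt (f i)) t x" by (simp add: pdt_def vector_derivative_at)
qed

section \<open>The Schwartz class as the periodic part of \<open>cinf rapid\<close>\<close>

lemma apply_partials_append: "apply_partials (xs @ ys) f = apply_partials xs (apply_partials ys f)"
  by (induction xs) auto

lemma smooth2_cinf:
  assumes "smooth2 f"
  shows "cinf unconstrained (\<lambda>i. apply_partials ws f)"
proof -
  have "ck unconstrained n (\<lambda>i. apply_partials ws f)" for n ws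
  proof (induction n arbitrary: ws)
    case 0
    then show ?case using assms by (auto simp: unconstrained_def cont2_def smooth2_def)
  next
    case (Suc n)
    show ?case
    proof (rule ck_SucI)
      show "partials (\<lambda>i. apply_partials ws f) (\<lambda>i. apply_partials (True # ws) f) (\<lambda>i. apply_partials (False # ws) f)"
        using assms unfolding partials_def smooth2_def
        by (auto simp: pdt_def pdx_def vector_derivative_works[symmetric])
    qed (use Suc.IH assms in \<open>auto simp: unconstrained_def cont2_def smooth2_def simp del: apply_partials.simps\<close>)
  qed
  then show ?thesis by (auto simp: cinf_def)
qed

text \<open>The seminorms only see derivatives with all \<open>pdt\<close> applied after all
  \<open>pdx\<close>, whereas smoothness speaks of arbitrary words. Commuting the two operators
  brings each word into the order of the seminorms.\<close>

lemma apply_partials_normal_form: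
  assumes "smooth2 f"
  shows "\<exists>a b. apply_partials ws f = (pdt ^^ a) ((pdx ^^ b) f)"
proof (induction ws)
  case Nil
  have "f = (pdt ^^ 0) ((pdx ^^ 0) f)" by simp
  then show ?case by (metis apply_partials.simps(1))
next
  case (Cons d ws)
  have words: "apply_partials (replicate a True @ replicate b False) f = (pdt ^^ a) ((pdx ^^ b) f)" for a b
  proof (induction a)
    case 0
    show ?case by (induction b) auto
  qed auto
  have comm: "pdx ((pdt ^^ a) ((pdx ^^ b) f)) = (pdt ^^ a) ((pdx ^^ Suc b) f)" for a b
  proof (induction a)
    case (Suc a)
    have "pdx (pdt ((pdt ^^ a) ((pdx ^^ b) f))) = pdt (pdx ((pdt ^^ a) ((pdx ^^ b) f)))"
      using cinf_clairaut[OF smooth2_cinf[OF assms, of "replicate a True @ replicate b False"]]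
      unfolding words by simp
    then show ?case using Suc by simp
  qed simp
  obtain a b where ab: "apply_partials ws f = (pdt ^^ a) ((pdx ^^ b) f)" using Cons by auto
  show ?case
  proof (cases d)
    case True
    then have "apply_partials (d # ws) f = (pdt ^^ Suc a) ((pdx ^^ b) f)" using ab by simp
    then show ?thesis by blast
  next
    case False
    then have "apply_partials (d # ws) f = (pdt ^^ a) ((pdx ^^ Suc b) f)" using ab comm by simp
    then show ?thesis by blast
  qed
qed

lemma one_plus_power_le: "(1 + \<bar>x::real\<bar>) ^ N \<le> 2 ^ N * (1 + \<bar>x\<bar> ^ N)"
proof (cases "\<bar>x\<bar> \<le> 1")
  case True
  then have "(1 + \<bar>x\<bar>) ^ N \<le> 2 ^ N" by (intro power_mono) auto
  also have "\<dots> \<le> 2 ^ N * (1 + \<bar>x\<bar> ^ N)" by simp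
  finally show ?thesis .
next
  case False
  then have "(1 + \<bar>x\<bar>) ^ N \<le> (2 * \<bar>x\<bar>) ^ N" by (intro power_mono) auto
  also have "\<dots> \<le> 2 ^ N * (1 + \<bar>x\<bar> ^ N)" by (simp add: power_mult_distrib)
  finally show ?thesis .
qed

lemma rapidI:
  assumes "\<And>N. \<exists>C. \<forall>i t x. \<bar>x\<bar> ^ N * norm (f i t x) \<le> C"
  shows "rapid f"
  unfolding rapid_def
proof
  fix N
  obtain C D where C: "\<And>i t x. \<bar>x\<bar> ^ N * norm (f i t x) \<le> C" and D: "\<And>i t x. \<bar>x\<bar> ^ 0 * norm (f i t x) \<le> D"
    using assms by metis
  have "norm (f i t x) * (1 + \<bar>x\<bar>) ^ N \<le> 2 ^ N * (C + D)" for i t x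
  proof -
    have "norm (f i t x) * (1 + \<bar>x\<bar>) ^ N \<le> norm (f i t x) * (2 ^ N * (1 + \<bar>x\<bar> ^ N))"
      by (intro mult_left_mono one_plus_power_le) auto
    also have "\<dots> = 2 ^ N * (\<bar>x\<bar> ^ N * norm (f i t x) + \<bar>x\<bar> ^ 0 * norm (f i t x))" by (simp add: algebra_simps)
    also have "\<dots> \<le> 2 ^ N * (C + D)" by (intro mult_left_mono add_mono C D) auto
    finally show ?thesis .
  qed
  then show "\<exists>C. \<forall>i t x. norm (f i t x) * (1 + \<bar>x\<bar>) ^ N \<le> C" by blast
qed

lemma rapidD: "rapid f \<Longrightarrow> \<exists>C\<ge>0. \<forall>i t x. \<bar>x\<bar> ^ N * norm (f i t x) \<le> C"
proof -
  assume "rapid f"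
  then obtain C where C: "\<And>i t x. norm (f i t x) * (1 + \<bar>x\<bar>) ^ N \<le> C" unfolding rapid_def by blast
  have "\<bar>x\<bar> ^ N * norm (f i t x) \<le> C" for i t x
  proof -
    have "\<bar>x\<bar> ^ N * norm (f i t x) \<le> (1 + \<bar>x\<bar>) ^ N * norm (f i t x)"
      by (intro mult_right_mono power_mono) auto
    then show ?thesis using C[of i t x] by (simp add: mult_ac)
  qed
  moreover have "0 \<le> C" using C[of undefined 0 0] by (simp add: order_trans[OF norm_ge_zero])
  ultimately show ?thesis by blast
qed

text \<open>A Schwartz function enters the theory as a constant family over an arbitrary index type,
  so that results on families apply to single functions.\<close>

lemma schwartz_cinf:
  assumes "f \<in> schwartz"
  shows "cinf rapid (\<lambda>i::'i. f)"
proof -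
  have sm: "smooth2 f" using assms by (simp add: schwartz_def)
  have r: "rapid (\<lambda>i::'i. apply_partials ws f)" for ws
  proof (rule rapidI)
    fix N
    obtain a b where ab: "apply_partials ws f = (pdt ^^ a) ((pdx ^^ b) f)"
      using apply_partials_normal_form[OF sm] by blast
    have "bdd_above (range (schwartz_term a b N f))" using assms by (simp add: schwartz_def)
    then obtain C where "\<And>p. schwartz_term a b N f p \<le> C" unfolding bdd_above_def by auto
    from this[of "(t, x)" for t x] show "\<exists>C. \<forall>i t x. \<bar>x\<bar> ^ N * norm (apply_partials ws f t x) \<le> C"
      by (auto simp: schwartz_term_def norm_mult norm_power ab)
  qed
  have "ck rapid n (\<lambda>i::'i. apply_partials ws f)" for n ws
  proof (induction n arbitrary: ws)
    case 0
    then show ?case using r sm by (auto simp: cont2_def smooth2_def)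
  next
    case (Suc n)
    show ?case
    proof (rule ck_SucI)
      show "partials (\<lambda>i::'i. apply_partials ws f) (\<lambda>i::'i. apply_partials (True # ws) f) (\<lambda>i::'i. apply_partials (False # ws) f)"
        using sm unfolding partials_def smooth2_def
        by (auto simp: pdt_def pdx_def vector_derivative_works[symmetric])
    qed (use Suc.IH r sm in \<open>auto simp: cont2_def smooth2_def simp del: apply_partials.simps\<close>)
  qed
  from this[of _ "[]"] show ?thesis by (simp add: cinf_def)
qed

lemma cinf_schwartz:
  assumes f: "cinf rapid (\<lambda>i::'i. f)" and per: "periodic_t f"
  shows "f \<in> schwartz"
proof -
  have w: "cinf rapid (\<lambda>i::'i. apply_partials ws f)" for ws
    by (induction ws) (use f in \<open>auto intro: cinf_partials(2,3)\<close>)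
  have 1: "(\<lambda>s. apply_partials ws f s x) differentiable (at t)" "(\<lambda>y. apply_partials ws f t y) differentiable (at x)" for ws t x
    using cinf_deriv[OF w, THEN differentiableI_vector] by auto
  have 2: "continuous_on UNIV (\<lambda>p. apply_partials ws f (fst p) (snd p))" for ws
    using cinf_cont2[OF w] by (simp add: cont2_def)
  have "bdd_above (range (schwartz_term a b N f))" for a b N
  proof -
    have words: "apply_partials (replicate a True @ replicate b False) f = (pdt ^^ a) ((pdx ^^ b) f)"
      unfolding apply_partials_append
    proof (induction a)
      case 0
      show ?case by (induction b) auto
    qed auto
    have "rapid (\<lambda>i::'i. (pdt ^^ a) ((pdx ^^ b) f))" using cinf_growth[OF w] words by metis
    from rapidD[OF this, of N] obtain C where
      C: "\<And>t x. \<bar>x\<bar> ^ N * norm ((pdt ^^ a) ((pdx ^^ b) f) t x) \<le> C" by blast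
    show ?thesis
      by (rule bdd_aboveI2[of _ _ C]) (use C in \<open>auto simp: schwartz_term_def norm_mult norm_power\<close>)
  qed
  then show ?thesis using 1 2 per by (auto simp: schwartz_def smooth2_def)
qed

section \<open>Functions of one variable, periodicity and primitives\<close>

lemma ck_of_seq_t:
  assumes "\<And>n t. (F n has_vector_derivative F (Suc n) t) (at t)"
    and "\<And>n. B (\<lambda>i t x. F n t)" "B (\<lambda>i t x. 0)"
  shows "ck B k (\<lambda>i t x. F n t)"
proof (induction k arbitrary: n)
  case 0
  have "continuous_on UNIV (F n)" for n
    using assms(1) by (meson continuous_at_imp_continuous_on has_vector_derivative_continuous)
  then have "cont2 (\<lambda>i t x. F n t)" for n
    unfolding cont2_def by (intro allI continuous_on_compose2[of UNIV "F n" UNIV fst] continuous_intros) auto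
  then show ?case using assms(2) by auto
next
  case (Suc k)
  show ?case
  proof (rule ck_SucI)
    show "partials (\<lambda>i t x. F n t) (\<lambda>i t x. F (Suc n) t) (\<lambda>i t x. 0)" using assms(1) by (auto simp: partials_def)
  qed (use Suc.IH assms(2,3) ck_cont2[OF Suc.IH] ck_const[where c="\<lambda>_. 0" and B=B] in auto)
qed

lemma ck_of_seq_x:
  assumes "\<And>n t. (F n has_vector_derivative F (Suc n) t) (at t)"
    and "\<And>n. B (\<lambda>i t x. F n x)" "B (\<lambda>i t x. 0)"
  shows "ck B k (\<lambda>i t x. F n x)"
proof (induction k arbitrary: n)
  case 0
  have "continuous_on UNIV (F n)" for n
    using assms(1) by (meson continuous_at_imp_continuous_on has_vector_derivative_continuous)
  then have "cont2 (\<lambda>i t x. F n x)" for n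
    unfolding cont2_def by (intro allI continuous_on_compose2[of UNIV "F n" UNIV snd] continuous_intros) auto
  then show ?case using assms(2) by auto
next
  case (Suc k)
  show ?case
  proof (rule ck_SucI)
    show "partials (\<lambda>i t x. F n x) (\<lambda>i t x. 0) (\<lambda>i t x. F (Suc n) x)" using assms(1) by (auto simp: partials_def)
  qed (use Suc.IH assms(2,3) ck_cont2[OF Suc.IH] ck_const[where c="\<lambda>_. 0" and B=B] in auto)
qed

text \<open>A sequence of successive derivatives serves as witness, so explicit formulas can be
  given for them and no iterated \<open>vector_derivative\<close> has to be computed.\<close>

definition smooth1 :: "(real \<Rightarrow> complex) \<Rightarrow> bool" where
  "smooth1 \<phi> \<longleftrightarrow> (\<exists>F. F 0 = \<phi> \<and> (\<forall>n x. (F n has_vector_derivative F (Suc n) x) (at x)))"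

lemma cinf_of_smooth1:
  assumes "smooth1 \<phi>"
  shows "cinf unconstrained (\<lambda>i t x. \<phi> t)" "cinf unconstrained (\<lambda>i t x. \<phi> x)"
proof -
  obtain F where F: "F 0 = \<phi>" "\<And>n x. (F n has_vector_derivative F (Suc n) x) (at x)"
    using assms by (auto simp: smooth1_def)
  show "cinf unconstrained (\<lambda>i t x. \<phi> t)" "cinf unconstrained (\<lambda>i t x. \<phi> x)"
    using ck_of_seq_t[of F unconstrained _ 0] ck_of_seq_x[of F unconstrained _ 0] F
    by (auto simp: cinf_def unconstrained_def)
qed

lemma smooth1_of_cinf:
  assumes "cinf B f"
  shows "smooth1 (\<lambda>t. f i t x)" "smooth1 (\<lambda>x. f i t x)"
proof -
  have 1: "cinf B (\<lambda>i. (pdt ^^ n) (f i))" for n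
    by (induction n) (use assms in \<open>auto intro: cinf_partials(2)\<close>)
  have 2: "cinf B (\<lambda>i. (pdx ^^ n) (f i))" for n
    by (induction n) (use assms in \<open>auto intro: cinf_partials(3)\<close>)
  show "smooth1 (\<lambda>t. f i t x)" unfolding smooth1_def
    by (rule exI[of _ "\<lambda>n t. (pdt ^^ n) (f i) t x"]) (use cinf_deriv(1)[OF 1] in auto)
  show "smooth1 (\<lambda>x. f i t x)" unfolding smooth1_def
    by (rule exI[of _ "\<lambda>n x. (pdx ^^ n) (f i) t x"]) (use cinf_deriv(2)[OF 2] in auto)
qed

lemma periodic_int:
  assumes "\<And>t. f (t + 2 * pi) = f t"
  shows "f (t + 2 * pi * of_int k) = f t"
proof (induction k rule: int_induct[where k=0])
  case (step1 i)
  then show ?case using assms[of "t + 2 * pi * of_int i"] by (simp add: algebra_simps)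
next
  case (step2 i)
  then show ?case using assms[of "t + 2 * pi * of_int (i - 1)"] by (simp add: algebra_simps)
qed simp

lemma periodic_reduce:
  fixes t a :: real
  obtains k :: int where "t + 2 * pi * of_int k \<in> {a..<a + 2 * pi}"
proof -
  define k where "k = - \<lfloor>(t - a) / (2 * pi)\<rfloor>"
  have "of_int \<lfloor>(t - a) / (2 * pi)\<rfloor> \<le> (t - a) / (2 * pi)" "(t - a) / (2 * pi) < of_int \<lfloor>(t - a) / (2 * pi)\<rfloor> + 1"
    by linarith+
  then have "of_int \<lfloor>(t - a) / (2 * pi)\<rfloor> * (2 * pi) \<le> t - a"
    "t - a < (of_int \<lfloor>(t - a) / (2 * pi)\<rfloor> + 1) * (2 * pi)"
    by (simp_all only: pos_le_divide_eq pos_divide_less_eq pi_gt_zero mult_pos_pos zero_less_numeral)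
  then have "t + 2 * pi * of_int k \<in> {a..<a + 2 * pi}"
    unfolding k_def by (simp add: algebra_simps)
  then show thesis by (rule that)
qed

lemma periodic_bounded:
  fixes f :: "real \<Rightarrow> complex"
  assumes "\<And>t. f (t + 2 * pi) = f t" "continuous_on UNIV f"
  shows "\<exists>C\<ge>0. \<forall>t. norm (f t) \<le> C"
proof -
  have "compact (f ` {0..2 * pi})"
    using assms(2) by (intro compact_continuous_image) (auto intro: continuous_on_subset)
  then obtain C where C: "\<And>y. y \<in> f ` {0..2 * pi} \<Longrightarrow> norm y \<le> C"
    by (meson compact_imp_bounded bounded_iff)
  have "norm (f t) \<le> C" for t
  proof -
    obtain k :: int where "t + 2 * pi * of_int k \<in> {0..<0 + 2 * pi}" by (rule periodic_reduce)
    then have "norm (f (t + 2 * pi * of_int k)) \<le> C" by (intro C) auto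
    then show ?thesis using periodic_int[of f, OF assms(1)] by simp
  qed
  moreover have "0 \<le> C" using order_trans[OF norm_ge_zero C[of "f 0"]] by simp
  ultimately show ?thesis by blast
qed

lemma vector_derivative_periodic:
  assumes "\<And>t. f (t + 2 * pi) = f t" "\<And>t. (f has_vector_derivative f' t) (at t)"
  shows "f' (t + 2 * pi) = f' t"
proof -
  have "((f \<circ> (\<lambda>t. t + 2 * pi)) has_vector_derivative (1 *\<^sub>R f' (t + 2 * pi))) (at t)"
    by (rule vector_diff_chain_at) (auto intro!: derivative_eq_intros assms(2)
        simp: has_real_derivative_iff_has_vector_derivative[symmetric])
  then have "(f has_vector_derivative f' (t + 2 * pi)) (at t)"
    using assms(1) by (simp add: o_def)
  then show ?thesis using assms(2) vector_derivative_unique_at by blast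
qed

text \<open>All derivatives are continuous and periodic, hence bounded. This makes the coefficients
  admissible factors for rapidly decreasing families.\<close>

lemma smooth_periodicD:
  assumes "smooth_periodic c"
  shows "smooth1 c" "c (t + 2 * pi) = c t" "cinf moderate (\<lambda>i::'i. \<lambda>t x. c t)"
proof -
  define F where "F = (\<lambda>n. ((\<lambda>g s. vector_derivative g (at s)) ^^ n) c)"
  have F: "(F n has_vector_derivative F (Suc n) t) (at t)" for n t
    using assms unfolding smooth_periodic_def F_def by (simp add: vector_derivative_works[symmetric])
  have F0: "F 0 = c" by (simp add: F_def)
  show "c (t + 2 * pi) = c t" for t using assms by (simp add: smooth_periodic_def)
  then have per: "F n (t + 2 * pi) = F n t" for n t
    by (induction n arbitrary: t) (auto simp: F0 intro: vector_derivative_periodic F)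
  show "smooth1 c" unfolding smooth1_def using F F0 by blast
  have "continuous_on UNIV (F n)" for n
    using F by (meson continuous_at_imp_continuous_on has_vector_derivative_continuous)
  then have "\<exists>C\<ge>0. \<forall>t. norm (F n t) \<le> C" for n
    by (rule periodic_bounded[of "F n" for n, OF per])
  then have "moderate (\<lambda>i::'i. \<lambda>t x. F n t)" for n
    by (meson moderate_bounded)
  from ck_of_seq_t[of F moderate, OF F this moderate_bounded[of _ 0]]
  have "ck moderate k (\<lambda>i::'i. \<lambda>t x. F 0 t)" for k by simp
  then show "cinf moderate (\<lambda>i::'i. \<lambda>t x. c t)" by (simp add: cinf_def F0)
qed

lemma has_vector_derivative_dilate:
  assumes "\<And>t. (f has_vector_derivative f' t) (at t)"
  shows "((\<lambda>t. f (a * t)) has_vector_derivative a *\<^sub>R f' (a * t)) (at t)"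
    "((\<lambda>t. f (t * a)) has_vector_derivative a *\<^sub>R f' (t * a)) (at t)"
proof -
  have "((\<lambda>t. a * t) has_vector_derivative a) (at t)"
    by (auto intro!: derivative_eq_intros simp: has_real_derivative_iff_has_vector_derivative[symmetric])
  from vector_diff_chain_at[OF this assms]
  show "((\<lambda>t. f (a * t)) has_vector_derivative a *\<^sub>R f' (a * t)) (at t)" by (simp add: o_def)
  then show "((\<lambda>t. f (t * a)) has_vector_derivative a *\<^sub>R f' (t * a)) (at t)" by (simp add: mult.commute)
qed

text \<open>The substitution \<open>s = \<sigma> * t\<close> makes the integral from \<open>0\<close> to \<open>t\<close> meaningful for negative \<open>t\<close> too.\<close>

definition prim_t :: "('i \<Rightarrow> tfun) \<Rightarrow> 'i \<Rightarrow> tfun" where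
  "prim_t f i t x = complex_of_real t * integral {0..1} (\<lambda>\<sigma>. f i (\<sigma> * t) x)"

lemma prim_t_0: "prim_t f i 0 x = 0"
  by (simp add: prim_t_def)

text \<open>With \<open>I t\<close> denoting the inner integral, the product rule gives
  \<open>I t + t * I' t\<close>. This is the integral over \<open>{0..1}\<close> of the
  \<sigma>-derivative of \<open>\<sigma> * f (\<sigma> * t)\<close>, and so equals
  \<open>f t\<close>.\<close>

lemma prim_t_partials:
  assumes "cinf unconstrained f"
  shows "partials (prim_t f) f (prim_t (\<lambda>i. pdx (f i)))"
proof -
  note P = cinf_partials[OF assms]
  note c0 = cont2_compose[OF cinf_cont2[OF assms]]
  note c1 = cont2_compose[OF cinf_cont2[OF P(2)]]
  note c2 = cont2_compose[OF cinf_cont2[OF P(3)]]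
  have "((\<lambda>s. prim_t f i s x) has_vector_derivative f i t x) (at t)" for i t x
  proof -
    define I where "I = (\<lambda>t. integral {0..1} (\<lambda>\<sigma>. f i (\<sigma> * t) x))"
    have chain: "((\<lambda>t. f i (\<sigma> * t) x) has_vector_derivative \<sigma> *\<^sub>R pdt (f i) (\<sigma> * t) x) (at t)" for \<sigma> t
      by (rule has_vector_derivative_dilate[of "\<lambda>s. f i s x", OF cinf_deriv(1)[OF assms]])
    have chain2: "((\<lambda>\<sigma>. f i (\<sigma> * t) x) has_vector_derivative t *\<^sub>R pdt (f i) (\<sigma> * t) x) (at \<sigma>)" for \<sigma> t
      by (rule has_vector_derivative_dilate[of "\<lambda>s. f i s x", OF cinf_deriv(1)[OF assms]])
    have dI: "(I has_vector_derivative integral {0..1} (\<lambda>\<sigma>. \<sigma> *\<^sub>R pdt (f i) (\<sigma> * t) x)) (at t)"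
      unfolding I_def
      by (rule leibniz_interval) (auto intro!: chain c0 c1 continuous_intros)
    have "((\<lambda>s. complex_of_real s * I s) has_vector_derivative
        complex_of_real t * integral {0..1} (\<lambda>\<sigma>. \<sigma> *\<^sub>R pdt (f i) (\<sigma> * t) x) + 1 * I t) (at t)"
      by (rule has_vector_derivative_mult[OF _ dI])
        (use has_vector_derivative_of_real[of "\<lambda>x. x" 1] in \<open>auto intro!: derivative_eq_intros\<close>)
    moreover have "complex_of_real t * integral {0..1} (\<lambda>\<sigma>. \<sigma> *\<^sub>R pdt (f i) (\<sigma> * t) x) + 1 * I t = f i t x"
    proof -
      have "((\<lambda>\<sigma>. complex_of_real t * (\<sigma> *\<^sub>R pdt (f i) (\<sigma> * t) x) + f i (\<sigma> * t) x) has_integral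
          1 *\<^sub>R f i (1 * t) x - 0 *\<^sub>R f i (0 * t) x) {0..1}"
      proof (rule fundamental_theorem_of_calculus)
        fix \<sigma> :: real
        have "((\<lambda>\<sigma>. \<sigma> *\<^sub>R f i (\<sigma> * t) x) has_vector_derivative
            (\<sigma> *\<^sub>R (t *\<^sub>R pdt (f i) (\<sigma> * t) x) + 1 *\<^sub>R f i (\<sigma> * t) x)) (at \<sigma>)"
          by (rule has_vector_derivative_scaleR[OF DERIV_ident chain2])
        then show "((\<lambda>\<sigma>. \<sigma> *\<^sub>R f i (\<sigma> * t) x) has_vector_derivative
            complex_of_real t * (\<sigma> *\<^sub>R pdt (f i) (\<sigma> * t) x) + f i (\<sigma> * t) x) (at \<sigma> within {0..1})"
          by (rule has_vector_derivative_at_within[OF back_subst[of "\<lambda>d. (_ has_vector_derivative d) _"]])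
            (simp only: scaleR_conv_of_real of_real_1 mult_1_left mult.left_commute)
      qed simp
      moreover have "((\<lambda>\<sigma>. complex_of_real t * (\<sigma> *\<^sub>R pdt (f i) (\<sigma> * t) x) + f i (\<sigma> * t) x) has_integral
          complex_of_real t * integral {0..1} (\<lambda>\<sigma>. \<sigma> *\<^sub>R pdt (f i) (\<sigma> * t) x) + I t) {0..1}"
        unfolding I_def
        by (intro has_integral_add has_integral_mult_right integrable_integral integrable_continuous_real;
            rule continuous_on_subset[OF _ subset_UNIV]; intro continuous_intros c0 c1)
      from has_integral_unique[OF this calculation] show ?thesis by simp
    qed
    ultimately show ?thesis by (simp add: prim_t_def I_def)
  qed
  moreover have "((\<lambda>y. prim_t f i t y) has_vector_derivative prim_t (\<lambda>i. pdx (f i)) i t x) (at x)" for i t x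
  proof -
    have "((\<lambda>y. integral {0..1} (\<lambda>\<sigma>. f i (\<sigma> * t) y)) has_vector_derivative
        integral {0..1} (\<lambda>\<sigma>. pdx (f i) (\<sigma> * t) x)) (at x)"
      by (rule leibniz_interval) (auto intro!: cinf_deriv(2)[OF assms] c0 c2 continuous_intros)
    then show ?thesis unfolding prim_t_def
      using has_vector_derivative_mult_right by blast
  qed
  ultimately show ?thesis by (auto simp: partials_def)
qed

lemma cont2_prim_t: "cont2 f \<Longrightarrow> cont2 (prim_t f)"
  unfolding cont2_def[of "prim_t f"] prim_t_def
  by (intro allI continuous_intros continuous_integral_param cont2_compose)

lemma cinf_prim_t:
  assumes "cinf unconstrained f"
  shows "cinf unconstrained (prim_t f)"
proof -
  have "ck unconstrained n (prim_t f)" for n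
    using assms
  proof (induction n arbitrary: f)
    case 0
    then show ?case by (simp add: cont2_prim_t cinf_cont2 unconstrained_def)
  next
    case (Suc n)
    have "ck unconstrained n f" using Suc.prems by (simp add: cinf_def)
    moreover have "ck unconstrained n (prim_t (\<lambda>i. pdx (f i)))"
      using Suc cinf_partials(3) by blast
    ultimately show ?case
      by (intro ck_SucI[of unconstrained, OF _ cont2_prim_t prim_t_partials] cinf_cont2[OF Suc.prems] Suc.prems)
        (simp_all add: unconstrained_def)
  qed
  then show ?thesis by (simp add: cinf_def)
qed

section \<open>The Fourier transform in the second variable\<close>

lemma integrable_inverse_square: "integrable lborel (\<lambda>x::real. C / (1 + x\<^sup>2))"
  using integrable_inverse_1_plus_square
  by (simp add: set_integrable_def divide_inverse)

lemma integrable_dominated: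
  fixes g :: "real \<Rightarrow> complex"
  assumes "continuous_on UNIV g" "\<And>x. norm (g x) \<le> C / (1 + x\<^sup>2)"
  shows "integrable lborel g"
proof (rule Bochner_Integration.integrable_bound[OF integrable_inverse_square[of C]])
  show "g \<in> borel_measurable lborel"
    using assms(1) by (simp add: borel_measurable_continuous_onI)
  show "AE x in lborel. norm (g x) \<le> norm (C / (1 + x\<^sup>2))"
    using assms(2) by (intro AE_I2) (metis abs_ge_self order_trans real_norm_def)
qed

lemma rapid_dominated:
  assumes "rapid f"
  shows "\<exists>C\<ge>0. \<forall>i t x. norm (f i t x) \<le> C / (1 + x\<^sup>2)"
proof -
  obtain C where C: "\<And>i t x. norm (f i t x) * (1 + \<bar>x\<bar>) ^ 2 \<le> C"
    using assms unfolding rapid_def by blast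
  have "norm (f i t x) \<le> C / (1 + x\<^sup>2)" for i t x
  proof -
    have "norm (f i t x) * (1 + x\<^sup>2) \<le> norm (f i t x) * (1 + \<bar>x\<bar>) ^ 2"
      by (intro mult_left_mono) (auto simp: power2_eq_square algebra_simps)
    then show ?thesis using C[of i t x] by (simp add: pos_le_divide_eq add_pos_nonneg)
  qed
  moreover have "0 \<le> C" using C[of undefined 0 0] by (simp add: order_trans[OF norm_ge_zero])
  ultimately show ?thesis by blast
qed

section \<open>Continuity and differentiation under the integral over the line\<close>

lemma continuous_lborel_param:
  fixes f :: "'a::{first_countable_topology,t2_space} \<Rightarrow> real \<Rightarrow> complex"
  assumes "\<And>x. continuous_on UNIV (\<lambda>p. f p x)" "\<And>p. continuous_on UNIV (f p)"
    and "\<And>p x. norm (f p x) \<le> C / (1 + x\<^sup>2)"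
  shows "continuous_on UNIV (\<lambda>p. LINT x|lborel. f p x)"
  unfolding continuous_on_def
proof
  fix p
  show "((\<lambda>p. LINT x|lborel. f p x) \<longlongrightarrow> (LINT x|lborel. f p x)) (at p within UNIV)"
    unfolding tendsto_at_iff_sequentially
  proof (intro allI impI)
    fix X assume X: "X \<longlonglongrightarrow> p"
    have "(\<lambda>n. LINT x|lborel. f (X n) x) \<longlonglongrightarrow> (LINT x|lborel. f p x)"
    proof (rule integral_dominated_convergence[where w="\<lambda>x. C / (1 + x\<^sup>2)"])
      show "AE x in lborel. (\<lambda>n. f (X n) x) \<longlonglongrightarrow> f p x"
        using assms(1) X by (intro AE_I2) (auto intro: continuous_on_tendsto_compose[of UNIV])
    qed (use assms integrable_inverse_square in \<open>auto intro: borel_measurable_continuous_onI\<close>)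
    then show "((\<lambda>p. LINT x|lborel. f p x) \<circ> X) \<longlonglongrightarrow> (LINT x|lborel. f p x)" by (simp add: o_def)
  qed
qed

lemma vector_mvt_bound:
  fixes f :: "real \<Rightarrow> complex"
  assumes "convex S" "\<And>x. x \<in> S \<Longrightarrow> (f has_vector_derivative f' x) (at x)"
    and "\<And>x. x \<in> S \<Longrightarrow> norm (f' x) \<le> B" "x \<in> S" "y \<in> S"
  shows "norm (f x - f y) \<le> B * norm (x - y)"
proof (rule differentiable_bound[of S f "\<lambda>s h. h *\<^sub>R f' s"])
  show "onorm (\<lambda>h. h *\<^sub>R f' s) \<le> B" if "s \<in> S" for s
  proof (rule onorm_le)
    fix y :: real
    show "norm (y *\<^sub>R f' s) \<le> B * norm y"
      using mult_left_mono[OF assms(3)[OF that], of "\<bar>y\<bar>"] by (simp add: mult.commute)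
  qed
qed (use assms in \<open>auto simp: has_vector_derivative_def intro: has_derivative_at_withinI\<close>)

text \<open>The mean value inequality dominates the remainder of the difference quotient by the
  integrable function \<open>2 * D / (1 + x^2)\<close>, so dominated convergence applies along every
  sequence of increments.\<close>

lemma has_vector_derivative_lborel:
  fixes f :: "real \<Rightarrow> real \<Rightarrow> complex"
  assumes d: "\<And>s x. ((\<lambda>s. f s x) has_vector_derivative f' s x) (at s)"
    and c: "\<And>s. continuous_on UNIV (f s)" "\<And>s. continuous_on UNIV (f' s)"
    and b: "\<And>s x. norm (f s x) \<le> C / (1 + x\<^sup>2)" "\<And>s x. norm (f' s x) \<le> D / (1 + x\<^sup>2)"
  shows "((\<lambda>s. LINT x|lborel. f s x) has_vector_derivative (LINT x|lborel. f' s x)) (at s)"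
proof -
  have int: "integrable lborel (f s)" "integrable lborel (f' s)" for s
    using c b integrable_dominated by blast+
  define q where "q h x = norm (f (s + h) x - f s x - h *\<^sub>R f' s x) / norm h" for h x
  have q_le: "q h x \<le> 2 * D / (1 + x\<^sup>2)" if "h \<noteq> 0" for h x
  proof -
    have "norm (f (s + h) x - f s x) \<le> D / (1 + x\<^sup>2) * norm ((s + h) - s)"
      by (rule vector_mvt_bound[of UNIV "\<lambda>s. f s x" "\<lambda>s. f' s x"]) (use d b(2) in auto)
    then have "norm (f (s + h) x - f s x - h *\<^sub>R f' s x) \<le> D / (1 + x\<^sup>2) * \<bar>h\<bar> + \<bar>h\<bar> * norm (f' s x)"
      using norm_triangle_ineq4[of "f (s + h) x - f s x" "h *\<^sub>R f' s x"] by simp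
    also have "\<dots> \<le> D / (1 + x\<^sup>2) * \<bar>h\<bar> + \<bar>h\<bar> * (D / (1 + x\<^sup>2))"
      by (intro add_left_mono mult_left_mono b) auto
    also have "\<dots> = 2 * D / (1 + x\<^sup>2) * \<bar>h\<bar>" by (simp add: algebra_simps)
    finally show ?thesis using that by (simp add: q_def pos_divide_le_eq)
  qed
  have q_meas: "q h \<in> borel_measurable lborel" for h
    unfolding q_def using int[THEN borel_measurable_integrable] by measurable
  have lim: "(\<lambda>h. LINT x|lborel. q h x) \<midarrow>0\<rightarrow> 0"
    unfolding tendsto_at_iff_sequentially
  proof (intro allI impI)
    fix X :: "nat \<Rightarrow> real" assume X0: "\<forall>i. X i \<in> UNIV - {0}" and X: "X \<longlonglongrightarrow> 0"
    have "(\<lambda>n. LINT x|lborel. q (X n) x) \<longlonglongrightarrow> (LINT x::real|lborel. (0::real))"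
    proof (rule integral_dominated_convergence[where w="\<lambda>x. 2 * D / (1 + x\<^sup>2)"])
      show "AE x in lborel. (\<lambda>n. q (X n) x) \<longlonglongrightarrow> 0"
      proof (rule AE_I2)
        fix x
        have "(\<lambda>h. q h x) \<midarrow>0\<rightarrow> 0"
          using d[of x s] unfolding has_vector_derivative_def has_derivative_at q_def by simp
        then show "(\<lambda>n. q (X n) x) \<longlonglongrightarrow> 0"
          using X0 X unfolding tendsto_at_iff_sequentially by (auto simp: o_def)
      qed
      show "AE x in lborel. norm (q (X n) x) \<le> 2 * D / (1 + x\<^sup>2)" for n
        using q_le[of "X n"] X0 by (auto simp: q_def)
    qed (use q_meas integrable_inverse_square in auto)
    then show "((\<lambda>h. LINT x|lborel. q h x) \<circ> X) \<longlonglongrightarrow> 0" by (simp add: o_def)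
  qed
  have le: "norm ((LINT x|lborel. f (s + h) x) - (LINT x|lborel. f s x) - h *\<^sub>R (LINT x|lborel. f' s x)) / norm h
      \<le> (LINT x|lborel. q h x)" for h
  proof -
    have "(LINT x|lborel. f (s + h) x) - (LINT x|lborel. f s x) - h *\<^sub>R (LINT x|lborel. f' s x)
        = (LINT x|lborel. f (s + h) x - f s x - h *\<^sub>R f' s x)"
      using int by simp
    then have "norm ((LINT x|lborel. f (s + h) x) - (LINT x|lborel. f s x) - h *\<^sub>R (LINT x|lborel. f' s x))
        \<le> (LINT x|lborel. norm (f (s + h) x - f s x - h *\<^sub>R f' s x))"
      using integral_norm_bound by metis
    then show ?thesis unfolding q_def by (simp add: divide_right_mono)
  qed
  have "(\<lambda>h. norm ((LINT x|lborel. f (s + h) x) - (LINT x|lborel. f s x)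
      - h *\<^sub>R (LINT x|lborel. f' s x)) / norm h) \<midarrow>0\<rightarrow> 0"
  proof (rule tendsto_sandwich[OF _ _ tendsto_const lim])
    show "\<forall>\<^sub>F h in at 0. norm ((LINT x|lborel. f (s + h) x) - (LINT x|lborel. f s x)
      - h *\<^sub>R (LINT x|lborel. f' s x)) / norm h \<le> (LINT x|lborel. q h x)"
      using le by (intro always_eventually allI)
  qed (intro always_eventually allI; simp)
  then show ?thesis
    unfolding has_vector_derivative_def has_derivative_at by (auto intro: bounded_linear_scaleR_left)
qed

lemma LINT_derivative_eq_0:
  fixes G :: "real \<Rightarrow> complex"
  assumes "\<And>x. (G has_vector_derivative G' x) (at x)" "continuous_on UNIV G'"
    and "\<And>x. norm (G x) \<le> C / (1 + x\<^sup>2)" "\<And>x. norm (G' x) \<le> D / (1 + x\<^sup>2)"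
  shows "(LINT x|lborel. G' x) = 0"
proof -
  have top: "(G \<longlongrightarrow> 0) at_top"
  proof (rule Lim_null_comparison[of _ "\<lambda>x. C / (1 + x\<^sup>2)"])
    show "((\<lambda>x::real. C / (1 + x\<^sup>2)) \<longlongrightarrow> 0) at_top"
      by real_asymp
  qed (use assms(3) in auto)
  have bot: "(G \<longlongrightarrow> 0) at_bot"
  proof (rule Lim_null_comparison[of _ "\<lambda>x. C / (1 + x\<^sup>2)"])
    show "((\<lambda>x::real. C / (1 + x\<^sup>2)) \<longlongrightarrow> 0) at_bot"
      by real_asymp
  qed (use assms(3) in auto)
  have "(LBINT x=-\<infinity>..\<infinity>. G' x) = 0 - 0"
  proof (rule interval_integral_FTC_integrable)
    show "isCont G' x" for x using assms(2) by (simp add: continuous_on_eq_continuous_at)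
    show "set_integrable lborel (einterval (- \<infinity>) \<infinity>) G'"
      using integrable_dominated[OF assms(2,4)] by (simp add: set_integrable_def)
    show "((G \<circ> real_of_ereal) \<longlongrightarrow> 0) (at_right (- \<infinity>))" "((G \<circ> real_of_ereal) \<longlongrightarrow> 0) (at_left \<infinity>)"
      using top bot by (auto simp: ereal_tendsto_simps)
  qed (use assms(1) in auto)
  then show ?thesis by (simp add: interval_lebesgue_integral_def set_lebesgue_integral_def)
qed

definition FT :: "('i \<Rightarrow> tfun) \<Rightarrow> 'i \<Rightarrow> tfun" where
  "FT f i t \<xi> = (LINT x|lborel. f i t x * cis (- (x * \<xi>)))"

lemma cinf_rapid_mult: "cinf moderate f \<Longrightarrow> cinf rapid g \<Longrightarrow> cinf rapid (\<lambda>i t x. f i t x * g i t x)"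
  by (rule cinf_mult[OF growth_module_rapid])

lemma cinf_rapid_cmult: "cinf rapid g \<Longrightarrow> cinf rapid (\<lambda>i t x. c * g i t x)"
  by (rule cinf_rapid_mult[OF cinf_moderate_const])

lemma cinf_rapid_xmult: "cinf rapid g \<Longrightarrow> cinf rapid (\<lambda>i t x. complex_of_real x * g i t x)"
  by (rule cinf_rapid_mult[OF cinf_moderate_x])

lemma has_vector_derivative_cis_linear:
  "((\<lambda>y. cis (a * y)) has_vector_derivative (\<i> * complex_of_real a * cis (a * x))) (at x)"
proof -
  have "((\<lambda>y. cis (a * y)) has_vector_derivative (a *\<^sub>R (\<i> * cis (a * x)))) (at x)"
    by (rule has_vector_derivative_dilate) (auto simp: has_vector_derivative_def intro!: derivative_eq_intros)
  then show ?thesis by (simp add: scaleR_conv_of_real mult_ac)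
qed

lemma cinf_continuous_x: "cinf B f \<Longrightarrow> continuous_on UNIV (\<lambda>x. f i t x)"
  using cont2_compose[OF cinf_cont2, of B f "\<lambda>_. t" "\<lambda>x. x"] by auto

lemma FT_partials:
  assumes f: "cinf rapid f"
  shows "partials (FT f) (FT (\<lambda>i. pdt (f i))) (FT (\<lambda>i t x. - \<i> * (complex_of_real x * f i t x)))"
proof -
  note ft = cinf_partials(2)[OF f]
  have fx: "cinf rapid (\<lambda>i t x. - \<i> * (complex_of_real x * f i t x))"
    by (intro cinf_rapid_cmult cinf_rapid_xmult f)
  obtain C where C: "\<And>i t x. norm (f i t x) \<le> C / (1 + x\<^sup>2)"
    using rapid_dominated[OF cinf_growth[OF f]] by blast
  obtain D where D: "\<And>i t x. norm (pdt (f i) t x) \<le> D / (1 + x\<^sup>2)"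
    using rapid_dominated[OF cinf_growth[OF ft]] by blast
  obtain E where E: "\<And>i t x. norm (- \<i> * (complex_of_real x * f i t x)) \<le> E / (1 + x\<^sup>2)"
    using rapid_dominated[OF cinf_growth[OF fx]] by blast
  have "((\<lambda>s. FT f i s \<xi>) has_vector_derivative FT (\<lambda>i. pdt (f i)) i t \<xi>) (at t)" for i t \<xi>
    unfolding FT_def
    by (rule has_vector_derivative_lborel[of _ _ C D])
      (use C D in \<open>auto simp: norm_mult intro!: has_vector_derivative_mult_left cinf_deriv(1)[OF f] continuous_intros
        cinf_continuous_x[OF f] cinf_continuous_x[OF ft]\<close>)
  moreover have "((\<lambda>\<xi>. FT f i t \<xi>) has_vector_derivative
      FT (\<lambda>i t x. - \<i> * (complex_of_real x * f i t x)) i t \<xi>) (at \<xi>)" for i t \<xi>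
    unfolding FT_def
  proof (rule has_vector_derivative_lborel[of _ _ C E])
    fix s x
    show "((\<lambda>s. f i t x * cis (- (x * s))) has_vector_derivative
        - \<i> * (complex_of_real x * f i t x) * cis (- (x * s))) (at s)"
      using has_vector_derivative_mult_right[OF has_vector_derivative_cis_linear[of "-x" s], of "f i t x"]
      by (simp add: mult_ac)
  qed (use C E in \<open>auto simp: norm_mult intro!: continuous_intros cinf_continuous_x[OF f]\<close>)
  ultimately show ?thesis by (auto simp: partials_def)
qed

text \<open>Integration by parts: the derivative of \<open>f\<close> times the oscillating factor
  integrates to 0, because the product vanishes at both ends of the line.\<close>

lemma FT_pdx:
  assumes f: "cinf rapid f"
  shows "FT (\<lambda>i. pdx (f i)) i t \<xi> = \<i> * complex_of_real \<xi> * FT f i t \<xi>"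
proof -
  note fx = cinf_partials(3)[OF f]
  obtain C where C: "\<And>i t x. norm (f i t x) \<le> C / (1 + x\<^sup>2)"
    using rapid_dominated[OF cinf_growth[OF f]] by blast
  obtain D where D: "\<And>i t x. norm (pdx (f i) t x) \<le> D / (1 + x\<^sup>2)"
    using rapid_dominated[OF cinf_growth[OF fx]] by blast
  define G' where "G' x = f i t x * (\<i> * complex_of_real (- \<xi>) * cis (- \<xi> * x)) + pdx (f i) t x * cis (- \<xi> * x)" for x
  have "(LINT x|lborel. G' x) = 0"
  proof (rule LINT_derivative_eq_0[of "\<lambda>x. f i t x * cis (- \<xi> * x)" _ C "\<bar>\<xi>\<bar> * C + D"])
    show "((\<lambda>x. f i t x * cis (- \<xi> * x)) has_vector_derivative G' x) (at x)" for x
      unfolding G'_def by (intro has_vector_derivative_mult cinf_deriv(2)[OF f] has_vector_derivative_cis_linear)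
    show "continuous_on UNIV G'"
      unfolding G'_def by (intro continuous_intros cinf_continuous_x[OF f] cinf_continuous_x[OF fx])
    show "norm (G' x) \<le> (\<bar>\<xi>\<bar> * C + D) / (1 + x\<^sup>2)" for x
    proof -
      have "norm (G' x) \<le> \<bar>\<xi>\<bar> * norm (f i t x) + norm (pdx (f i) t x)"
        unfolding G'_def by (rule order_trans[OF norm_triangle_ineq]) (simp add: norm_mult mult_ac)
      also have "\<dots> \<le> \<bar>\<xi>\<bar> * (C / (1 + x\<^sup>2)) + D / (1 + x\<^sup>2)"
        by (intro add_mono mult_left_mono C D) auto
      finally show ?thesis by (simp add: add_divide_distrib)
    qed
  qed (use C in \<open>simp add: norm_mult\<close>)
  moreover have "(LINT x|lborel. G' x) =
      (LINT x|lborel. (- \<i> * complex_of_real \<xi>) * (f i t x * cis (- (x * \<xi>))) + pdx (f i) t x * cis (- (x * \<xi>)))"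
    by (simp add: G'_def mult_ac)
  moreover have "\<dots> = (- \<i> * complex_of_real \<xi>) * FT f i t \<xi> + FT (\<lambda>i. pdx (f i)) i t \<xi>"
  proof -
    have "integrable lborel (\<lambda>x. f i t x * cis (- (x * \<xi>)))"
      by (rule integrable_dominated[of _ C])
        (use C in \<open>auto simp: norm_mult intro!: continuous_intros cinf_continuous_x[OF f]\<close>)
    moreover have "integrable lborel (\<lambda>x. pdx (f i) t x * cis (- (x * \<xi>)))"
      by (rule integrable_dominated[of _ D])
        (use D in \<open>auto simp: norm_mult intro!: continuous_intros cinf_continuous_x[OF fx]\<close>)
    ultimately show ?thesis unfolding FT_def
      by (subst Bochner_Integration.integral_add) auto
  qed
  ultimately show ?thesis by (simp add: algebra_simps add_eq_0_iff)
qed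

text \<open>Each factor \<xi> is traded for an \<open>x\<close>-derivative of \<open>f\<close>,
  which stays in the class; the induction therefore runs over all \<open>f\<close>. The base case is
  the integral of the common majorant.\<close>

lemma FT_rapid:
  assumes "cinf rapid f"
  shows "rapid (FT f)"
proof (rule rapidI)
  fix N
  show "\<exists>C. \<forall>i t \<xi>. \<bar>\<xi>\<bar> ^ N * norm (FT f i t \<xi>) \<le> C"
    using assms
  proof (induction N arbitrary: f)
    case 0
    obtain C where C: "\<And>i t x. norm (f i t x) \<le> C / (1 + x\<^sup>2)"
      using rapid_dominated[OF cinf_growth[OF 0]] by blast
    have "norm (FT f i t \<xi>) \<le> (LINT x|lborel. C / (1 + x\<^sup>2))" for i t \<xi>
    proof -
      have "norm (FT f i t \<xi>) \<le> (LINT x|lborel. norm (f i t x * cis (- (x * \<xi>))))"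
        unfolding FT_def by (rule integral_norm_bound)
      also have "\<dots> \<le> (LINT x|lborel. C / (1 + x\<^sup>2))"
      proof (rule integral_mono)
        show "integrable lborel (\<lambda>x. norm (f i t x * cis (- (x * \<xi>))))"
          by (intro integrable_norm integrable_dominated[of _ C])
            (use C in \<open>auto simp: norm_mult intro!: continuous_intros cinf_continuous_x[OF 0]\<close>)
      qed (use C integrable_inverse_square in \<open>auto simp: norm_mult\<close>)
      finally show ?thesis .
    qed
    then show ?case by auto
  next
    case (Suc N)
    obtain C where "\<And>i t \<xi>. \<bar>\<xi>\<bar> ^ N * norm (FT (\<lambda>i. pdx (f i)) i t \<xi>) \<le> C"
      using Suc.IH[OF cinf_partials(3)[OF Suc.prems]] by blast
    then show ?case by (auto simp: FT_pdx[OF Suc.prems] norm_mult mult_ac)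
  qed
qed

lemma FT_cont2:
  assumes f: "cinf rapid f"
  shows "cont2 (FT f)"
  unfolding cont2_def FT_def
proof
  fix i
  obtain C where C: "\<And>i t x. norm (f i t x) \<le> C / (1 + x\<^sup>2)"
    using rapid_dominated[OF cinf_growth[OF f]] by blast
  show "continuous_on UNIV (\<lambda>p. LINT x|lborel. f i (fst p) x * cis (- (x * snd p)))"
    by (rule continuous_lborel_param[of _ C])
      (use C in \<open>auto simp: norm_mult intro!: continuous_intros cont2_compose[OF cinf_cont2[OF f]]\<close>)
qed

text \<open>Both partial derivatives of a transform are transforms of families from the same class,
  so the bound of order 0 propagates to every order.\<close>

lemma cinf_FT:
  assumes "cinf rapid f"
  shows "cinf rapid (FT f)"
proof -
  have "ck rapid n (FT f)" for n
    using assms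
  proof (induction n arbitrary: f)
    case 0
    then show ?case by (simp add: FT_rapid FT_cont2)
  next
    case (Suc n)
    show ?case
      by (intro ck_SucI[of rapid, OF FT_rapid FT_cont2 FT_partials] Suc.IH Suc.prems cinf_partials(2) cinf_rapid_cmult cinf_rapid_xmult)
  qed
  then show ?thesis by (simp add: cinf_def)
qed

lemma pdt_FT: "cinf rapid f \<Longrightarrow> pdt (FT f i) = FT (\<lambda>i. pdt (f i)) i"
  using partials_pd[OF FT_partials] by metis

section \<open>Fourier inversion\<close>

text \<open>The integral is the characteristic function of the standard normal distribution.\<close>

lemma LINT_gauss_cis: "(LINT x|lborel. complex_of_real (std_normal_density x) * cis (u * x)) = exp (- (u\<^sup>2) / 2)"
proof -
  have "char std_normal_distribution u = (LINT x|lborel. std_normal_density x *\<^sub>R iexp (u * x))"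
    unfolding char_def by (subst integral_density) (auto simp: normal_density_nonneg)
  then have "(LINT x|lborel. complex_of_real (std_normal_density x) * cis (u * x)) = complex_of_real (exp (- (u\<^sup>2) / 2))"
    by (simp add: char_std_normal_distribution scaleR_conv_of_real cis_conv_exp)
  then show ?thesis by (simp flip: exp_of_real)
qed

lemma continuous_std_normal_density: "continuous_on A std_normal_density"
  unfolding std_normal_density_def by (intro continuous_intros) auto

lemma integrable_std_normal: "integrable lborel std_normal_density"
  using integrable_normal_density[of 1 0] by simp

lemma std_normal_density_le: "0 \<le> std_normal_density x" "std_normal_density x \<le> std_normal_density 0"
  by (auto simp: std_normal_density_def divide_right_mono)

lemma LINT_gauss_scaled:
  assumes e: "e > 0"
  shows "(LINT \<xi>|lborel. complex_of_real (std_normal_density (e * \<xi>)) * cis (u * \<xi>))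
    = complex_of_real (sqrt (2 * pi) / e * std_normal_density (u / e))"
proof -
  have "(LINT \<xi>|lborel. complex_of_real (std_normal_density (e * \<xi>)) * cis (u * \<xi>))
      = \<bar>1 / e\<bar> *\<^sub>R (LINT x|lborel. complex_of_real (std_normal_density (e * (0 + (1 / e) * x))) * cis (u * (0 + (1 / e) * x)))"
    by (rule lborel_integral_real_affine) (use e in auto)
  also have "\<dots> = (1 / e) *\<^sub>R (LINT x|lborel. complex_of_real (std_normal_density x) * cis ((u / e) * x))"
    using e by simp
  also have "\<dots> = complex_of_real (1 / e * exp (- ((u / e)\<^sup>2) / 2))"
    unfolding LINT_gauss_cis by (simp add: scaleR_conv_of_real flip: exp_of_real)
  finally show ?thesis by (simp add: std_normal_density_def)
qed

text \<open>The factor \<open>std_normal_density (e n * \<xi>)\<close> regularises the double integral, so that Fubini applies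
  and one inner integral is an explicit approximate identity.\<close>

lemma fourier_inversion_pointwise:
  fixes g h :: "real \<Rightarrow> complex"
  assumes gc: "continuous_on UNIV g" and gb: "\<And>y. norm (g y) \<le> C / (1 + y\<^sup>2)"
    and h: "\<And>\<xi>. h \<xi> = (LINT y|lborel. g y * cis (- (y * \<xi>)))"
    and hc: "continuous_on UNIV h" and hb: "\<And>\<xi>. norm (h \<xi>) \<le> D / (1 + \<xi>\<^sup>2)"
  shows "(LINT \<xi>|lborel. h \<xi> * cis (x * \<xi>)) = complex_of_real (2 * pi) * g x"
proof -
  let ?\<phi> = std_normal_density
  define e where "e n = 1 / (real n + 1)" for n
  have e: "e n > 0" for n by (simp add: e_def)
  have e0: "e \<longlonglongrightarrow> 0" unfolding e_def by real_asymp
  have C0: "0 \<le> C" using order_trans[OF norm_ge_zero gb[of 0]] by simp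
  have phi_cont: "continuous_on A (\<lambda>x. ?\<phi> (f x))" if "continuous_on A f" for A :: "real set" and f
    using continuous_on_compose2[OF continuous_std_normal_density that] by auto
  have gi: "integrable lborel g" and hi: "integrable lborel h"
    using integrable_dominated gc gb hc hb by blast+
  define A where "A n = (LINT \<xi>|lborel. h \<xi> * cis (x * \<xi>) * ?\<phi> (e n * \<xi>))" for n
  have lim1: "A \<longlonglongrightarrow> (LINT \<xi>|lborel. h \<xi> * cis (x * \<xi>) * ?\<phi> 0)"
    unfolding A_def
  proof (rule integral_dominated_convergence[where w="\<lambda>\<xi>. norm (h \<xi>) * ?\<phi> 0"])
    show "AE \<xi> in lborel. (\<lambda>n. h \<xi> * cis (x * \<xi>) * ?\<phi> (e n * \<xi>)) \<longlonglongrightarrow> h \<xi> * cis (x * \<xi>) * ?\<phi> 0"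
    proof (rule AE_I2)
      fix \<xi> :: real
      have "(\<lambda>n. ?\<phi> (e n * \<xi>)) \<longlonglongrightarrow> ?\<phi> 0"
        by (rule continuous_on_tendsto_compose[OF continuous_std_normal_density[of UNIV]])
          (auto intro!: tendsto_eq_intros e0)
      then show "(\<lambda>n. h \<xi> * cis (x * \<xi>) * ?\<phi> (e n * \<xi>)) \<longlonglongrightarrow> h \<xi> * cis (x * \<xi>) * ?\<phi> 0"
        by (intro tendsto_intros)
    qed
    show "AE \<xi> in lborel. norm (h \<xi> * cis (x * \<xi>) * complex_of_real (?\<phi> (e n * \<xi>))) \<le> norm (h \<xi>) * ?\<phi> 0" for n
      using std_normal_density_le by (intro AE_I2) (auto simp: norm_mult intro!: mult_left_mono)
  qed (use hi in \<open>auto intro!: borel_measurable_continuous_onI continuous_intros hc phi_cont\<close>)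
  have A_eq: "A n = (LINT z|lborel. sqrt (2 * pi) * (g (x + e n * z) * ?\<phi> z))" for n
  proof -
    define K where "K \<xi> y = g y * cis (- (y * \<xi>)) * (cis (x * \<xi>) * ?\<phi> (e n * \<xi>))" for \<xi> y
    have phi_int: "integrable lborel (\<lambda>\<xi>. ?\<phi> (e n * \<xi>))"
      using lborel_integrable_real_affine[OF integrable_std_normal, of "e n" 0] e[of n] by simp
    have gsnd: "continuous_on UNIV (\<lambda>p::real \<times> real. g (snd p))"
      using continuous_on_compose2[OF gc continuous_on_snd[OF continuous_on_id]] by auto
    have "continuous_on UNIV (case_prod K)"
      unfolding K_def split_beta
      by (intro continuous_intros gsnd continuous_on_compose2[OF continuous_std_normal_density[of UNIV]]) auto
    then have Km: "case_prod K \<in> borel_measurable (lborel \<Otimes>\<^sub>M lborel)"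
      by (simp add: lborel_prod borel_measurable_continuous_onI)
    have Ki: "integrable lborel (K \<xi>)" for \<xi>
      unfolding K_def
      by (intro Bochner_Integration.integrable_mult_left integrable_dominated[of _ C])
        (use gb in \<open>auto simp: norm_mult intro!: continuous_intros gc\<close>)
    have "integrable (lborel \<Otimes>\<^sub>M lborel) (case_prod K)"
    proof (rule lborel_pair.Fubini_integrable[OF Km])
      have "(\<lambda>\<xi>. LINT y|lborel. norm (case_prod K (\<xi>, y))) = (\<lambda>\<xi>. (LINT y|lborel. norm (g y)) * ?\<phi> (e n * \<xi>))"
        using std_normal_density_le by (auto simp: K_def norm_mult)
      then show "integrable lborel (\<lambda>\<xi>. LINT y|lborel. norm (case_prod K (\<xi>, y)))"
        using phi_int by simp
    qed (use Ki in auto)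
    from lborel_pair.Fubini_integral[OF this]
    have "(LINT y|lborel. LINT \<xi>|lborel. K \<xi> y) = (LINT \<xi>|lborel. LINT y|lborel. K \<xi> y)" .
    moreover have "A n = (LINT \<xi>|lborel. LINT y|lborel. K \<xi> y)"
      unfolding A_def K_def h by (simp only: integral_mult_left_zero) (simp only: mult.assoc)
    moreover have "(LINT \<xi>|lborel. K \<xi> y) = g y * complex_of_real (sqrt (2 * pi) / e n * ?\<phi> ((x - y) / e n))" for y
    proof -
      have "K \<xi> y = g y * (complex_of_real (?\<phi> (e n * \<xi>)) * cis ((x - y) * \<xi>))" for \<xi>
        unfolding K_def by (simp add: cis_mult mult_ac) (simp add: algebra_simps)
      then show ?thesis using LINT_gauss_scaled[OF e[of n], of "x - y"] by simp
    qed
    ultimately have "A n = (LINT y|lborel. g y * complex_of_real (sqrt (2 * pi) / e n * ?\<phi> ((x - y) / e n)))"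
      by simp
    also have "\<dots> = \<bar>e n\<bar> *\<^sub>R (LINT z|lborel. g (x + e n * z) * complex_of_real (sqrt (2 * pi) / e n * ?\<phi> ((x - (x + e n * z)) / e n)))"
      by (rule lborel_integral_real_affine) (use e[of n] in auto)
    also have "\<dots> = (LINT z|lborel. e n *\<^sub>R (g (x + e n * z) * complex_of_real (sqrt (2 * pi) / e n * ?\<phi> ((x - (x + e n * z)) / e n))))"
      using e[of n] by simp
    also have "\<dots> = (LINT z|lborel. sqrt (2 * pi) * (g (x + e n * z) * ?\<phi> z))"
      using e[of n] by (intro Bochner_Integration.integral_cong) (auto simp: scaleR_conv_of_real std_normal_density_def)
    finally show ?thesis .
  qed
  have lim2: "A \<longlonglongrightarrow> (LINT z|lborel. sqrt (2 * pi) * (g x * ?\<phi> z))"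
    unfolding A_eq[abs_def]
  proof (rule integral_dominated_convergence[where w="\<lambda>z. sqrt (2 * pi) * (C * ?\<phi> z)"])
    show "AE z in lborel. (\<lambda>n. sqrt (2 * pi) * (g (x + e n * z) * ?\<phi> z)) \<longlonglongrightarrow> complex_of_real (sqrt (2 * pi)) * (g x * ?\<phi> z)"
    proof (rule AE_I2)
      fix z :: real
      have "(\<lambda>n. g (x + e n * z)) \<longlonglongrightarrow> g x"
        by (rule continuous_on_tendsto_compose[OF gc]) (auto intro!: tendsto_eq_intros e0)
      then show "(\<lambda>n. sqrt (2 * pi) * (g (x + e n * z) * ?\<phi> z)) \<longlonglongrightarrow> complex_of_real (sqrt (2 * pi)) * (g x * ?\<phi> z)"
        by (intro tendsto_intros)
    qed
    have "norm (g y) \<le> C" for y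
    proof -
      have "C / (1 + y\<^sup>2) \<le> C / 1" by (intro divide_left_mono C0) (auto intro: add_pos_nonneg)
      then show ?thesis using gb[of y] by simp
    qed
    then show "AE z in lborel. norm (complex_of_real (sqrt (2 * pi)) * (g (x + e n * z) * complex_of_real (?\<phi> z))) \<le> sqrt (2 * pi) * (C * ?\<phi> z)" for n
      using std_normal_density_le by (intro AE_I2) (auto simp: norm_mult intro!: mult_left_mono mult_right_mono)
    show "(\<lambda>z. complex_of_real (sqrt (2 * pi)) * (g (x + e n * z) * complex_of_real (?\<phi> z))) \<in> borel_measurable lborel" for n
    proof -
      have "continuous_on UNIV (\<lambda>z. g (x + e n * z))"
        by (rule continuous_on_compose2[OF gc]) (auto intro!: continuous_intros)
      then show ?thesis by (auto intro!: borel_measurable_continuous_onI continuous_intros phi_cont)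
    qed
  qed (use integrable_std_normal in \<open>auto intro!: borel_measurable_continuous_onI continuous_intros phi_cont\<close>)
  have "(LINT z|lborel. ?\<phi> z) = 1"
    using integral_normal_density[of 1 0] by simp
  then have "(LINT z|lborel. complex_of_real (?\<phi> z)) = 1"
    by simp
  then have I: "complex_of_real (?\<phi> 0) * (LINT \<xi>|lborel. h \<xi> * cis (x * \<xi>)) = sqrt (2 * pi) * g x"
    using LIMSEQ_unique[OF lim1 lim2]
    by (simp only: integral_mult_left_zero integral_mult_right_zero mult_1_right mult.commute[of _ "complex_of_real (?\<phi> 0)"])
  \<comment> \<open>The density at 0 is the reciprocal of \<open>sqrt (2 * pi)\<close>, so the
    constants of the two limits combine to \<open>2 * pi\<close>.\<close>
  have "complex_of_real (sqrt (2 * pi)) * complex_of_real (?\<phi> 0) = 1"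
    unfolding of_real_mult[symmetric] by (simp add: std_normal_density_def)
  then have "(LINT \<xi>|lborel. h \<xi> * cis (x * \<xi>))
      = complex_of_real (sqrt (2 * pi)) * complex_of_real (?\<phi> 0) * (LINT \<xi>|lborel. h \<xi> * cis (x * \<xi>))"
    by simp
  also have "\<dots> = complex_of_real (sqrt (2 * pi)) * (sqrt (2 * pi) * g x)"
    by (simp only: mult.assoc I)
  also have "\<dots> = complex_of_real (2 * pi) * g x"
    by (simp add: mult.assoc[symmetric] of_real_mult[symmetric] del: of_real_mult)
  finally show ?thesis .
qed

lemma cinf_rapid_reflect:
  assumes "cinf rapid f"
  shows "cinf rapid (\<lambda>i t x. f i t (- x))"
proof -
  have "ck rapid n (\<lambda>i t x. f i t (- x))" for n
    using assms
  proof (induction n arbitrary: f)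
    case (0 f)
    have "cont2 (\<lambda>i t x. f i t (- x))"
      unfolding cont2_def by (intro allI cont2_compose[OF cinf_cont2[OF 0]] continuous_intros)
    moreover have "rapid (\<lambda>i t x. f i t (- x))"
      using cinf_growth[OF 0] unfolding rapid_def by (metis abs_minus_cancel)
    ultimately show ?case by simp
  next
    case (Suc n f)
    note P = cinf_partials[OF Suc.prems]
    have "ck rapid n (\<lambda>i t x. (\<lambda>i t x. - 1 * pdx (f i) t x) i t (- x))"
      by (rule Suc.IH) (intro cinf_rapid_cmult P)
    moreover have "partials (\<lambda>i t x. f i t (- x)) (\<lambda>i t x. pdt (f i) t (- x)) (\<lambda>i t x. (\<lambda>i t x. - 1 * pdx (f i) t x) i t (- x))"
      using has_vector_derivative_dilate(1)[of "\<lambda>x. f i t x" "\<lambda>x. pdx (f i) t x" "-1" x for i t x]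
        cinf_deriv[OF Suc.prems] by (auto simp: partials_def)
    moreover have "cont2 (\<lambda>i t x. f i t (- x))"
      unfolding cont2_def by (intro allI cont2_compose[OF cinf_cont2[OF Suc.prems]] continuous_intros)
    moreover have "rapid (\<lambda>i t x. f i t (- x))"
      using cinf_growth[OF Suc.prems] unfolding rapid_def by (metis abs_minus_cancel)
    moreover note Suc.IH[OF P(2)]
    ultimately show ?case by (intro ck_SucI[of rapid])
  qed
  then show ?thesis by (simp add: cinf_def)
qed

text \<open>Expressing the inverse through \<open>FT\<close> and a reflection lets it inherit
  regularity and decay from \<open>cinf_FT\<close>.\<close>

definition IFT :: "('i \<Rightarrow> tfun) \<Rightarrow> 'i \<Rightarrow> tfun" where
  "IFT f i t x = FT f i t (- x) / (2 * pi)"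

lemma cinf_IFT: "cinf rapid f \<Longrightarrow> cinf rapid (IFT f)"
  using cinf_rapid_cmult[OF cinf_rapid_reflect[OF cinf_FT], of f "1 / (2 * pi)"]
  unfolding IFT_def[abs_def] by simp

lemma fourier_inversion:
  assumes f: "cinf rapid f"
  shows "(LINT \<xi>|lborel. FT f i t \<xi> * cis (x * \<xi>)) = complex_of_real (2 * pi) * f i t x"
proof -
  obtain C where C: "\<And>i t x. norm (f i t x) \<le> C / (1 + x\<^sup>2)"
    using rapid_dominated[OF cinf_growth[OF f]] by blast
  obtain D where D: "\<And>i t x. norm (FT f i t x) \<le> D / (1 + x\<^sup>2)"
    using rapid_dominated[OF FT_rapid[OF f]] by blast
  show ?thesis
    by (rule fourier_inversion_pointwise[of "\<lambda>x. f i t x" C "\<lambda>\<xi>. FT f i t \<xi>" D])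
      (use C D in \<open>auto simp: FT_def[symmetric] intro: cinf_continuous_x f cinf_continuous_x[OF cinf_FT[OF f]]\<close>)
qed

lemma IFT_FT: "cinf rapid f \<Longrightarrow> IFT (FT f) = f"
  using fourier_inversion[of f] by (auto simp: IFT_def FT_def[of "FT f"] fun_eq_iff mult.commute)

text \<open>The substitution \<open>y\<close> to \<open>-y\<close> turns this into the inversion
  formula already known for \<open>f\<close>, so no second limiting argument is needed.\<close>

lemma FT_IFT:
  assumes f: "cinf rapid f"
  shows "FT (IFT f) = f"
proof (intro ext)
  fix i t x
  have "FT (IFT f) i t x = (LINT y|lborel. FT f i t (- y) / (2 * pi) * cis (- (y * x)))"
    by (simp add: FT_def[of "IFT f"] IFT_def)
  also have "\<dots> = \<bar>-1\<bar> *\<^sub>R (LINT y|lborel. FT f i t (- (0 + (-1) * y)) / (2 * pi) * cis (- ((0 + (-1) * y) * x)))"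
    by (rule lborel_integral_real_affine) auto
  also have "\<dots> = (LINT y|lborel. FT f i t y * cis (x * y)) / (2 * pi)"
    by (simp add: mult.commute)
  also have "\<dots> = f i t x" using fourier_inversion[OF f] by simp
  finally show "FT (IFT f) i t x = f i t x" .
qed

lemma FT_eq_imp_eq: "cinf rapid f \<Longrightarrow> cinf rapid g \<Longrightarrow> FT f = FT g \<Longrightarrow> f = g"
  using IFT_FT by metis

lemma FT_add:
  assumes f: "cinf rapid f" and g: "cinf rapid g"
  shows "FT (\<lambda>i t x. f i t x + g i t x) i t \<xi> = FT f i t \<xi> + FT g i t \<xi>"
proof -
  have "integrable lborel (\<lambda>x. f i t x * cis (- (x * \<xi>)))" if r: "cinf rapid f" for f :: "'a \<Rightarrow> tfun"
  proof -
    obtain C where C: "\<And>i t x. norm (f i t x) \<le> C / (1 + x\<^sup>2)"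
      using rapid_dominated[OF cinf_growth[OF r]] by blast
    show ?thesis
      by (rule integrable_dominated[of _ C])
        (use C in \<open>auto simp: norm_mult intro!: continuous_intros cinf_continuous_x[OF r]\<close>)
  qed
  then show ?thesis using f g by (simp add: FT_def distrib_right)
qed

lemma FT_tmult: "FT (\<lambda>i t x. c t * f i t x) i t \<xi> = c t * FT f i t \<xi>"
  by (simp add: FT_def mult.assoc)

lemma FT_periodic: "(\<And>i t x. f i (t + 2 * pi) x = f i t x) \<Longrightarrow> FT f i (t + 2 * pi) \<xi> = FT f i t \<xi>"
  by (simp add: FT_def)

lemma FT_opL:
  assumes c: "smooth_periodic c" "smooth_periodic q" and f: "cinf rapid f"
  shows "FT (\<lambda>i. opL c q (f i)) i t \<xi> = pdt (FT f i) t \<xi> + (\<i> * \<xi> * c t + q t) * FT f i t \<xi>"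
proof -
  note P = cinf_partials(2,3)[OF f]
  have 1: "cinf rapid (\<lambda>i t x. c t * pdx (f i) t x)" "cinf rapid (\<lambda>i t x. q t * f i t x)"
    using cinf_rapid_mult[OF smooth_periodicD(3)] c P f by auto
  have 2: "cinf rapid (\<lambda>i t x. pdt (f i) t x + c t * pdx (f i) t x)"
    using cinf_add[OF growth_module_rapid P(1) 1(1)] .
  show ?thesis
    unfolding opL_def using FT_add[OF 2 1(2)] FT_add[OF P(1) 1(1)]
    by (simp add: FT_tmult FT_pdx[OF f] pdt_FT[OF f] algebra_simps)
qed

lemma cinf_opL:
  assumes c: "smooth_periodic c" "smooth_periodic q" and f: "cinf rapid f"
  shows "cinf rapid (\<lambda>i. opL c q (f i))"
proof -
  note P = cinf_partials(2,3)[OF f]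
  have 1: "cinf rapid (\<lambda>i t x. c t * pdx (f i) t x)" "cinf rapid (\<lambda>i t x. q t * f i t x)"
    using cinf_rapid_mult[OF smooth_periodicD(3)] c P f by auto
  show ?thesis unfolding opL_def
    using cinf_add[OF growth_module_rapid cinf_add[OF growth_module_rapid P(1) 1(1)] 1(2)] .
qed

section \<open>The transformed equation\<close>

lemma prim_t_eq_integral:
  assumes "cinf unconstrained f" "0 \<le> t"
  shows "prim_t f i t x = integral {0..t} (\<lambda>s. f i s x)"
proof -
  have "((\<lambda>s. f i s x) has_integral (prim_t f i t x - prim_t f i 0 x)) {0..t}"
    by (rule fundamental_theorem_of_calculus[OF assms(2) has_vector_derivative_at_within])
      (use prim_t_partials[OF assms(1)] in \<open>auto simp: partials_def\<close>)
  then show ?thesis by (simp add: prim_t_0 integral_unique)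
qed

text \<open>After the Fourier transform in \<open>x\<close>, \<open>L u = f\<close> reads \<open>w' + symb c q w = g\<close> for each frequency \<open>\<xi>\<close>.\<close>

definition symb :: "(real \<Rightarrow> complex) \<Rightarrow> (real \<Rightarrow> complex) \<Rightarrow> unit \<Rightarrow> tfun" where
  "symb c q i t \<xi> = \<i> * complex_of_real \<xi> * c t + q t"

abbreviation phase :: "(real \<Rightarrow> complex) \<Rightarrow> (real \<Rightarrow> complex) \<Rightarrow> unit \<Rightarrow> tfun" where
  "phase c q \<equiv> prim_t (symb c q)"

abbreviation periodic_fam :: "(unit \<Rightarrow> tfun) \<Rightarrow> bool" where
  "periodic_fam w \<equiv> \<forall>t \<xi>. w () (t + 2 * pi) \<xi> = w () t \<xi>"

text \<open>The integrating factor is normalised to 1 at the end point \<open>t\<close>. Since only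
  the segment between \<open>s\<close> and \<open>t\<close> enters, \<open>s\<close> may lie on
  either side of \<open>t\<close>; this is what allows integration in the damped direction.\<close>

lemma ode_bound:
  fixes w g z Z :: "real \<Rightarrow> complex"
  assumes w: "\<And>t. (w has_vector_derivative g t - z t * w t) (at t)"
    and Z: "\<And>t. (Z has_vector_derivative z t) (at t)"
    and b: "\<And>r. r \<in> closed_segment s t \<Longrightarrow> - M \<le> Re (Z t - Z r)"
      "\<And>r. r \<in> closed_segment s t \<Longrightarrow> norm (g r) \<le> G"
  shows "norm (w t) \<le> exp (- Re (Z t - Z s)) * norm (w s) + exp M * G * \<bar>t - s\<bar>"
proof -
  define y where "y r = w r * exp (Z r - Z t)" for r
  have y: "(y has_vector_derivative g r * exp (Z r - Z t)) (at r)" for r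
  proof -
    have "((\<lambda>r. exp (Z r - Z t)) has_vector_derivative z r * exp (Z r - Z t)) (at r)"
      by (rule field_vector_diff_chain_at[of "\<lambda>r. Z r - Z t" _ _ exp, unfolded o_def])
        (auto intro!: derivative_eq_intros Z)
    from has_vector_derivative_mult[OF w this] show ?thesis
      unfolding y_def by (simp add: algebra_simps)
  qed
  have "norm (y t - y s) \<le> exp M * G * norm (t - s)"
  proof (rule vector_mvt_bound[OF _ y])
    fix r assume r: "r \<in> closed_segment s t"
    have "Re (Z r) - Re (Z t) \<le> M" using b(1)[OF r] by simp
    then have "norm (g r) * exp (Re (Z r) - Re (Z t)) \<le> G * exp M"
      using b(2)[OF r] by (intro mult_mono) (auto intro: order_trans[OF norm_ge_zero])
    then show "norm (g r * exp (Z r - Z t)) \<le> exp M * G" by (simp add: norm_mult mult.commute)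
  qed auto
  moreover have "norm (y t) \<le> norm (y s) + norm (y t - y s)" by (rule norm_triangle_sub)
  moreover have "y t = w t" "norm (y s) = exp (- Re (Z t - Z s)) * norm (w s)"
    by (auto simp: y_def norm_mult)
  ultimately show ?thesis by (simp add: real_norm_def)
qed

lemma ode_homogeneous:
  fixes y z Z :: "real \<Rightarrow> complex"
  assumes y: "\<And>t. (y has_vector_derivative - z t * y t) (at t)"
    and Z: "\<And>t. (Z has_vector_derivative z t) (at t)"
  shows "y t * exp (Z t) = y s * exp (Z s)"
proof -
  have d: "((\<lambda>r. y r * exp (Z r)) has_vector_derivative 0) (at r)" for r
  proof -
    have "((\<lambda>r. exp (Z r)) has_vector_derivative z r * exp (Z r)) (at r)"
      by (rule field_vector_diff_chain_at[of Z _ _ exp, unfolded o_def])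
        (auto intro!: derivative_eq_intros Z)
    from has_vector_derivative_mult[OF y this] show ?thesis by (simp add: algebra_simps)
  qed
  have "norm (y t * exp (Z t) - y s * exp (Z s)) \<le> 0 * norm (t - s)"
    by (rule vector_mvt_bound[OF convex_UNIV d]) auto
  then show ?thesis by simp
qed

context
  fixes c q :: "real \<Rightarrow> complex"
  assumes c: "smooth_periodic c" and q: "smooth_periodic q"
begin

lemma cinf_symb: "cinf moderate (symb c q)"
  unfolding symb_def[abs_def]
  by (intro cinf_add[OF growth_module_moderate] cinf_mult[OF growth_module_moderate]
      cinf_moderate_const cinf_moderate_x smooth_periodicD(3) c q)

lemma symb_periodic: "symb c q i (t + 2 * pi) \<xi> = symb c q i t \<xi>"
  using smooth_periodicD(2)[OF c] smooth_periodicD(2)[OF q] by (simp add: symb_def)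

lemma cinf_phase: "cinf unconstrained (phase c q)"
  by (intro cinf_prim_t cinf_unconstrained[OF cinf_symb])

lemma phase_deriv: "((\<lambda>t. phase c q i t \<xi>) has_vector_derivative symb c q i t \<xi>) (at t)"
  using prim_t_partials[OF cinf_unconstrained[OF cinf_symb]] by (simp add: partials_def)

text \<open>The exponent of the monodromy. A frequency is resonant exactly if the exponential of
  this value is 1.\<close>

lemma phase_2pi: "phase c q i (2 * pi) \<xi> = 2 * pi * (\<i> * \<xi> * mean c + mean q)"
proof -
  have int: "f integrable_on {0..2 * pi}" if "smooth_periodic f" for f
  proof -
    have "continuous_on UNIV f"
      using cont2_compose[OF cinf_cont2[OF smooth_periodicD(3)[OF that]], of "\<lambda>x. x" "\<lambda>x. x"] by auto
    then show ?thesis by (intro integrable_continuous_real) (rule continuous_on_subset, auto)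
  qed
  have "phase c q i (2 * pi) \<xi> = integral {0..2 * pi} (\<lambda>s. \<i> * \<xi> * c s + q s)"
    by (subst prim_t_eq_integral) (auto simp: symb_def cinf_unconstrained[OF cinf_symb])
  also have "\<dots> = \<i> * \<xi> * integral {0..2 * pi} c + integral {0..2 * pi} q"
    using int[OF c] int[OF q] integrable_on_mult_right[OF int[OF c], of "\<i> * \<xi>"]
    by (subst Henstock_Kurzweil_Integration.integral_add) auto
  finally show ?thesis by (simp add: mean_def field_simps)
qed

lemma phase_shift: "phase c q i (t + 2 * pi) \<xi> = phase c q i t \<xi> + phase c q i (2 * pi) \<xi>"
proof -
  have "((\<lambda>t. phase c q i (t + 2 * pi) \<xi>) has_vector_derivative symb c q i t \<xi>) (at t)" for t
  proof -
    have "(((\<lambda>t. phase c q i t \<xi>) \<circ> (\<lambda>t. t + 2 * pi)) has_vector_derivative (1 *\<^sub>R symb c q i (t + 2 * pi) \<xi>)) (at t)"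
      by (rule vector_diff_chain_at[OF _ phase_deriv]) (auto intro!: derivative_eq_intros)
    then show ?thesis by (simp add: o_def symb_periodic)
  qed
  from has_vector_derivative_diff[OF this phase_deriv[where \<xi>=\<xi>]]
  have d: "((\<lambda>t. phase c q i (t + 2 * pi) \<xi> - phase c q i t \<xi>) has_vector_derivative 0) (at t)" for t
    by simp
  have "norm ((phase c q i (t + 2 * pi) \<xi> - phase c q i t \<xi>) - (phase c q i (0 + 2 * pi) \<xi> - phase c q i 0 \<xi>))
      \<le> 0 * norm (t - 0)"
    by (rule vector_mvt_bound[OF convex_UNIV d]) auto
  then show ?thesis by (simp add: prim_t_0 diff_eq_eq add.commute)
qed

text \<open>Variation of constants with value \<open>w0 \<xi>\<close> at \<open>t = 0\<close>. The
  initial value is a function of the frequency, to be chosen so as to obtain periodicity or a zero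
  at a prescribed point.\<close>

definition voc :: "(real \<Rightarrow> complex) \<Rightarrow> (unit \<Rightarrow> tfun) \<Rightarrow> unit \<Rightarrow> tfun" where
  "voc w0 g i t \<xi> = exp (- phase c q i t \<xi>) * (w0 \<xi> + prim_t (\<lambda>i t \<xi>. exp (phase c q i t \<xi>) * g i t \<xi>) i t \<xi>)"

lemma cinf_exp_phase: "cinf unconstrained (\<lambda>i t \<xi>. exp (phase c q i t \<xi>))"
  by (rule cinf_exp[OF growth_module_unconstrained _ cinf_phase]) (simp add: unconstrained_def)

lemma cinf_exp_phase_mult: "cinf B g \<Longrightarrow> cinf unconstrained (\<lambda>i t \<xi>. exp (phase c q i t \<xi>) * g i t \<xi>)"
  by (intro cinf_mult[OF growth_module_unconstrained] cinf_exp_phase cinf_unconstrained)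

lemma cinf_voc:
  assumes "cinf B g" "smooth1 w0"
  shows "cinf unconstrained (voc w0 g)"
proof -
  have "cinf unconstrained (\<lambda>i t \<xi>. - 1 * phase c q i t \<xi>)"
    by (intro cinf_mult[OF growth_module_unconstrained] cinf_phase cinf_unconstrained[OF cinf_moderate_const])
  then have "cinf unconstrained (\<lambda>i t \<xi>. exp (- 1 * phase c q i t \<xi>))"
    by (rule cinf_exp[OF growth_module_unconstrained, rotated]) (simp add: unconstrained_def)
  then have "cinf unconstrained (\<lambda>i t \<xi>. exp (- phase c q i t \<xi>))" by simp
  then show ?thesis unfolding voc_def[abs_def]
    by (intro cinf_mult[OF growth_module_unconstrained] cinf_add[OF growth_module_unconstrained]
        cinf_of_smooth1 assms(2) cinf_prim_t cinf_exp_phase_mult[OF assms(1)])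
qed

lemma voc_ode:
  assumes "cinf B g"
  shows "((\<lambda>t. voc w0 g i t \<xi>) has_vector_derivative g i t \<xi> - symb c q i t \<xi> * voc w0 g i t \<xi>) (at t)"
proof -
  let ?P = "prim_t (\<lambda>i t \<xi>. exp (phase c q i t \<xi>) * g i t \<xi>)"
  have 1: "((\<lambda>t. exp (- phase c q i t \<xi>)) has_vector_derivative (- symb c q i t \<xi>) * exp (- phase c q i t \<xi>)) (at t)"
    by (rule field_vector_diff_chain_at[of "\<lambda>t. - phase c q i t \<xi>" _ _ exp, unfolded o_def])
      (auto intro!: derivative_eq_intros phase_deriv)
  have "((\<lambda>t. ?P i t \<xi>) has_vector_derivative exp (phase c q i t \<xi>) * g i t \<xi>) (at t)"
    using prim_t_partials[OF cinf_exp_phase_mult[OF assms]] by (simp add: partials_def)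
  from has_vector_derivative_add[OF has_vector_derivative_const this, of "w0 \<xi>"]
  have 2: "((\<lambda>t. w0 \<xi> + ?P i t \<xi>) has_vector_derivative exp (phase c q i t \<xi>) * g i t \<xi>) (at t)" by simp
  from has_vector_derivative_mult[OF 1 2] show ?thesis
    unfolding voc_def by (simp add: algebra_simps flip: exp_add)
qed

text \<open>The difference of \<open>w\<close> and its translate by one period solves the
  homogeneous equation, so its vanishing at a single point \<open>s\<close> suffices.\<close>

lemma ode_periodic:
  assumes w: "\<And>t. (w has_vector_derivative g () t \<xi> - symb c q () t \<xi> * w t) (at t)"
    and g: "periodic_fam g" and s: "w (s + 2 * pi) = w s"
  shows "w (t + 2 * pi) = w t"
proof -
  have "((\<lambda>t. w (t + 2 * pi)) has_vector_derivative g () t \<xi> - symb c q () t \<xi> * w (t + 2 * pi)) (at t)" for t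
  proof -
    have "((w \<circ> (\<lambda>t. t + 2 * pi)) has_vector_derivative (1 *\<^sub>R (g () (t + 2 * pi) \<xi> - symb c q () (t + 2 * pi) \<xi> * w (t + 2 * pi)))) (at t)"
      by (rule vector_diff_chain_at[OF _ w]) (auto intro!: derivative_eq_intros)
    then show ?thesis using g by (simp add: o_def symb_periodic)
  qed
  from has_vector_derivative_diff[OF this w]
  have "((\<lambda>t. w (t + 2 * pi) - w t) has_vector_derivative - symb c q () t \<xi> * (w (t + 2 * pi) - w t)) (at t)" for t
    by (simp add: algebra_simps)
  from ode_homogeneous[OF this phase_deriv, of t s] show ?thesis using s by simp
qed

text \<open>The \<open>\<xi>\<close>-derivative of a solution solves the same equation with \<open>\<partial>\<^sub>\<xi> g - \<i> c w\<close> in place of \<open>g\<close>. Hence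
  a bound valid for all rapidly decreasing data, under a normalisation \<open>N\<close> that is stable under
  differentiation, controls all derivatives.\<close>

lemma bootstrap:
  fixes N :: "(unit \<Rightarrow> tfun) \<Rightarrow> bool"
  assumes apriori: "\<And>w g. cinf unconstrained w \<Longrightarrow> periodic_fam w \<Longrightarrow> N w \<Longrightarrow> rapid g \<Longrightarrow>
      (\<And>t \<xi>. ((\<lambda>t. w () t \<xi>) has_vector_derivative g () t \<xi> - symb c q () t \<xi> * w () t \<xi>) (at t)) \<Longrightarrow> rapid w"
    and N: "\<And>w. cinf unconstrained w \<Longrightarrow> N w \<Longrightarrow> N (\<lambda>i. pdx (w i))"
    and w: "cinf unconstrained w" "periodic_fam w" "N w" "cinf rapid g"
      "\<And>t \<xi>. ((\<lambda>t. w () t \<xi>) has_vector_derivative g () t \<xi> - symb c q () t \<xi> * w () t \<xi>) (at t)"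
  shows "cinf rapid w"
proof -
  have "ck rapid n w" if "ck rapid n g" for n
    using w(1,2,3,5) that
  proof (induction n arbitrary: w g)
    case 0
    then show ?case using apriori by (auto intro: cinf_cont2)
  next
    case (Suc n w g)
    note P = cinf_partials[OF Suc.prems(1)]
    obtain g1 g2 where g12: "partials g g1 g2" "ck rapid n g1" "ck rapid n g2" and g0: "rapid g"
      using Suc.prems(5) by auto
    have gn: "ck rapid n g" using Suc.prems(5) by (rule ck_SucD)
    \<comment> \<open>The source term of the differentiated equation contains \<open>w\<close>, so
      \<open>w\<close> is controlled to order \<open>n\<close> before its \<xi>-derivative is
      treated.\<close>
    have wn: "ck rapid n w" by (rule Suc.IH[OF Suc.prems(1-4) gn])
    have "ck rapid n (\<lambda>i t \<xi>. g i t \<xi> + - 1 * (symb c q i t \<xi> * w i t \<xi>))"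
      using cinf_symb by (intro ck_add[OF growth_module_rapid] ck_mult[OF growth_module_rapid] gn wn ck_moderate_const)
        (simp add: cinf_def)
    moreover have "(\<lambda>i t \<xi>. g i t \<xi> + - 1 * (symb c q i t \<xi> * w i t \<xi>)) = (\<lambda>i. pdt (w i))"
      by (intro ext) (simp add: pdt_def vector_derivative_at[OF Suc.prems(4)])
    ultimately have wt: "ck rapid n (\<lambda>i. pdt (w i))" by simp
    define g' where "g' = (\<lambda>i t \<xi>. g2 i t \<xi> + - \<i> * (c t * w i t \<xi>))"
    have "ck rapid n (\<lambda>i. pdx (w i))"
    proof (rule Suc.IH[OF P(3)])
      have "w () (t + 2 * pi) = w () t" for t using Suc.prems(2) by (intro ext) blast
      then show "periodic_fam (\<lambda>i. pdx (w i))" by (simp add: pdx_def)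
      show "N (\<lambda>i. pdx (w i))" using N Suc.prems by blast
      show "ck rapid n g'"
        unfolding g'_def using smooth_periodicD(3)[OF c, where 'i=unit]
        by (intro ck_add[OF growth_module_rapid] ck_mult[OF growth_module_rapid] g12 wn ck_moderate_const)
          (simp add: cinf_def)
      fix t \<xi>
      have "((\<lambda>\<xi>. pdt (w ()) t \<xi>) has_vector_derivative g' () t \<xi> - symb c q () t \<xi> * pdx (w ()) t \<xi>) (at \<xi>)"
      proof -
        have "pdt (w ()) t = (\<lambda>\<xi>. g () t \<xi> - symb c q () t \<xi> * w () t \<xi>)"
          by (intro ext) (simp add: pdt_def vector_derivative_at[OF Suc.prems(4)])
        moreover have sd: "((\<lambda>\<xi>. symb c q () t \<xi>) has_vector_derivative \<i> * c t) (at \<xi>)"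
        proof -
          have "((\<lambda>\<xi>. complex_of_real \<xi> * (\<i> * c t) + q t) has_vector_derivative (1 * (\<i> * c t) + 0)) (at \<xi>)"
            by (intro has_vector_derivative_add has_vector_derivative_const has_vector_derivative_mult_left)
              (use has_vector_derivative_of_real[of "\<lambda>x. x" 1] in auto)
          then show ?thesis by (simp add: symb_def mult_ac)
        qed
        moreover have gd: "((\<lambda>\<xi>. g () t \<xi>) has_vector_derivative g2 () t \<xi>) (at \<xi>)"
          using g12 by (simp add: partials_def)
        ultimately show ?thesis
          using has_vector_derivative_diff[OF gd has_vector_derivative_mult[OF sd cinf_deriv(2)[OF Suc.prems(1)]]]
          by (simp add: g'_def algebra_simps)
      qed
      moreover have "((\<lambda>t. pdx (w ()) t \<xi>) has_vector_derivative pdt (pdx (w ())) t \<xi>) (at t)"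
        using cinf_deriv(1)[OF P(3)] .
      \<comment> \<open>The \<open>t\<close>-derivative of \<open>pdx (w ())\<close> is not given by
        the equation directly. Interchanging the derivatives reduces it to the \<xi>-derivative of
        the right-hand side.\<close>
      moreover have "pdt (pdx (w ())) t \<xi> = pdx (pdt (w ())) t \<xi>"
        using cinf_clairaut[OF Suc.prems(1)] by simp
      ultimately show "((\<lambda>t. pdx (w ()) t \<xi>) has_vector_derivative g' () t \<xi> - symb c q () t \<xi> * pdx (w ()) t \<xi>) (at t)"
        by (simp add: pdx_def vector_derivative_at)
    qed
    with wt show ?case
      using apriori[OF Suc.prems(1-3) g0 Suc.prems(4)] P(1) cinf_cont2[OF Suc.prems(1)]
      by (intro ck_SucI)
  qed
  then show ?thesis using w(4) by (simp add: cinf_def)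
qed

text \<open>Injectivity of the transform on rapidly decreasing families carries the equation back
  from the frequency side.\<close>

lemma solvable_of_multiplier_solution:
  assumes f: "f \<in> schwartz" and w: "cinf rapid w" "periodic_fam w"
    and eq: "\<And>t \<xi>. ((\<lambda>t. w () t \<xi>) has_vector_derivative FT (\<lambda>_. f) () t \<xi> - symb c q () t \<xi> * w () t \<xi>) (at t)"
  shows "\<exists>u\<in>schwartz. opL c q u = f"
proof -
  have cu: "cinf rapid (IFT w)" using w(1) by (rule cinf_IFT)
  have "FT (\<lambda>i. opL c q (IFT w i)) i t \<xi> = FT (\<lambda>_::unit. f) i t \<xi>" for i t \<xi>
    unfolding FT_opL[OF c q cu] FT_IFT[OF w(1)]
    using vector_derivative_at[OF eq[of \<xi> t]] by (simp add: symb_def pdt_def)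
  then have "(\<lambda>i. opL c q (IFT w i)) = (\<lambda>_::unit. f)"
    by (intro FT_eq_imp_eq[OF cinf_opL[OF c q cu] schwartz_cinf[OF f]] ext)
  then have "opL c q (IFT w ()) = f" by (auto simp: fun_eq_iff)
  moreover have "IFT w () \<in> schwartz"
  proof (rule cinf_schwartz)
    show "cinf rapid (\<lambda>i::unit. IFT w ())" using cu unit_abs_eta_conv[of "IFT w"] by simp
    show "periodic_t (IFT w ())" unfolding periodic_t_def using w(2) by (simp add: IFT_def FT_def)
  qed
  ultimately show ?thesis by blast
qed

end

section \<open>Compatibility conditions\<close>

lemma schwartz_term_le_seminorm:
  assumes "f \<in> schwartz"
  shows "schwartz_term \<alpha> \<beta> \<gamma> f p \<le> schwartz_seminorm \<alpha> \<beta> \<gamma> f"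
  unfolding schwartz_seminorm_def using assms by (intro cSUP_upper) (auto simp: schwartz_def)

lemma schwartz_seminorm_nonneg:
  assumes "f \<in> schwartz"
  shows "0 \<le> schwartz_seminorm \<alpha> \<beta> \<gamma> f"
  using schwartz_term_le_seminorm[OF assms, of \<alpha> \<beta> \<gamma> "(0, 0)"] by (auto simp: schwartz_term_def intro: order_trans[OF norm_ge_zero])

text \<open>The integrable majorant \<open>C / (1 + x^2)\<close> costs the weights of exponent 0 and
  2 without derivatives; the common index bound 2 covers both.\<close>

lemma triple_sum_ge:
  fixes g :: "nat \<Rightarrow> nat \<Rightarrow> nat \<Rightarrow> real"
  assumes "\<And>a b c. 0 \<le> g a b c"
  shows "g 0 0 0 + g 0 0 2 \<le> (\<Sum>a\<le>2. \<Sum>b\<le>2. \<Sum>c\<le>2. g a b c)"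
  using assms by (simp add: eval_nat_numeral atMost_Suc add_nonneg_nonneg)

text \<open>This is the continuity estimate that makes evaluation of the transform at a fixed
  frequency, and integrals of it over a period, tempered.\<close>

lemma FT_le_seminorms:
  assumes f: "f \<in> schwartz"
  shows "norm (FT (\<lambda>_::unit. f) () t \<xi>) \<le> (LINT x::real|lborel. 1 / (1 + x\<^sup>2)) *
    (\<Sum>\<alpha>\<le>2. \<Sum>\<beta>\<le>2. \<Sum>\<gamma>\<le>2. schwartz_seminorm \<alpha> \<beta> \<gamma> f)"
proof -
  define C where "C = schwartz_seminorm 0 0 0 f + schwartz_seminorm 0 0 2 f"
  have C: "norm (f t x) \<le> C / (1 + x\<^sup>2)" for t x
  proof -
    have "norm (f t x) + x\<^sup>2 * norm (f t x) \<le> C"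
      using schwartz_term_le_seminorm[OF f, of 0 0 0 "(t, x)"] schwartz_term_le_seminorm[OF f, of 0 0 2 "(t, x)"]
      by (simp add: C_def schwartz_term_def norm_mult norm_power)
    then show ?thesis by (simp add: pos_le_divide_eq add_pos_nonneg algebra_simps)
  qed
  have ci: "cinf rapid (\<lambda>_::unit. f)" using schwartz_cinf[OF f] .
  have "norm (FT (\<lambda>_::unit. f) () t \<xi>) \<le> (LINT x|lborel. norm (f t x * cis (- (x * \<xi>))))"
    unfolding FT_def by (rule integral_norm_bound)
  also have "\<dots> \<le> (LINT x|lborel. C / (1 + x\<^sup>2))"
  proof (rule integral_mono)
    show "integrable lborel (\<lambda>x. norm (f t x * cis (- (x * \<xi>))))"
      by (intro integrable_norm integrable_dominated[of _ C])
        (use C in \<open>auto simp: norm_mult intro!: continuous_intros cinf_continuous_x[OF ci]\<close>)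
  qed (use C integrable_inverse_square in \<open>auto simp: norm_mult\<close>)
  also have "\<dots> = (LINT x|lborel. C * (1 / (1 + x\<^sup>2)))" by simp
  also have "\<dots> = (LINT x::real|lborel. 1 / (1 + x\<^sup>2)) * C"
    unfolding integral_mult_right_zero by (simp add: mult.commute)
  also have "\<dots> \<le> (LINT x::real|lborel. 1 / (1 + x\<^sup>2)) *
    (\<Sum>\<alpha>\<le>2. \<Sum>\<beta>\<le>2. \<Sum>\<gamma>\<le>2. schwartz_seminorm \<alpha> \<beta> \<gamma> f)"
    unfolding C_def using schwartz_seminorm_nonneg[OF f]
    by (intro mult_left_mono triple_sum_ge Bochner_Integration.integral_nonneg) (auto simp: add_nonneg_nonneg)
  finally show ?thesis .
qed

context
  fixes c q :: "real \<Rightarrow> complex"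
  assumes c: "smooth_periodic c" and q: "smooth_periodic q"
begin

text \<open>At a resonant frequency \<open>\<xi>\<close> the distribution \<open>exp (phase t \<xi> - \<i> x \<xi>)\<close> is periodic in \<open>t\<close> and lies in the
  kernel of the transpose.\<close>

lemma compatibility:
  assumes f: "f \<in> schwartz" and orth: "\<forall>v\<in>ker_Lt c q. v f = 0"
    and res: "exp (phase c q () (2 * pi) \<xi>) = 1"
  shows "prim_t (\<lambda>i t \<xi>. exp (phase c q i t \<xi>) * FT (\<lambda>_. f) i t \<xi>) () (2 * pi) \<xi> = 0"
proof -
  define E where "E t = exp (phase c q () t \<xi>)" for t
  define v where "v \<phi> = integral {0..2 * pi} (\<lambda>s. E s * FT (\<lambda>_::unit. \<phi>) () s \<xi>)" for \<phi>
  have Ec: "continuous_on UNIV E"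
    unfolding E_def using cont2_compose[OF cinf_cont2[OF cinf_exp_phase[OF c q]], of "\<lambda>t. t" "\<lambda>_. \<xi>" "()"] by auto
  have Fc: "continuous_on UNIV (\<lambda>s. FT (\<lambda>_::unit. \<phi>) () s \<xi>)" if "\<phi> \<in> schwartz" for \<phi>
    using cont2_compose[OF FT_cont2[OF schwartz_cinf[OF that]], of "\<lambda>t. t" "\<lambda>_. \<xi>"] by auto
  have vi: "(\<lambda>s. E s * FT (\<lambda>_::unit. \<phi>) () s \<xi>) integrable_on {0..2 * pi}" if "\<phi> \<in> schwartz" for \<phi>
    using continuous_on_mult[OF Ec Fc[OF that]]
    by (intro integrable_continuous_real) (rule continuous_on_subset, auto)
  obtain K where K: "\<And>t. t \<in> {0..2 * pi} \<Longrightarrow> norm (E t) \<le> K"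
  proof -
    have "compact (E ` {0..2 * pi})"
      by (rule compact_continuous_image) (auto intro: continuous_on_subset[OF Ec])
    then show thesis using that by (meson bounded_iff compact_imp_bounded imageI)
  qed
  have K0: "0 \<le> K" using order_trans[OF norm_ge_zero K[of 0]] by simp
  define J where "J = (LINT x::real|lborel. 1 / (1 + x\<^sup>2))"
  have "v \<in> tempered"
    unfolding tempered_def mem_Collect_eq
  proof (intro conjI allI ballI)
    fix f g assume f: "f \<in> schwartz" and g: "g \<in> schwartz"
    show "v (\<lambda>t x. f t x + g t x) = v f + v g"
      unfolding v_def FT_add[OF schwartz_cinf[OF f] schwartz_cinf[OF g]] distrib_left
      by (rule Henstock_Kurzweil_Integration.integral_add) (rule vi, fact)+
  next
    fix a f assume f: "f \<in> schwartz"
    have "FT (\<lambda>_::unit. \<lambda>t x. a * f t x) () s \<xi> = a * FT (\<lambda>_::unit. f) () s \<xi>" for s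
      by (rule FT_tmult)
    then show "v (\<lambda>t x. a * f t x) = a * v f"
      unfolding v_def by (simp add: mult.left_commute[of _ a])
  next
    show "\<exists>C N. \<forall>f\<in>schwartz. norm (v f) \<le> C * (\<Sum>\<alpha>\<le>N. \<Sum>\<beta>\<le>N. \<Sum>\<gamma>\<le>N. schwartz_seminorm \<alpha> \<beta> \<gamma> f)"
    proof (intro exI ballI)
      fix f assume f: "f \<in> schwartz"
      let ?S = "\<Sum>\<alpha>\<le>2. \<Sum>\<beta>\<le>2. \<Sum>\<gamma>\<le>2. schwartz_seminorm \<alpha> \<beta> \<gamma> f"
      have "norm (v f) \<le> (K * (J * ?S)) * (2 * pi - 0)"
        unfolding v_def
      proof (rule integral_bound)
        show "continuous_on {0..2 * pi} (\<lambda>s. E s * FT (\<lambda>_::unit. f) () s \<xi>)"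
          using continuous_on_mult[OF Ec Fc[OF f]] by (rule continuous_on_subset) auto
        show "norm (E s * FT (\<lambda>_::unit. f) () s \<xi>) \<le> K * (J * ?S)" if "s \<in> {0..2 * pi}" for s
          unfolding norm_mult J_def by (intro mult_mono K FT_le_seminorms f that K0) auto
      qed simp
      then show "norm (v f) \<le> (2 * pi * K * J) * ?S" by (simp add: mult_ac)
    qed
  qed
  moreover have "v (opL c q \<phi>) = 0" if "\<phi> \<in> schwartz" for \<phi>
  proof -
    note ci = schwartz_cinf[OF that, where 'i=unit]
    have per: "FT (\<lambda>_::unit. \<phi>) () (0 + 2 * pi) \<xi> = FT (\<lambda>_::unit. \<phi>) () 0 \<xi>"
      using that by (intro FT_periodic) (auto simp: schwartz_def periodic_t_def)
    \<comment> \<open>\<open>E\<close> is the integrating factor, so the integrand is the derivative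
      of \<open>E\<close> times the transform of \<phi>. Resonance makes \<open>E\<close> agree at
      both ends of the period, and the boundary terms cancel.\<close>
    have "((\<lambda>s. E s * FT (\<lambda>_::unit. opL c q \<phi>) () s \<xi>) has_integral
        (E (2 * pi) * FT (\<lambda>_::unit. \<phi>) () (2 * pi) \<xi> - E 0 * FT (\<lambda>_::unit. \<phi>) () 0 \<xi>)) {0..2 * pi}"
    proof (rule fundamental_theorem_of_calculus[OF _ has_vector_derivative_at_within])
      fix s :: real
      have "(E has_vector_derivative symb c q () s \<xi> * E s) (at s)"
        unfolding E_def
        by (rule field_vector_diff_chain_at[of _ _ _ exp, unfolded o_def])
          (auto intro!: derivative_eq_intros phase_deriv[OF c q])
      from has_vector_derivative_mult[OF this cinf_deriv(1)[OF cinf_FT[OF ci]]]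
      show "((\<lambda>s. E s * FT (\<lambda>_::unit. \<phi>) () s \<xi>) has_vector_derivative E s * FT (\<lambda>_::unit. opL c q \<phi>) () s \<xi>) (at s)"
        unfolding FT_opL[OF c q ci] by (simp add: symb_def algebra_simps)
    qed simp
    moreover have "E (2 * pi) = 1" "E 0 = 1" using res by (auto simp: E_def prim_t_0)
    ultimately show ?thesis using per by (simp add: v_def integral_unique)
  qed
  ultimately have "v \<in> ker_Lt c q" by (simp add: ker_Lt_def)
  then have "v f = 0" using orth by blast
  moreover have "prim_t (\<lambda>i t \<xi>. exp (phase c q i t \<xi>) * FT (\<lambda>_. f) i t \<xi>) () (2 * pi) \<xi> = v f"
    unfolding v_def E_def
    by (rule prim_t_eq_integral[OF cinf_exp_phase_mult[OF c q cinf_FT[OF schwartz_cinf[OF f]]]]) simp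
  ultimately show ?thesis by simp
qed

end

section \<open>Smooth functions of one variable\<close>

lemma smooth1_iff_cinf: "smooth1 \<phi> \<longleftrightarrow> cinf unconstrained (\<lambda>_::unit. \<lambda>t x. \<phi> t)"
  using cinf_of_smooth1(1) smooth1_of_cinf(1)[of unconstrained "\<lambda>_::unit. \<lambda>t x. \<phi> t"] by auto

lemma smooth1_const: "smooth1 (\<lambda>x. a)"
  unfolding smooth1_iff_cinf by (rule cinf_unconstrained[OF cinf_moderate_const])

lemma smooth1_add: "smooth1 f \<Longrightarrow> smooth1 g \<Longrightarrow> smooth1 (\<lambda>x. f x + g x)"
  and smooth1_mult: "smooth1 f \<Longrightarrow> smooth1 g \<Longrightarrow> smooth1 (\<lambda>x. f x * g x)"
  unfolding smooth1_iff_cinf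
  by (rule cinf_add[OF growth_module_unconstrained] cinf_mult[OF growth_module_unconstrained]; assumption)+

lemma smooth1_diff: "smooth1 f \<Longrightarrow> smooth1 g \<Longrightarrow> smooth1 (\<lambda>x. f x - g x)"
  using smooth1_add[OF _ smooth1_mult[OF smooth1_const[of "-1"]], of f g] by simp

lemma smooth1_of_real: "smooth1 complex_of_real"
  using smooth1_of_cinf(2)[OF cinf_moderate_x] by simp

lemma smooth1_exp: "smooth1 f \<Longrightarrow> smooth1 (\<lambda>x. exp (f x))"
  unfolding smooth1_iff_cinf
  by (rule cinf_exp[OF growth_module_unconstrained]) (simp_all add: unconstrained_def)

lemma smooth1_deriv: "smooth1 f \<Longrightarrow> \<exists>f'. smooth1 f' \<and> (\<forall>x. (f has_vector_derivative f' x) (at x))"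
proof -
  assume "smooth1 f"
  then obtain F where F: "F 0 = f" "\<And>n x. (F n has_vector_derivative F (Suc n) x) (at x)"
    by (auto simp: smooth1_def)
  then have "smooth1 (F (Suc 0))" unfolding smooth1_def by (intro exI[of _ "\<lambda>n. F (Suc n)"]) auto
  with F show ?thesis by blast
qed

lemma smooth1_continuous: "smooth1 f \<Longrightarrow> continuous_on A f"
  using smooth1_deriv
  by (metis continuous_at_imp_continuous_on has_vector_derivative_continuous)

lemma smooth1_inverse:
  assumes "smooth1 f" "\<And>x. f x \<noteq> 0"
  shows "smooth1 (\<lambda>x. inverse (f x))"
proof -
  have "ck unconstrained n (\<lambda>_::unit. \<lambda>t x. inverse (f t))" for n
  proof (induction n)
    case 0
    have "continuous_on UNIV (\<lambda>p::real \<times> real. inverse (f (fst p)))"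
      by (intro continuous_intros continuous_on_compose2[OF smooth1_continuous[OF assms(1), of UNIV]])
        (auto simp: assms)
    then show ?case by (simp add: unconstrained_def cont2_def)
  next
    case (Suc n)
    obtain f' where f': "smooth1 f'" "\<And>x. (f has_vector_derivative f' x) (at x)"
      using smooth1_deriv[OF assms(1)] by blast
    have "cinf unconstrained (\<lambda>_::unit. \<lambda>t x. - f' t)"
      using smooth1_mult[OF smooth1_const[of "-1"] f'(1)] by (simp add: smooth1_iff_cinf)
    then have "ck unconstrained n (\<lambda>_::unit. \<lambda>t x. - f' t * (inverse (f t) * inverse (f t)))"
      by (intro ck_mult[OF growth_module_unconstrained] Suc) (simp add: cinf_def)
    moreover have "ck unconstrained n (\<lambda>_::unit. \<lambda>t x. 0)"
      by (rule ck_unconstrained[OF ck_moderate_const])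
    moreover have "((\<lambda>t. inverse (f t)) has_vector_derivative - f' t * (inverse (f t) * inverse (f t))) (at t)" for t
      using field_vector_diff_chain_at[OF f'(2) DERIV_inverse'[OF DERIV_ident assms(2)], of t]
      by (simp add: o_def)
    then have "partials (\<lambda>_::unit. \<lambda>t x. inverse (f t))
        (\<lambda>_. \<lambda>t x. - f' t * (inverse (f t) * inverse (f t))) (\<lambda>_ t x. 0)"
      by (simp add: partials_def)
    ultimately show ?case
      using ck_cont2[OF Suc] by (intro ck_SucI[of unconstrained]) (simp add: unconstrained_def)
  qed
  then show ?thesis by (simp add: smooth1_iff_cinf cinf_def)
qed

text \<open>The compositions with all derivatives of \<phi> are treated at once, because
  differentiation raises the order \<open>m\<close> by one and contributes the factor
  \<open>a'\<close>.\<close>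

lemma smooth1_compose:
  fixes a :: "real \<Rightarrow> real"
  assumes "smooth1 \<phi>" "smooth1 (\<lambda>x. complex_of_real (a x))"
  shows "smooth1 (\<lambda>x. \<phi> (a x))"
proof -
  obtain F where F: "F 0 = \<phi>" "\<And>n x. (F n has_vector_derivative F (Suc n) x) (at x)"
    using assms(1) by (auto simp: smooth1_def)
  obtain a' where a': "smooth1 a'" "\<And>x. ((\<lambda>x. complex_of_real (a x)) has_vector_derivative a' x) (at x)"
    using smooth1_deriv[OF assms(2)] by blast
  have aR: "(a has_vector_derivative Re (a' x)) (at x)" for x
    using bounded_linear.has_vector_derivative[OF bounded_linear_Re a'(2)[of x]] by simp
  have aI: "a' x = complex_of_real (Re (a' x))" for x
    using vector_derivative_unique_at[OF bounded_linear.has_vector_derivative[OF bounded_linear_Im a'(2)[of x]], of 0]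
    by (simp add: complex_eq_iff)
  have d: "((\<lambda>t. F m (a t)) has_vector_derivative a' t * F (Suc m) (a t)) (at t)" for m t
    using vector_diff_chain_at[OF aR F(2)] by (simp add: o_def scaleR_conv_of_real flip: aI)
  have cont: "continuous_on UNIV (\<lambda>p::real \<times> real. F m (a (fst p)))" for m
  proof (rule continuous_on_compose2[of UNIV "\<lambda>t. F m (a t)"])
    show "continuous_on UNIV (\<lambda>t. F m (a t))"
      using d by (meson continuous_at_imp_continuous_on has_vector_derivative_continuous)
  qed (auto intro!: continuous_intros)
  have "ck unconstrained n (\<lambda>_::unit. \<lambda>t x. F m (a t))" for n m
  proof (induction n arbitrary: m)
    case 0
    then show ?case using cont by (simp add: unconstrained_def cont2_def)
  next
    case (Suc n)
    have "ck unconstrained n (\<lambda>_::unit. \<lambda>t x. a' t * F (Suc m) (a t))"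
      using a'(1) by (intro ck_mult[OF growth_module_unconstrained] Suc) (simp add: smooth1_iff_cinf cinf_def)
    moreover have "ck unconstrained n (\<lambda>_::unit. \<lambda>t x. 0)"
      by (rule ck_unconstrained[OF ck_moderate_const])
    moreover have "partials (\<lambda>_::unit. \<lambda>t x. F m (a t)) (\<lambda>_ t x. a' t * F (Suc m) (a t)) (\<lambda>_ t x. 0)"
      using d by (simp add: partials_def)
    ultimately show ?case
      using ck_cont2[OF Suc] by (intro ck_SucI[of unconstrained]) (simp add: unconstrained_def)
  qed
  from this[of _ 0] show ?thesis by (simp add: smooth1_iff_cinf cinf_def F)
qed

lemma smooth1_cos: "smooth1 (\<lambda>t. complex_of_real (cos (t - m)))"
  unfolding smooth1_def
\<comment> \<open>Each differentiation of the cosine is a shift of its argument by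
  \<open>pi / 2\<close>.\<close>
proof (rule exI[of _ "\<lambda>n t. complex_of_real (cos (t - m + real n * (pi / 2)))"], intro conjI allI)
  fix n t
  have "((\<lambda>t. cos (t - m + real n * (pi / 2))) has_real_derivative cos (t - m + real (Suc n) * (pi / 2))) (at t)"
  proof -
    have "t - m + real (Suc n) * (pi / 2) = (t - m + real n * (pi / 2)) + pi / 2" by (simp add: field_simps)
    then have "cos (t - m + real (Suc n) * (pi / 2)) = - sin (t - m + real n * (pi / 2))"
      by (simp only: minus_sin_cos_eq of_real_eq_id id_apply)
    then show ?thesis by (auto intro!: derivative_eq_intros)
  qed
  then show "((\<lambda>t. complex_of_real (cos (t - m + real n * (pi / 2)))) has_vector_derivative
      complex_of_real (cos (t - m + real (Suc n) * (pi / 2)))) (at t)"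
    by (intro has_vector_derivative_of_real) (simp add: has_real_derivative_iff_has_vector_derivative)
qed simp

lemma smooth1_antiderivative:
  assumes "smooth1 f"
  shows "\<exists>F. smooth1 F \<and> (\<forall>x. (F has_vector_derivative f x) (at x)) \<and> F a = 0"
proof -
  have ci: "cinf unconstrained (\<lambda>_::unit. \<lambda>t x. f t)" using assms by (simp add: smooth1_iff_cinf)
  define F where "F t = prim_t (\<lambda>_::unit. \<lambda>t x. f t) () t 0" for t
  have "smooth1 F" unfolding F_def by (rule smooth1_of_cinf(1)[OF cinf_prim_t[OF ci]])
  then have "smooth1 (\<lambda>t. F t - F a)" by (intro smooth1_diff smooth1_const)
  moreover have "((\<lambda>t. F t - F a) has_vector_derivative f x) (at x)" for x
  proof -
    have "(F has_vector_derivative f x) (at x)"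
      using prim_t_partials[OF ci] by (simp add: partials_def F_def[abs_def])
    from has_vector_derivative_diff[OF this has_vector_derivative_const[of "F a"]] show ?thesis by simp
  qed
  ultimately show ?thesis by (intro exI[of _ "\<lambda>t. F t - F a"]) auto
qed

text \<open>The quotient is the integral over \<open>{0..1}\<close> of \<open>f'\<close> along the
  segment from \<open>a\<close> to \<open>x\<close>, which is visibly smooth in \<open>x\<close>. It
  serves to divide by functions with a simple zero.\<close>

lemma hadamard_quotient:
  assumes "smooth1 f" "f a = 0"
  shows "\<exists>g. smooth1 g \<and> (\<forall>x. f x = complex_of_real (x - a) * g x) \<and> (f has_vector_derivative g a) (at a)"
proof -
  obtain F where F: "F 0 = f" "\<And>n x. (F n has_vector_derivative F (Suc n) x) (at x)"
    using assms(1) by (auto simp: smooth1_def)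
  have Fc: "continuous_on UNIV (F n)" for n
    using F(2) by (meson continuous_at_imp_continuous_on has_vector_derivative_continuous)
  define G where "G n x = integral {0..1} (\<lambda>\<sigma>. complex_of_real (\<sigma> ^ n) * F (Suc n) (a + \<sigma> * (x - a)))" for n x
  have chain: "((\<lambda>x. F n (a + \<sigma> * (x - a))) has_vector_derivative \<sigma> *\<^sub>R F (Suc n) (a + \<sigma> * (x - a))) (at x)"
    and chain2: "((\<lambda>\<sigma>. F n (a + \<sigma> * (x - a))) has_vector_derivative (x - a) *\<^sub>R F (Suc n) (a + \<sigma> * (x - a))) (at \<sigma>)" for n \<sigma> x
  proof -
    have "((\<lambda>x. a + \<sigma> * (x - a)) has_real_derivative \<sigma>) (at x)"
      "((\<lambda>\<sigma>. a + \<sigma> * (x - a)) has_real_derivative x - a) (at \<sigma>)"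
      by (auto intro!: derivative_eq_intros)
    then show "((\<lambda>x. F n (a + \<sigma> * (x - a))) has_vector_derivative \<sigma> *\<^sub>R F (Suc n) (a + \<sigma> * (x - a))) (at x)"
      "((\<lambda>\<sigma>. F n (a + \<sigma> * (x - a))) has_vector_derivative (x - a) *\<^sub>R F (Suc n) (a + \<sigma> * (x - a))) (at \<sigma>)"
      unfolding has_real_derivative_iff_has_vector_derivative
      using vector_diff_chain_at[OF _ F(2)[of n]] by (auto simp: o_def)
  qed
  have Fc2: "continuous_on UNIV (\<lambda>p. F n (h p))" if "continuous_on UNIV h" for n and h :: "'a::topological_space \<Rightarrow> real"
    by (rule continuous_on_compose2[OF Fc that]) auto
  have "(G n has_vector_derivative G (Suc n) x) (at x)" for n x
    unfolding G_def
  proof (rule leibniz_interval)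
    show "((\<lambda>x. complex_of_real (\<sigma> ^ n) * F (Suc n) (a + \<sigma> * (x - a))) has_vector_derivative
        complex_of_real (\<sigma> ^ Suc n) * F (Suc (Suc n)) (a + \<sigma> * (x - a))) (at x)" for x \<sigma>
      using has_vector_derivative_mult_right[OF chain[of "Suc n" \<sigma> x], of "complex_of_real (\<sigma> ^ n)"]
      by (simp add: scaleR_conv_of_real mult_ac)
  qed (auto intro!: continuous_intros Fc2)
  then have "smooth1 (G 0)" unfolding smooth1_def by blast
  moreover have "f x = complex_of_real (x - a) * G 0 x" for x
  proof -
    have "((\<lambda>\<sigma>. (x - a) *\<^sub>R F (Suc 0) (a + \<sigma> * (x - a))) has_integral F 0 (a + 1 * (x - a)) - F 0 (a + 0 * (x - a))) {0..1}"
      by (rule fundamental_theorem_of_calculus[OF _ has_vector_derivative_at_within]) (use chain2 in auto)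
    then have "(x - a) *\<^sub>R integral {0..1} (\<lambda>\<sigma>. F (Suc 0) (a + \<sigma> * (x - a))) = f x"
      using assms(2) F(1) by (simp add: integral_unique flip: integral_cmul)
    then show ?thesis by (simp add: G_def scaleR_conv_of_real)
  qed
  moreover have "G 0 a = F (Suc 0) a" by (simp add: G_def)
  ultimately show ?thesis using F(2)[of 0 a] F(1) by auto
qed

section \<open>A flat function and a smooth cutoff\<close>

definition flat_poly :: "real poly \<Rightarrow> real \<Rightarrow> real" where
  "flat_poly P y = (if y \<le> 0 then 0 else poly P (inverse y) * exp (- inverse y))"

lemma poly_exp_tendsto_0: "((\<lambda>z::real. poly P z * exp (- z)) \<longlongrightarrow> 0) at_top"
proof -
  have "((\<lambda>z::real. \<Sum>i\<le>degree P. coeff P i * (z ^ i / exp z)) \<longlongrightarrow> (\<Sum>i\<le>degree P. coeff P i * 0)) at_top"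
    by (intro tendsto_sum tendsto_mult tendsto_const tendsto_power_div_exp_0)
  then show ?thesis
    by (simp add: poly_altdef sum_distrib_right exp_minus divide_inverse mult.assoc)
qed

text \<open>With \<open>z = 1/y\<close> one has \<open>dz/dy = - z^2\<close>, so
  \<open>P(z) * exp (- z)\<close> has the derivative \<open>z^2 * (P - P')(z) * exp (- z)\<close>.
  The family is thus closed under differentiation, which gives the smoothness of \<open>flat\<close>
  including the origin.\<close>

lemma flat_poly_deriv:
  "(flat_poly P has_real_derivative flat_poly (pCons 0 (pCons 0 (P - pderiv P))) y) (at y)"
proof (cases "y = 0")
  case True
  have "((\<lambda>h. (flat_poly P h - flat_poly P 0) / (h - 0)) \<longlongrightarrow> 0) (at 0)"
  proof (rule filterlim_split_at)
    have "((\<lambda>h. poly (pCons 0 P) (inverse h) * exp (- inverse h)) \<longlongrightarrow> 0) (at_right (0::real))"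
      by (rule filterlim_compose[OF poly_exp_tendsto_0 filterlim_inverse_at_top_right])
    then show "((\<lambda>h. (flat_poly P h - flat_poly P 0) / (h - 0)) \<longlongrightarrow> 0) (at_right 0)"
      by (rule Lim_transform_eventually)
        (auto simp: flat_poly_def eventually_at_right_field divide_inverse intro!: exI[of _ 1])
    show "((\<lambda>h. (flat_poly P h - flat_poly P 0) / (h - 0)) \<longlongrightarrow> 0) (at_left 0)"
      by (rule Lim_transform_eventually[OF tendsto_const])
        (auto simp: flat_poly_def eventually_at_left_field intro!: exI[of _ "-1"])
  qed
  then show ?thesis using True by (simp add: has_field_derivative_iff flat_poly_def)
next
  case False
  show ?thesis
  proof (cases "y > 0")
    case True
    have "((\<lambda>y. poly P (inverse y) * exp (- inverse y)) has_real_derivative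
        flat_poly (pCons 0 (pCons 0 (P - pderiv P))) y) (at y)"
      using True by (auto intro!: derivative_eq_intros simp: flat_poly_def power2_eq_square field_simps)
    then show ?thesis
      by (rule has_field_derivative_transform_within_open[of _ _ _ "{0<..}"]) (use True in \<open>auto simp: flat_poly_def\<close>)
  next
    case False
    with \<open>y \<noteq> 0\<close> have "y < 0" by simp
    have "((\<lambda>y. 0) has_real_derivative flat_poly (pCons 0 (pCons 0 (P - pderiv P))) y) (at y)"
      using \<open>y < 0\<close> by (simp add: flat_poly_def)
    then show ?thesis
      by (rule has_field_derivative_transform_within_open[of _ _ _ "{..<0}"]) (use \<open>y < 0\<close> in \<open>auto simp: flat_poly_def\<close>)
  qed
qed

definition flat :: "real \<Rightarrow> real" where "flat = flat_poly [:1:]"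

lemma flat_nonneg: "0 \<le> flat y" and flat_pos: "0 < y \<Longrightarrow> 0 < flat y" and flat_0: "y \<le> 0 \<Longrightarrow> flat y = 0"
  by (auto simp: flat_def flat_poly_def)

lemma smooth1_flat: "smooth1 (\<lambda>y. complex_of_real (flat y))"
  unfolding smooth1_def
  by (rule exI[of _ "\<lambda>n y. complex_of_real (flat_poly (((\<lambda>P. pCons 0 (pCons 0 (P - pderiv P))) ^^ n) [:1:]) y)"])
    (auto simp: flat_def intro!: has_vector_derivative_of_real flat_poly_deriv
      simp: has_real_derivative_iff_has_vector_derivative[symmetric])

text \<open>The cutoff is a normalised primitive of the bump \<open>flat (1 - x * x)\<close>. Its
  derivatives vanish outside \<open>{-1..1}\<close> and are bounded there, so multiplication by it
  preserves rapid decrease.\<close>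

lemma smooth_cutoff_exists:
  "\<exists>\<eta>. cinf moderate (\<lambda>i::'i. \<lambda>t x. \<eta> x) \<and> (\<forall>x. x < -1 \<longrightarrow> \<eta> x = 0) \<and>
    (\<forall>x. x > 1 \<longrightarrow> \<eta> x = (1::complex))"
proof -
  define \<beta> where "\<beta> x = flat (1 - x * x)" for x
  have "smooth1 (\<lambda>x. complex_of_real (flat (1 - x * x)))"
    by (rule smooth1_compose[OF smooth1_flat])
      (simp, intro smooth1_diff smooth1_const smooth1_mult smooth1_of_real)
  then obtain B where B: "smooth1 B" "\<And>x. (B has_vector_derivative complex_of_real (\<beta> x)) (at x)" "B (-1) = 0"
    using smooth1_antiderivative[of "\<lambda>x. complex_of_real (\<beta> x)" "-1"] unfolding \<beta>_def by blast
  have \<beta>0: "\<beta> x = 0" if "\<bar>x\<bar> \<ge> 1" for x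
    unfolding \<beta>_def using that mult_mono[of 1 "\<bar>x\<bar>" 1 "\<bar>x\<bar>"] by (intro flat_0) (auto simp: abs_mult_self_eq)
  have \<beta>p: "\<beta> x > 0" if "-1 < x" "x < 1" for x
    unfolding \<beta>_def using that abs_square_less_1[of x] by (intro flat_pos) (auto simp: power2_eq_square)
  have BR: "((\<lambda>x. Re (B x)) has_real_derivative \<beta> x) (at x)" for x
    using bounded_linear.has_vector_derivative[OF bounded_linear_Re B(2)[of x]]
    by (simp add: has_real_derivative_iff_has_vector_derivative)
  have "Re (B (-1)) < Re (B 1)"
  proof (rule DERIV_pos_imp_increasing_open[of "-1" 1])
    show "\<And>x. \<lbrakk>-1 < x; x < 1\<rbrakk> \<Longrightarrow> \<exists>y. ((\<lambda>x. Re (B x)) has_real_derivative y) (at x) \<and> 0 < y"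
      using BR \<beta>p by blast
    show "continuous_on {-1..1} (\<lambda>x. Re (B x))"
      using BR by (meson DERIV_isCont continuous_at_imp_continuous_on)
  qed simp
  then have B1: "B 1 \<noteq> 0" using B(3) by auto
  define \<eta> where "\<eta> x = inverse (B 1) * B x" for x
  have "smooth1 \<eta>" unfolding \<eta>_def by (intro smooth1_mult smooth1_const B(1))
  then obtain F where F: "F 0 = \<eta>" "\<And>n x. (F n has_vector_derivative F (Suc n) x) (at x)"
    by (auto simp: smooth1_def)
  have left: "\<eta> x = 0" if "x < -1" for x
  proof -
    have "norm (B x - B (-1)) \<le> 0 * norm (x - (-1))"
      by (rule vector_mvt_bound[OF convex_real_interval(2) B(2), of "-1"]) (use that in \<open>auto simp: \<beta>0\<close>)
    then show ?thesis using B(3) by (simp add: \<eta>_def)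
  qed
  have right: "\<eta> x = 1" if "x > 1" for x
  proof -
    have "norm (B x - B 1) \<le> 0 * norm (x - 1)"
      by (rule vector_mvt_bound[OF convex_real_interval(1) B(2), of 1]) (use that in \<open>auto simp: \<beta>0\<close>)
    then show ?thesis using B1 by (simp add: \<eta>_def)
  qed
  have F0: "F (Suc n) x = 0" if "\<bar>x\<bar> > 1" for n x
    using that
  proof (induction n arbitrary: x)
    case 0
    define S where "S = (if x > 1 then {1<..} else {..<-1::real})"
    define k where "k = (if x > 1 then 1 else 0 :: complex)"
    have "(F 0 has_vector_derivative 0) (at x)"
      by (rule has_vector_derivative_transform_within_open[of "\<lambda>_. k" _ _ S])
        (use 0 left right F(1) in \<open>auto simp: S_def k_def split: if_splits\<close>)
    then show ?case using F(2) vector_derivative_unique_at by blast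
  next
    case (Suc n)
    have "open {x::real. 1 < \<bar>x\<bar>}" by (intro open_Collect_less continuous_intros)
    moreover have "x \<in> {x. 1 < \<bar>x\<bar>}" using Suc.prems by simp
    moreover have "0 = F (Suc n) y" if "y \<in> {x. 1 < \<bar>x\<bar>}" for y using Suc.IH that by simp
    ultimately have "(F (Suc n) has_vector_derivative 0) (at x)"
      by (rule has_vector_derivative_transform_within_open[OF has_vector_derivative_const])
    then show ?case using F(2) vector_derivative_unique_at by blast
  qed
  have "moderate (\<lambda>i::'i. \<lambda>t x. F n x)" for n
  proof -
    have "continuous_on {-1..1} (F n)"
      using F(2) by (meson continuous_at_imp_continuous_on has_vector_derivative_continuous)
    then obtain C where C: "\<And>x. x \<in> {-1..1} \<Longrightarrow> norm (F n x) \<le> C"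
      using compact_imp_bounded[OF compact_continuous_image[of "{-1..1}" "F n"]]
      by (force simp: bounded_iff)
    have "norm (F n x) \<le> max C 1" for x
    proof (cases "\<bar>x\<bar> \<le> 1")
      case True
      then show ?thesis using C[of x] by (auto simp: abs_le_iff)
    next
      case False
      then show ?thesis using F0 F(1) left[of x] right[of x] by (cases n) (auto simp: abs_if split: if_splits)
    qed
    then show ?thesis by (rule moderate_bounded)
  qed
  from ck_of_seq_x[of F moderate, OF F(2) this moderate_bounded[of _ 0]]
  have "ck moderate k (\<lambda>i::'i. \<lambda>t x. F 0 x)" for k by simp
  then show ?thesis using left right by (auto simp: cinf_def F(1) intro!: exI[of _ \<eta>])
qed

section \<open>Coefficients of constant sign\<close>

text \<open>The line through \<open>cis a\<close> and \<open>cis b\<close> separates \<open>cis x\<close> from \<open>cis y\<close>.\<close>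

lemma connected_circle_arcs:
  fixes S :: "real set"
  assumes conn: "connected (cis ` S)" and ab: "a < b" "b < a + 2 * pi"
    and x: "a < x" "x < b" and y: "b < y" "y < a + 2 * pi"
    and mem: "cis x \<in> cis ` S" "cis y \<in> cis ` S"
  shows "cis a \<in> cis ` S \<or> cis b \<in> cis ` S"
proof -
  define m where "m = (a + b) / 2"
  define d where "d = (b - a) / 2"
  have d: "0 < d" "d < pi" using ab by (auto simp: d_def)
  \<comment> \<open>The chord with midpoint direction \<open>m\<close> and half-angle
    \<open>d\<close> is the zero line of \<open>l\<close>; on the unit circle \<open>l\<close>
    vanishes only at \<open>cis a\<close> and \<open>cis b\<close>.\<close>
  define l where "l z = Re (z * cis (- m)) - cos d" for z
  have l: "l (cis r) = cos (r - m) - cos d" for r by (simp add: l_def cis_mult)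
  have "connected (l ` cis ` S)"
    by (rule connected_continuous_image[OF _ conn]) (auto simp: l_def intro!: continuous_intros)
  moreover have "l (cis x) > 0"
  proof -
    have "\<bar>x - m\<bar> < d" using x by (auto simp: m_def d_def abs_less_iff field_simps)
    then have "cos d < cos \<bar>x - m\<bar>" using d by (intro cos_monotone_0_pi) auto
    then show ?thesis by (simp add: l)
  qed
  moreover have "l (cis y) < 0"
  proof -
    have "d < y - m" "y - m < 2 * pi - d" using y by (auto simp: m_def d_def field_simps)
    then have "cos (y - m) < cos d"
    proof (cases "y - m \<le> pi")
      case False
      have "cos (2 * pi - (y - m)) < cos d"
        by (rule cos_monotone_0_pi) (use d False \<open>y - m < 2 * pi - d\<close> in auto)
      then show ?thesis by simp
    qed (use d in \<open>auto intro!: cos_monotone_0_pi\<close>)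
    then show ?thesis by (simp add: l)
  qed
  ultimately have "0 \<in> l ` cis ` S"
    using mem connectedD_interval[of "l ` cis ` S" "l (cis y)" "l (cis x)" 0] by auto
  then obtain r where r: "r \<in> S" "cos (r - m) = cos d" by (auto simp: l)
  then obtain k :: int where "r - m = d + 2 * k * pi \<or> r - m = - d + 2 * k * pi"
    by (auto simp: cos_eq Ints_def)
  then have "r = b + 2 * pi * of_int k \<or> r = a + 2 * pi * of_int k"
    by (auto simp: m_def d_def field_simps)
  then have "cis r = cis b \<or> cis r = cis a"
    by (auto simp: cis_multiple_2pi simp flip: cis_mult)
  then show ?thesis using r(1) by (metis imageI)
qed

lemma real_increment_bound:
  fixes h h' :: "real \<Rightarrow> real"
  assumes "\<And>r. (h has_real_derivative h' r) (at r)" "r \<le> t" "\<And>x. - L \<le> h' x"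
  shows "- (L * (t - r)) \<le> h t - h r"
proof (cases "r = t")
  case False
  with assms(2) have "r < t" by simp
  from MVT2[OF this, of h h'] obtain z where "h t - h r = (t - r) * h' z" using assms(1) by auto
  moreover have "(t - r) * (- L) \<le> (t - r) * h' z" using assms(2,3) by (intro mult_left_mono) auto
  ultimately show ?thesis by (simp add: mult.commute)
qed simp

context
  fixes c q :: "real \<Rightarrow> complex"
  assumes c: "smooth_periodic c" and q: "smooth_periodic q"
begin

lemma Re_phase_deriv:
  "((\<lambda>t. Re (phase c q i t \<xi>)) has_real_derivative (- \<xi> * Im (c t) + Re (q t))) (at t)"
  using bounded_linear.has_vector_derivative[OF bounded_linear_Re phase_deriv[OF c q]]
  by (simp add: has_real_derivative_iff_has_vector_derivative symb_def)

lemma continuous_coeff: "continuous_on A c" "continuous_on A q"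
  using smooth1_continuous smooth_periodicD(1) c q by blast+

lemma Im_mean_pos:
  assumes sg: "\<And>t. \<sigma> * Im (c t) \<ge> 0" and nz: "Im (c t0) \<noteq> 0" and s0: "\<sigma> \<noteq> 0"
  shows "\<sigma> * Im (mean c) > 0"
proof -
  have ci: "continuous_on {0..2 * pi} (\<lambda>t. \<sigma> * Im (c t))"
    by (intro continuous_intros continuous_coeff)
  have "Im (integral {0..2 * pi} c) = integral {0..2 * pi} (\<lambda>t. Im (c t))"
    using integral_linear[OF integrable_continuous_real[OF continuous_coeff(1)] bounded_linear_Im]
    by (simp add: o_def)
  then have "\<sigma> * Im (mean c) * (2 * pi) = integral {0..2 * pi} (\<lambda>t. \<sigma> * Im (c t))"
    by (simp add: mean_def)
  moreover have "integral {0..2 * pi} (\<lambda>t. \<sigma> * Im (c t)) \<ge> 0"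
    by (rule Henstock_Kurzweil_Integration.integral_nonneg[OF integrable_continuous_real[OF ci]]) (use sg in auto)
  moreover have "integral {0..2 * pi} (\<lambda>t. \<sigma> * Im (c t)) \<noteq> 0"
  proof
    assume "integral {0..2 * pi} (\<lambda>t. \<sigma> * Im (c t)) = 0"
    then have z: "\<And>t. t \<in> {0..2 * pi} \<Longrightarrow> \<sigma> * Im (c t) = 0"
      using integral_eq_0_iff[OF ci] sg by auto
    obtain k :: int where k: "t0 + 2 * pi * of_int k \<in> {0..<0 + 2 * pi}" by (rule periodic_reduce)
    then have "Im (c (t0 + 2 * pi * of_int k)) = 0" using z[of "t0 + 2 * pi * of_int k"] s0 by auto
    then show False using nz periodic_int[of c, OF smooth_periodicD(2)[OF c]] by simp
  qed
  ultimately have "\<sigma> * Im (mean c) * (2 * pi) > 0" by linarith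
  then show ?thesis by (simp add: zero_less_mult_iff)
qed

text \<open>Away from the only possibly resonant frequency \<open>\<xi>0\<close> the equation is integrated over one period, in
  the direction of \<open>t\<close> in which its solutions are damped.\<close>

lemma apriori_sign:
  fixes w g :: "unit \<Rightarrow> tfun"
  assumes sg: "\<And>t. \<sigma> * Im (c t) \<ge> 0" and s1: "\<sigma> = 1 \<or> \<sigma> = -1" and b0: "\<sigma> * Im (mean c) > 0"
    and w: "cinf unconstrained w" "periodic_fam w" and g: "rapid g"
    and ode: "\<And>t \<xi>. ((\<lambda>t. w () t \<xi>) has_vector_derivative g () t \<xi> - symb c q () t \<xi> * w () t \<xi>) (at t)"
  shows "rapid w"
proof -
  \<comment> \<open>At this frequency the real part of the phase has no net change over a
    period.\<close>
  define \<xi>0 where "\<xi>0 = Re (mean q) / Im (mean c)"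
  \<comment> \<open>The real part of the phase changes by
    \<open>- \<delta> * (\<sigma> * (\<xi> - \<xi>0))\<close> over a period, so at distance at least
    1 from \<open>\<xi>0\<close> the damping factor is at most
    \<open>exp (- \<delta>)\<close>.\<close>
  define \<delta> where "\<delta> = 2 * pi * (\<sigma> * Im (mean c))"
  have \<delta>: "\<delta> > 0" using b0 by (simp add: \<delta>_def)
  have ss: "\<sigma> * \<sigma> = 1" using s1 by auto
  obtain Kc where Kc: "\<And>t. norm (c t) \<le> Kc"
    using periodic_bounded[of c, OF smooth_periodicD(2)[OF c] continuous_coeff(1)] by blast
  obtain Kq where Kq: "\<And>t. norm (q t) \<le> Kq"
    using periodic_bounded[of q, OF smooth_periodicD(2)[OF q] continuous_coeff(2)] by blast
  \<comment> \<open>Beyond \<open>\<xi>0\<close>, on either side, \<xi> can have the unfavourable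
    sign only with modulus up to \<open>\<bar>\<xi>0\<bar>\<close>. Hence the real part of the phase
    decreases at most at rate \<open>L\<close> in the direction of integration.\<close>
  define L where "L = \<bar>\<xi>0\<bar> * Kc + Kq"
  have Imc: "0 \<le> \<sigma> * Im (c t)" "\<sigma> * Im (c t) \<le> Kc" for t
    using sg[of t] s1 abs_Im_le_cmod[of "c t"] Kc[of t] by auto
  have Req: "\<bar>Re (q t)\<bar> \<le> Kq" for t using abs_Re_le_cmod[of "q t"] Kq[of t] by linarith
  have L0: "0 \<le> L" using Kc[of 0] Kq[of 0] unfolding L_def
    by (intro add_nonneg_nonneg mult_nonneg_nonneg) (auto intro: order_trans[OF norm_ge_zero])
  have key: "\<xi> * Im (c t) = (\<sigma> * \<xi>) * (\<sigma> * Im (c t))" for \<xi> t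
    using ss by (simp add: mult_ac)
  have Zshift: "Re (phase c q () (t + 2 * pi) \<xi>) - Re (phase c q () t \<xi>) = - \<delta> * (\<sigma> * (\<xi> - \<xi>0))" for t \<xi>
  proof -
    have "Im (mean c) \<noteq> 0" using b0 by auto
    then have "Re (mean q) = \<xi>0 * Im (mean c)" by (simp add: \<xi>0_def)
    then have "Re (phase c q () (2 * pi) \<xi>) = - (2 * pi) * Im (mean c) * (\<xi> - \<xi>0)"
      unfolding phase_2pi[OF c q] by (simp add: algebra_simps)
    also have "\<dots> = - \<delta> * (\<sigma> * (\<xi> - \<xi>0))" using ss by (simp add: \<delta>_def mult_ac)
    finally show ?thesis by (simp add: phase_shift[OF c q, of "()" t])
  qed
  \<comment> \<open>Obtained by solving \<open>W \<le> exp (- \<delta>) * W + exp (2 * pi * L) * G *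
    (2 * pi)\<close> for \<open>W\<close>, the norm of the periodic solution at
    \<open>t\<close>.\<close>
  define A where "A = exp (2 * pi * L) * (2 * pi) / (1 - exp (- \<delta>))"
  have far: "norm (w () t \<xi>) \<le> A * G"
    if far: "\<bar>\<xi> - \<xi>0\<bar> \<ge> 1" and G: "\<And>t. norm (g () t \<xi>) \<le> G" for t \<xi> G
  proof -
    \<comment> \<open>The starting point is one period before or after \<open>t\<close>, whichever
      makes the homogeneous solutions decay on the way to \<open>t\<close>; periodicity gives
      \<open>w\<close> the same value at both ends.\<close>
    define s where "s = (if \<sigma> * (\<xi> - \<xi>0) \<le> -1 then t - 2 * pi else t + 2 * pi)"
    have cases: "\<sigma> * (\<xi> - \<xi>0) \<le> -1 \<or> \<sigma> * (\<xi> - \<xi>0) \<ge> 1"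
      using far s1 by (auto simp: abs_if split: if_splits)
    have M: "- (2 * pi * L) \<le> Re (phase c q () t \<xi> - phase c q () r \<xi>)" if r: "r \<in> closed_segment s t" for r
    proof (cases "\<sigma> * (\<xi> - \<xi>0) \<le> -1")
      case True
      then have r: "t - 2 * pi \<le> r" "r \<le> t" using r pi_gt_zero by (auto simp: s_def closed_segment_eq_real_ivl split: if_splits)
      have "\<sigma> * \<xi> \<le> \<bar>\<xi>0\<bar>" using True s1 by (auto simp: abs_if algebra_simps)
      then have "(\<sigma> * \<xi>) * (\<sigma> * Im (c x)) \<le> \<bar>\<xi>0\<bar> * Kc" for x
        using mult_right_mono[of "\<sigma> * \<xi>" "\<bar>\<xi>0\<bar>", OF _ Imc(1)[of x]] mult_left_mono[OF Imc(2)[of x], of "\<bar>\<xi>0\<bar>"]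
        by linarith
      then have "- L \<le> - \<xi> * Im (c x) + Re (q x)" for x
        using Req[of x] key[of \<xi> x] unfolding L_def by (smt (verit) mult_minus_left)
      from real_increment_bound[OF Re_phase_deriv r(2) this]
      have "- (L * (t - r)) \<le> Re (phase c q () t \<xi>) - Re (phase c q () r \<xi>)" .
      moreover have "L * (t - r) \<le> L * (2 * pi)" using r L0 by (intro mult_left_mono) auto
      ultimately show ?thesis by (simp add: mult.commute)
    next
      case False
      then have r: "t \<le> r" "r \<le> t + 2 * pi" using r pi_gt_zero by (auto simp: s_def closed_segment_eq_real_ivl split: if_splits)
      have "- \<bar>\<xi>0\<bar> \<le> \<sigma> * \<xi>" using False cases s1 by (auto simp: abs_if algebra_simps)
      then have "- ((\<sigma> * \<xi>) * (\<sigma> * Im (c x))) \<le> \<bar>\<xi>0\<bar> * Kc" for x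
        using mult_right_mono[of "- \<bar>\<xi>0\<bar>" "\<sigma> * \<xi>", OF _ Imc(1)[of x]] mult_left_mono[OF Imc(2)[of x], of "\<bar>\<xi>0\<bar>"]
        by linarith
      then have "- L \<le> - (- \<xi> * Im (c x) + Re (q x))" for x
        using Req[of x] key[of \<xi> x] unfolding L_def by (smt (verit) mult_minus_left)
      from real_increment_bound[OF DERIV_minus[OF Re_phase_deriv] r(1) this]
      have "- (L * (r - t)) \<le> Re (phase c q () t \<xi>) - Re (phase c q () r \<xi>)" by simp
      moreover have "L * (r - t) \<le> L * (2 * pi)" using r L0 by (intro mult_left_mono) auto
      ultimately show ?thesis by (simp add: mult.commute)
    qed
    have "norm (w () t \<xi>) \<le> exp (- Re (phase c q () t \<xi> - phase c q () s \<xi>)) * norm (w () s \<xi>)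
        + exp (2 * pi * L) * G * \<bar>t - s\<bar>"
      by (rule ode_bound[OF ode phase_deriv[OF c q] M G])
    moreover have "w () s \<xi> = w () t \<xi>"
      using w(2)[rule_format, of t \<xi>] w(2)[rule_format, of "t - 2 * pi" \<xi>] by (simp add: s_def)
    moreover have "\<bar>t - s\<bar> = 2 * pi" by (simp add: s_def)
    moreover have "exp (- Re (phase c q () t \<xi> - phase c q () s \<xi>)) \<le> exp (- \<delta>)"
    proof -
      have "\<delta> \<le> Re (phase c q () t \<xi> - phase c q () s \<xi>)"
      proof (cases "\<sigma> * (\<xi> - \<xi>0) \<le> -1")
        case True
        then have "\<delta> * 1 \<le> \<delta> * - (\<sigma> * (\<xi> - \<xi>0))" using \<delta> by (intro mult_left_mono) auto
        then show ?thesis using Zshift[of "t - 2 * pi" \<xi>] True by (simp add: s_def)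
      next
        case False
        then have "\<delta> * 1 \<le> \<delta> * (\<sigma> * (\<xi> - \<xi>0))" using \<delta> cases by (intro mult_left_mono) auto
        then show ?thesis using Zshift[of t \<xi>] False by (simp add: s_def)
      qed
      then show ?thesis by simp
    qed
    ultimately have "norm (w () t \<xi>) \<le> exp (- \<delta>) * norm (w () t \<xi>) + exp (2 * pi * L) * G * (2 * pi)"
      by (smt (verit) mult_right_mono norm_ge_zero)
    then have "norm (w () t \<xi>) * (1 - exp (- \<delta>)) \<le> exp (2 * pi * L) * (2 * pi) * G"
      by (simp add: algebra_simps)
    moreover have "0 < 1 - exp (- \<delta>)" using \<delta> by simp
    ultimately show ?thesis by (simp add: A_def pos_le_divide_eq)
  qed
  \<comment> \<open>Near the possible resonance no estimate by the data is available. Continuity on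
    a compact set suffices, since decay only concerns large frequencies.\<close>
  obtain K where K: "\<And>t \<xi>. \<bar>\<xi> - \<xi>0\<bar> \<le> 1 \<Longrightarrow> norm (w () t \<xi>) \<le> K"
  proof -
    let ?f = "\<lambda>p. w () (fst p) (snd p)"
    have "compact (?f ` ({0..2 * pi} \<times> {\<xi>0 - 1..\<xi>0 + 1}))"
      using cinf_cont2[OF w(1)] unfolding cont2_def
      by (intro compact_continuous_image compact_Times compact_Icc) (auto intro: continuous_on_subset)
    then obtain K where K: "\<And>z. z \<in> ?f ` ({0..2 * pi} \<times> {\<xi>0 - 1..\<xi>0 + 1}) \<Longrightarrow> norm z \<le> K"
      by (meson bounded_iff compact_imp_bounded)
    have "norm (w () t \<xi>) \<le> K" if "\<bar>\<xi> - \<xi>0\<bar> \<le> 1" for t \<xi>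
    proof -
      obtain k :: int where k: "t + 2 * pi * of_int k \<in> {0..<0 + 2 * pi}" by (rule periodic_reduce)
      have "w () (t + 2 * pi * of_int k) \<xi> \<in> ?f ` ({0..2 * pi} \<times> {\<xi>0 - 1..\<xi>0 + 1})"
        by (rule image_eqI[of _ _ "(t + 2 * pi * of_int k, \<xi>)"]) (use k that in \<open>auto simp: abs_le_iff\<close>)
      moreover have "w () (t + 2 * pi * of_int k) \<xi> = w () t \<xi>"
        by (rule periodic_int[of "\<lambda>t. w () t \<xi>"]) (use w(2) in auto)
      ultimately show ?thesis using K by metis
    qed
    then show thesis by (rule that)
  qed
  show ?thesis
    unfolding rapid_def
  proof
    fix N
    obtain C where C: "\<And>i t x. norm (g i t x) * (1 + \<bar>x\<bar>) ^ N \<le> C"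
      using g unfolding rapid_def by blast
    have A0: "0 \<le> A" using \<delta> by (simp add: A_def)
    have "norm (w i t \<xi>) * (1 + \<bar>\<xi>\<bar>) ^ N \<le> max (A * C) (K * (2 + \<bar>\<xi>0\<bar>) ^ N)" for i t \<xi>
    proof (cases "\<bar>\<xi> - \<xi>0\<bar> \<ge> 1")
      case True
      have "norm (w () t \<xi>) \<le> A * (C / (1 + \<bar>\<xi>\<bar>) ^ N)"
        by (rule far[OF True]) (use C in \<open>simp add: pos_le_divide_eq add_pos_nonneg\<close>)
      then have "norm (w () t \<xi>) * (1 + \<bar>\<xi>\<bar>) ^ N \<le> A * C"
        by (simp add: pos_le_divide_eq add_pos_nonneg)
      then show ?thesis by simp
    next
      case False
      have "norm (w () t \<xi>) * (1 + \<bar>\<xi>\<bar>) ^ N \<le> K * (2 + \<bar>\<xi>0\<bar>) ^ N"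
        using False K[of \<xi> t] by (intro mult_mono power_mono) (auto intro: order_trans[OF norm_ge_zero])
      then show ?thesis by simp
    qed
    then show "\<exists>C. \<forall>i t \<xi>. norm (w i t \<xi>) * (1 + \<bar>\<xi>\<bar>) ^ N \<le> C" by blast
  qed
qed

text \<open>If \<open>D\<close> has a zero, it is unique and simple and \<open>J\<close> vanishes
  there too. Splitting off the linear factor from both leaves a smooth quotient whose denominator
  has no zero.\<close>

lemma division_of_compatible:
  assumes J: "smooth1 J" and D: "smooth1 D" and zero: "\<And>\<xi>. D \<xi> = 0 \<Longrightarrow> \<xi> = \<xi>0"
    and comp: "D \<xi>0 = 0 \<Longrightarrow> J \<xi>0 = 0" and simple: "D \<xi>0 = 0 \<Longrightarrow> \<not> (D has_vector_derivative 0) (at \<xi>0)"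
  shows "\<exists>w0. smooth1 w0 \<and> (\<forall>\<xi>. w0 \<xi> * D \<xi> = J \<xi>)"
proof (cases "D \<xi>0 = 0")
  case False
  then have nz: "D \<xi> \<noteq> 0" for \<xi> using zero by blast
  then show ?thesis
    by (intro exI[of _ "\<lambda>\<xi>. J \<xi> * inverse (D \<xi>)"]) (auto intro!: smooth1_mult smooth1_inverse J D)
next
  case True
  obtain J1 where J1: "smooth1 J1" "\<And>\<xi>. J \<xi> = complex_of_real (\<xi> - \<xi>0) * J1 \<xi>"
    using hadamard_quotient[OF J comp[OF True]] by blast
  obtain D1 where D1: "smooth1 D1" "\<And>\<xi>. D \<xi> = complex_of_real (\<xi> - \<xi>0) * D1 \<xi>" "(D has_vector_derivative D1 \<xi>0) (at \<xi>0)"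
    using hadamard_quotient[OF D True] by blast
  have nz: "D1 \<xi> \<noteq> 0" for \<xi>
    using zero[of \<xi>] D1(2)[of \<xi>] D1(3) simple[OF True] by (cases "\<xi> = \<xi>0") auto
  then show ?thesis
    by (intro exI[of _ "\<lambda>\<xi>. J1 \<xi> * inverse (D1 \<xi>)"]) (auto intro!: smooth1_mult smooth1_inverse J1(1) D1(1) simp: J1(2) D1(2))
qed

text \<open>The derivative is nonzero unless \<open>mean c = 0\<close>: resonances are then simple
  zeros. Conversely, resonance on an open set of frequencies forces
  \<open>mean c = 0\<close>.\<close>

lemma exp_phase_2pi_deriv:
  "((\<lambda>\<xi>. exp (phase c q () (2 * pi) \<xi>) - 1) has_vector_derivative
    (2 * pi * \<i> * mean c) * exp (phase c q () (2 * pi) \<xi>)) (at \<xi>)"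
proof -
  have 1: "((\<lambda>\<xi>. complex_of_real \<xi> * (2 * pi * \<i> * mean c) + 2 * pi * mean q) has_vector_derivative 1 * (2 * pi * \<i> * mean c) + 0) (at \<xi>)"
    by (intro has_vector_derivative_add has_vector_derivative_const has_vector_derivative_mult_left)
      (use has_vector_derivative_of_real[of "\<lambda>x. x" 1] in auto)
  have "(\<lambda>\<xi>. complex_of_real \<xi> * (2 * pi * \<i> * mean c) + 2 * pi * mean q) = phase c q () (2 * pi)"
    by (rule ext) (simp only: phase_2pi[OF c q], simp add: algebra_simps)
  with 1 have "(phase c q () (2 * pi) has_vector_derivative (2 * pi * \<i> * mean c)) (at \<xi>)" by simp
  then have "((\<lambda>\<xi>. exp (phase c q () (2 * pi) \<xi>)) has_vector_derivative
      (2 * pi * \<i> * mean c) * exp (phase c q () (2 * pi) \<xi>)) (at \<xi>)"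
    by (rule field_vector_diff_chain_at[of _ _ _ exp, unfolded o_def]) (auto intro!: derivative_eq_intros)
  from has_vector_derivative_diff[OF this has_vector_derivative_const] show ?thesis by simp
qed

theorem solvable_constant_sign:
  assumes sg: "\<And>t. \<sigma> * Im (c t) \<ge> 0" and s1: "\<sigma> = 1 \<or> \<sigma> = -1" and nz: "Im (c t0) \<noteq> 0"
  shows "globally_solvable c q"
  unfolding globally_solvable_def
proof (intro ballI impI)
  fix f assume f: "f \<in> schwartz" and orth: "\<forall>v\<in>ker_Lt c q. v f = 0"
  have b0: "\<sigma> * Im (mean c) > 0" by (rule Im_mean_pos[OF sg nz]) (use s1 in auto)
  define g where "g = FT (\<lambda>_::unit. f)"
  have g: "cinf rapid g" unfolding g_def by (rule cinf_FT[OF schwartz_cinf[OF f]])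
  have gp: "periodic_fam g"
    using f unfolding g_def by (auto intro!: FT_periodic simp: schwartz_def periodic_t_def)
  define \<xi>0 where "\<xi>0 = Re (mean q) / Im (mean c)"
  define P where "P = prim_t (\<lambda>i t \<xi>. exp (phase c q i t \<xi>) * g i t \<xi>)"
  have P: "cinf unconstrained P" unfolding P_def by (rule cinf_prim_t[OF cinf_exp_phase_mult[OF c q g]])
  \<comment> \<open>The equation for \<open>w0\<close> says that the solution with initial value
    \<open>w0\<close> at 0 returns to this value at \<open>2 * pi\<close>.\<close>
  have "\<exists>w0. smooth1 w0 \<and> (\<forall>\<xi>. w0 \<xi> * (exp (phase c q () (2 * pi) \<xi>) - 1) = P () (2 * pi) \<xi>)"
  proof (rule division_of_compatible)
    show "smooth1 (P () (2 * pi))" using smooth1_of_cinf(2)[OF P] .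
    show "smooth1 (\<lambda>\<xi>. exp (phase c q () (2 * pi) \<xi>) - 1)"
      by (intro smooth1_diff smooth1_const smooth1_exp smooth1_of_cinf(2)[OF cinf_phase[OF c q]])
    show "P () (2 * pi) \<xi>0 = 0" if "exp (phase c q () (2 * pi) \<xi>0) - 1 = 0"
      unfolding P_def g_def using that by (intro compatibility[OF c q f orth]) simp
    show "\<xi> = \<xi>0" if "exp (phase c q () (2 * pi) \<xi>) - 1 = 0" for \<xi>
    proof -
      have "norm (exp (phase c q () (2 * pi) \<xi>)) = 1" using that by simp
      then have "Re (phase c q () (2 * pi) \<xi>) = 0" by simp
      then have "\<xi> * Im (mean c) = Re (mean q)" by (simp add: phase_2pi[OF c q])
      then show ?thesis using b0 by (cases "Im (mean c) = 0") (auto simp: \<xi>0_def eq_divide_eq)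
    qed
    show "\<not> ((\<lambda>\<xi>. exp (phase c q () (2 * pi) \<xi>) - 1) has_vector_derivative 0) (at \<xi>0)"
      using vector_derivative_unique_at[OF exp_phase_2pi_deriv[of \<xi>0], of 0] b0 by auto
  qed
  then obtain w0 where w0: "smooth1 w0" "\<And>\<xi>. w0 \<xi> * (exp (phase c q () (2 * pi) \<xi>) - 1) = P () (2 * pi) \<xi>"
    by blast
  define w where "w = voc c q w0 g"
  have w: "cinf unconstrained w" unfolding w_def by (rule cinf_voc[OF c q g w0(1)])
  have ode: "((\<lambda>t. w () t \<xi>) has_vector_derivative g () t \<xi> - symb c q () t \<xi> * w () t \<xi>) (at t)" for t \<xi>
    unfolding w_def by (rule voc_ode[OF c q g])
  have "w () (0 + 2 * pi) \<xi> = w () 0 \<xi>" for \<xi>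
  proof -
    have "w0 \<xi> + P () (2 * pi) \<xi> = exp (phase c q () (2 * pi) \<xi>) * w0 \<xi>"
      using w0(2)[of \<xi>] by (simp add: algebra_simps)
    then have "exp (- phase c q () (2 * pi) \<xi>) * (w0 \<xi> + P () (2 * pi) \<xi>)
        = exp (- phase c q () (2 * pi) \<xi> + phase c q () (2 * pi) \<xi>) * w0 \<xi>"
      by (simp only: exp_add mult.assoc)
    then show ?thesis
      unfolding w_def voc_def[OF c q] P_def[symmetric] by (simp add: prim_t_0 P_def)
  qed
  then have wp: "periodic_fam w"
    using ode_periodic[OF c q, of "\<lambda>t. w () t \<xi>" g \<xi> 0 for \<xi>] ode gp by blast
  have wr: "cinf rapid w"
    by (rule bootstrap[OF c q apriori_sign[OF sg s1 b0], where N="\<lambda>_. True"]) (use w wp g ode in auto)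
  show "\<exists>u\<in>schwartz. opL c q u = f"
    by (rule solvable_of_multiplier_solution[OF c q f wr wp]) (use ode in \<open>simp add: g_def\<close>)
qed

end

section \<open>Connected sublevel sets\<close>

lemma cis_eq_iff_periodic: "cis x = cis y \<longleftrightarrow> (\<exists>k::int. x = y + 2 * pi * of_int k)"
  using sin_cos_eq_iff[of x y] by (auto simp: complex_eq_iff)

text \<open>The base point is a maximum in the first claim and a minimum in the second. If
  \<open>B\<close> fell below \<open>B t\<close> on both arcs from the maximum to \<open>t\<close>,
  these two points would cut the sublevel set of level \<open>B t\<close>. If \<open>B\<close>
  exceeded \<open>B t\<close> on both arcs from the minimum, two such higher points would separate
  \<open>t\<close> from the minimum within a sublevel set.\<close>

lemma superlevel_arc:
  fixes B :: "real \<Rightarrow> real"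
  assumes cont: "continuous_on UNIV B" and per: "\<And>t. B (t + 2 * pi) = B t"
    and conn: "\<And>r. connected (cis ` {t \<in> {0..2 * pi}. B t < r})"
  shows "\<exists>t0. \<forall>t. \<exists>k::int. \<bar>t - (t0 + 2 * pi * of_int k)\<bar> \<le> 2 * pi \<and>
    (\<forall>r\<in>closed_segment (t0 + 2 * pi * of_int k) t. B t \<le> B r)"
    and "\<exists>t0. \<forall>t. \<exists>k::int. \<bar>t - (t0 + 2 * pi * of_int k)\<bar> \<le> 2 * pi \<and>
    (\<forall>r\<in>closed_segment (t0 + 2 * pi * of_int k) t. B r \<le> B t)"
proof -
  have shift: "B (t + 2 * pi * of_int k) = B t" for t k
    using periodic_int[of B, OF per] .
  have red: "\<exists>s\<in>{0..2 * pi}. B s = B t \<and> cis s = cis t" for t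
  proof -
    obtain k :: int where "t + 2 * pi * of_int k \<in> {0..<0 + 2 * pi}" by (rule periodic_reduce)
    then show ?thesis using shift
      by (intro bexI[of _ "t + 2 * pi * of_int k"]) (auto simp: cis_multiple_2pi simp flip: cis_mult)
  qed
  define S where "S r = {t \<in> {0..2 * pi}. B t < r}" for r
  have mem: "cis x \<in> cis ` S r \<longleftrightarrow> B x < r" for x r
  proof
    assume "cis x \<in> cis ` S r"
    then obtain s where s: "B s < r" "cis x = cis s" by (auto simp: S_def)
    then obtain k :: int where "x = s + 2 * pi * of_int k" by (auto simp: cis_eq_iff_periodic)
    then show "B x < r" using s(1) shift by simp
  next
    assume "B x < r"
    moreover obtain s where "s \<in> {0..2 * pi}" "B s = B x" "cis s = cis x" using red by blast
    ultimately have "s \<in> S r" by (simp add: S_def)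
    then show "cis x \<in> cis ` S r" using \<open>cis s = cis x\<close> by (metis imageI)
  qed
  have conn: "connected (cis ` S r)" for r unfolding S_def by (rule conn)
  have reduce: "\<exists>k::int. t0 + 2 * pi * of_int k \<le> t \<and> t < t0 + 2 * pi * of_int k + 2 * pi" for t t0
  proof -
    obtain k :: int where "t + 2 * pi * of_int k \<in> {t0..<t0 + 2 * pi}" by (rule periodic_reduce)
    then show ?thesis by (intro exI[of _ "- k"]) auto
  qed
  obtain t0 where "\<forall>y\<in>{0..2 * pi}. B y \<le> B t0"
    using continuous_attains_sup[of "{0..2 * pi}" B] continuous_on_subset[OF cont, of "{0..2 * pi}"] by auto
  then have t0: "B y \<le> B t0" for y using red by metis
  have "\<exists>k::int. \<bar>t - (t0 + 2 * pi * of_int k)\<bar> \<le> 2 * pi \<and>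
    (\<forall>r\<in>closed_segment (t0 + 2 * pi * of_int k) t. B t \<le> B r)" for t
  proof -
    obtain k :: int where k: "t0 + 2 * pi * of_int k \<le> t" "t < t0 + 2 * pi * of_int k + 2 * pi"
      using reduce by blast
    define a where "a = t0 + 2 * pi * of_int k"
    have Ba: "B a = B t0" "B (a + 2 * pi) = B t0" using shift per by (auto simp: a_def)
    have "(\<forall>r\<in>{a..t}. B t \<le> B r) \<or> (\<forall>r\<in>{t..a + 2 * pi}. B t \<le> B r)"
    proof (rule ccontr)
      assume "\<not> ?thesis"
      then obtain r1 r2 where r: "a \<le> r1" "r1 \<le> t" "B r1 < B t" "t \<le> r2" "r2 \<le> a + 2 * pi" "B r2 < B t"
        by (auto simp: not_le)
      have "r1 \<noteq> a" "r1 \<noteq> t" "r2 \<noteq> t" "r2 \<noteq> a + 2 * pi" using r t0[of t] Ba by auto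
      then have "cis a \<in> cis ` S (B t) \<or> cis t \<in> cis ` S (B t)"
        using r k by (intro connected_circle_arcs[OF conn, of a t r1 r2]) (auto simp: mem a_def)
      then show False using Ba t0[of t] by (simp add: mem)
    qed
    then show ?thesis
    proof
      assume "\<forall>r\<in>{a..t}. B t \<le> B r"
      then show ?thesis using k
        by (intro exI[of _ k]) (auto simp: closed_segment_eq_real_ivl a_def)
    next
      assume "\<forall>r\<in>{t..a + 2 * pi}. B t \<le> B r"
      \<comment> \<open>The arc now runs backwards from the next copy of the maximum, whence
        \<open>k + 1\<close>.\<close>
      then show ?thesis using k
        by (intro exI[of _ "k + 1"]) (auto simp: closed_segment_eq_real_ivl a_def algebra_simps)
    qed
  qed
  then show "\<exists>t0. \<forall>t. \<exists>k::int. \<bar>t - (t0 + 2 * pi * of_int k)\<bar> \<le> 2 * pi \<and>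
    (\<forall>r\<in>closed_segment (t0 + 2 * pi * of_int k) t. B t \<le> B r)" by blast
  obtain t1 where "\<forall>y\<in>{0..2 * pi}. B t1 \<le> B y"
    using continuous_attains_inf[of "{0..2 * pi}" B] continuous_on_subset[OF cont, of "{0..2 * pi}"] by auto
  then have t1: "B t1 \<le> B y" for y using red by metis
  have "\<exists>k::int. \<bar>t - (t1 + 2 * pi * of_int k)\<bar> \<le> 2 * pi \<and>
    (\<forall>r\<in>closed_segment (t1 + 2 * pi * of_int k) t. B r \<le> B t)" for t
  proof -
    obtain k :: int where k: "t1 + 2 * pi * of_int k \<le> t" "t < t1 + 2 * pi * of_int k + 2 * pi"
      using reduce by blast
    define a where "a = t1 + 2 * pi * of_int k"
    have Ba: "B a = B t1" "B (a + 2 * pi) = B t1" using shift per by (auto simp: a_def)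
    have "(\<forall>r\<in>{a..t}. B r \<le> B t) \<or> (\<forall>r\<in>{t..a + 2 * pi}. B r \<le> B t)"
    proof (rule ccontr)
      assume "\<not> ?thesis"
      then obtain r1 r2 where r: "a \<le> r1" "r1 \<le> t" "B t < B r1" "t \<le> r2" "r2 \<le> a + 2 * pi" "B t < B r2"
        by (auto simp: not_le)
      \<comment> \<open>The strict sublevel set of the lower of the two high values contains
        \<open>t\<close> and the minimum, but neither \<open>r1\<close> nor
        \<open>r2\<close>.\<close>
      define m where "m = min (B r1) (B r2)"
      have "r1 \<noteq> a" "r1 \<noteq> t" "r2 \<noteq> t" "r2 \<noteq> a + 2 * pi" using r t1[of t] Ba by auto
      then have "cis r1 \<in> cis ` S m \<or> cis r2 \<in> cis ` S m"
        using r k t1[of t] Ba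
        by (intro connected_circle_arcs[OF conn, of r1 r2 t "a + 2 * pi"]) (auto simp: mem a_def m_def)
      then show False by (simp add: mem m_def)
    qed
    then show ?thesis
    proof
      assume "\<forall>r\<in>{a..t}. B r \<le> B t"
      then show ?thesis using k
        by (intro exI[of _ k]) (auto simp: closed_segment_eq_real_ivl a_def)
    next
      assume "\<forall>r\<in>{t..a + 2 * pi}. B r \<le> B t"
      then show ?thesis using k
        by (intro exI[of _ "k + 1"]) (auto simp: closed_segment_eq_real_ivl a_def algebra_simps)
    qed
  qed
  then show "\<exists>t0. \<forall>t. \<exists>k::int. \<bar>t - (t0 + 2 * pi * of_int k)\<bar> \<le> 2 * pi \<and>
    (\<forall>r\<in>closed_segment (t0 + 2 * pi * of_int k) t. B r \<le> B t)" by blast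
qed

context
  fixes c q :: "real \<Rightarrow> complex"
  assumes c: "smooth_periodic c" and q: "smooth_periodic q"
begin

text \<open>Since \<open>w\<close> vanishes at \<open>t0\<close>, it can be computed along an arc from \<open>t0\<close> to \<open>t\<close> on which the kernel stays
  bounded for the relevant sign of \<open>\<xi>\<close>.\<close>

lemma apriori_arc:
  fixes w g :: "unit \<Rightarrow> tfun" and B :: "real \<Rightarrow> real"
  assumes ReZ: "\<And>t \<xi>. Re (phase c q () t \<xi>) = - \<xi> * B t" and BK: "\<And>t. \<bar>B t\<bar> \<le> K"
    and arc: "\<And>t. \<exists>k::int. \<bar>t - (t0 + 2 * pi * of_int k)\<bar> \<le> 2 * pi \<and>
      (\<forall>r\<in>closed_segment (t0 + 2 * pi * of_int k) t. \<tau> * (B r - B t) \<ge> 0)"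
    and t1: "\<tau> = 1 \<or> \<tau> = -1"
    and w: "periodic_fam w" "\<And>\<xi>. w () t0 \<xi> = 0" "\<And>t \<xi>. \<tau> * \<xi> < -1 \<Longrightarrow> w () t \<xi> = 0" and g: "rapid g"
    and ode: "\<And>t \<xi>. ((\<lambda>t. w () t \<xi>) has_vector_derivative g () t \<xi> - symb c q () t \<xi> * w () t \<xi>) (at t)"
  shows "rapid w"
proof -
  have tt: "\<tau> * \<tau> = 1" using t1 by auto
  have K0: "0 \<le> K" using BK[of 0] by linarith
  have bound: "norm (w () t \<xi>) \<le> exp (2 * K) * G * (2 * pi)" if G: "\<And>t. norm (g () t \<xi>) \<le> G" for t \<xi> G
  proof (cases "\<tau> * \<xi> < -1")
    case True
    have "0 \<le> G" using order_trans[OF norm_ge_zero G] .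
    then show ?thesis using w(3)[OF True] by simp
  next
    case False
    obtain k :: int where k: "\<bar>t - (t0 + 2 * pi * of_int k)\<bar> \<le> 2 * pi"
      "\<And>r. r \<in> closed_segment (t0 + 2 * pi * of_int k) t \<Longrightarrow> \<tau> * (B r - B t) \<ge> 0"
      using arc[of t] by blast
    define s where "s = t0 + 2 * pi * of_int k"
    have ws: "w () s \<xi> = 0"
      using periodic_int[of "\<lambda>t. w () t \<xi>" t0 k] w(1,2) by (simp add: s_def)
    have M: "- (2 * K) \<le> Re (phase c q () t \<xi> - phase c q () r \<xi>)" if r: "r \<in> closed_segment s t" for r
    proof -
      have nn: "\<tau> * (B r - B t) \<ge> 0" using k(2) r by (simp add: s_def)
      have "\<tau> * (B r - B t) \<le> 2 * K" using BK[of r] BK[of t] t1 by (auto simp: abs_le_iff)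
      \<comment> \<open>For frequencies with \<open>-1 \<le> \<tau> * \<xi> < 0\<close>, left over
        by the cutoff, the sign is unfavourable, but the loss is at most
        \<open>2 * K\<close>.\<close>
      moreover have "(- 1) * (\<tau> * (B r - B t)) \<le> (\<tau> * \<xi>) * (\<tau> * (B r - B t))"
        using False nn by (intro mult_right_mono) auto
      moreover have "(\<tau> * \<xi>) * (\<tau> * (B r - B t)) = (\<tau> * \<tau>) * (\<xi> * (B r - B t))" by (simp only: mult_ac)
      ultimately have "- (2 * K) \<le> \<xi> * (B r - B t)" using tt by simp
      then show ?thesis by (simp add: ReZ algebra_simps)
    qed
    have "norm (w () t \<xi>) \<le> exp (- Re (phase c q () t \<xi> - phase c q () s \<xi>)) * norm (w () s \<xi>)
        + exp (2 * K) * G * \<bar>t - s\<bar>"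
      by (rule ode_bound[OF ode phase_deriv[OF c q] M G])
    also have "\<dots> = exp (2 * K) * G * \<bar>t - s\<bar>" using ws by simp
    also have "\<dots> \<le> exp (2 * K) * G * (2 * pi)"
      using k(1) order_trans[OF norm_ge_zero G] by (intro mult_left_mono) (auto simp: s_def)
    finally show ?thesis .
  qed
  show ?thesis
    unfolding rapid_def
  proof
    fix N
    obtain C where C: "\<And>i t x. norm (g i t x) * (1 + \<bar>x\<bar>) ^ N \<le> C"
      using g unfolding rapid_def by blast
    have "norm (w () t \<xi>) * (1 + \<bar>\<xi>\<bar>) ^ N \<le> exp (2 * K) * C * (2 * pi)" for t \<xi>
    proof -
      have "norm (w () t \<xi>) \<le> exp (2 * K) * (C / (1 + \<bar>\<xi>\<bar>) ^ N) * (2 * pi)"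
        by (rule bound) (use C in \<open>simp add: pos_le_divide_eq add_pos_nonneg\<close>)
      then show ?thesis by (simp add: pos_le_divide_eq add_pos_nonneg)
    qed
    then show "\<exists>C. \<forall>i t \<xi>. norm (w i t \<xi>) * (1 + \<bar>\<xi>\<bar>) ^ N \<le> C" by auto
  qed
qed

text \<open>As every frequency is resonant and the data are compatible, each initial value yields a
  periodic solution. The choice \<open>w0 = - P () t0\<close> makes it vanish at the base point
  \<open>t0\<close> of the arcs.\<close>

lemma half_line_solution:
  fixes g :: "unit \<Rightarrow> tfun" and B :: "real \<Rightarrow> real"
  assumes ReZ: "\<And>t \<xi>. Re (phase c q () t \<xi>) = - \<xi> * B t" and BK: "\<And>t. \<bar>B t\<bar> \<le> K"
    and arc: "\<And>t. \<exists>k::int. \<bar>t - (t0 + 2 * pi * of_int k)\<bar> \<le> 2 * pi \<and>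
      (\<forall>r\<in>closed_segment (t0 + 2 * pi * of_int k) t. \<tau> * (B r - B t) \<ge> 0)"
    and t1: "\<tau> = 1 \<or> \<tau> = -1"
    and res: "\<And>\<xi>. exp (phase c q () (2 * pi) \<xi>) = 1"
    and g: "cinf rapid g" "periodic_fam g" "\<And>t \<xi>. \<tau> * \<xi> < -1 \<Longrightarrow> g () t \<xi> = 0"
    and comp: "\<And>\<xi>. prim_t (\<lambda>i t \<xi>. exp (phase c q i t \<xi>) * g i t \<xi>) () (2 * pi) \<xi> = 0"
  shows "\<exists>w. cinf rapid w \<and> periodic_fam w \<and>
    (\<forall>t \<xi>. ((\<lambda>t. w () t \<xi>) has_vector_derivative g () t \<xi> - symb c q () t \<xi> * w () t \<xi>) (at t))"
proof -
  define P where "P = prim_t (\<lambda>i t \<xi>. exp (phase c q i t \<xi>) * g i t \<xi>)"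
  have P: "cinf unconstrained P" unfolding P_def by (rule cinf_prim_t[OF cinf_exp_phase_mult[OF c q g(1)]])
  define w0 where "w0 \<xi> = - 1 * P () t0 \<xi>" for \<xi>
  have w0: "smooth1 w0" unfolding w0_def by (intro smooth1_mult smooth1_const smooth1_of_cinf(2)[OF P])
  define w where "w = voc c q w0 g"
  have w: "cinf unconstrained w" unfolding w_def by (rule cinf_voc[OF c q g(1) w0])
  have ode: "((\<lambda>t. w () t \<xi>) has_vector_derivative g () t \<xi> - symb c q () t \<xi> * w () t \<xi>) (at t)" for t \<xi>
    unfolding w_def by (rule voc_ode[OF c q g(1)])
  have w_eq: "w () t \<xi> = exp (- phase c q () t \<xi>) * (w0 \<xi> + P () t \<xi>)" for t \<xi>
    unfolding w_def voc_def[OF c q] P_def ..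
  have "w () (0 + 2 * pi) \<xi> = w () 0 \<xi>" for \<xi>
    using comp[of \<xi>] res[of \<xi>] unfolding w_eq by (simp add: P_def prim_t_0 exp_minus)
  then have wp: "periodic_fam w"
    using ode_periodic[OF c q, of "\<lambda>t. w () t \<xi>" g \<xi> 0 for \<xi>] ode g(2) by blast
  \<comment> \<open>Both conditions pass to the \<xi>-derivative: the first holds for all \<xi>, the
    second on an open half-line of frequencies.\<close>
  define N where "N v \<longleftrightarrow> (\<forall>\<xi>. v () t0 \<xi> = 0) \<and> (\<forall>t \<xi>. \<tau> * \<xi> < -1 \<longrightarrow> v () t \<xi> = 0)" for v :: "unit \<Rightarrow> tfun"
  have "cinf rapid w"
  proof (rule bootstrap[OF c q, where N=N])
    show "rapid w" if "periodic_fam w" "N w" "rapid g"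
      "\<And>t \<xi>. ((\<lambda>t. w () t \<xi>) has_vector_derivative g () t \<xi> - symb c q () t \<xi> * w () t \<xi>) (at t)" for w g
      by (rule apriori_arc[OF ReZ BK arc t1]) (use that in \<open>auto simp: N_def\<close>)
    show "N (\<lambda>i. pdx (w i))" if "N w" "cinf unconstrained w" for w
    proof -
      have "pdx (w ()) t0 \<xi> = 0" for \<xi>
      proof -
        have "w () t0 = (\<lambda>_. 0)" using that(1) by (auto simp: N_def)
        then show ?thesis by (simp add: pdx_def vector_derivative_at)
      qed
      moreover have "pdx (w ()) t \<xi> = 0" if "\<tau> * \<xi> < -1" for t \<xi>
      proof -
        have "open {\<xi>. \<tau> * \<xi> < -1}" by (intro open_Collect_less continuous_intros)
        then have "(w () t has_vector_derivative 0) (at \<xi>)"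
          by (rule has_vector_derivative_transform_within_open[OF has_vector_derivative_const[of 0]])
            (use \<open>N w\<close> that in \<open>auto simp: N_def\<close>)
        then show ?thesis by (simp add: pdx_def vector_derivative_at)
      qed
      ultimately show ?thesis by (simp add: N_def)
    qed
    have "P () t \<xi> = 0" if "\<tau> * \<xi> < -1" for t \<xi> using g(3) that by (simp add: P_def prim_t_def)
    then show "N w" by (simp add: N_def w_eq w0_def)
  qed (use w wp g ode in auto)
  then show ?thesis using wp ode by blast
qed

theorem solvable_connected_sublevels:
  assumes c0: "mean c = 0" and qk: "\<And>t. q t = \<i> * of_int k"
    and conn: "\<And>r. connected (cis ` {t \<in> {0..2 * pi}. integral {0..t} (\<lambda>s. Im (c s)) < r})"
  shows "globally_solvable c q"
  unfolding globally_solvable_def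
proof (intro ballI impI)
  fix f assume f: "f \<in> schwartz" and orth: "\<forall>v\<in>ker_Lt c q. v f = 0"
  \<comment> \<open>As \<open>q\<close> is purely imaginary, the real part of the phase at frequency
    1 is minus the primitive of \<open>Im c\<close>; unlike an integral over \<open>{0..t}\<close>,
    it is also meaningful for negative \<open>t\<close>.\<close>
  define B where "B t = - Re (phase c q () t 1)" for t
  have Re_q: "Re (q t) = 0" for t by (simp add: qk)
  have B': "(B has_real_derivative Im (c t)) (at t)" for t
    using DERIV_minus[OF Re_phase_deriv[OF c q, of "()" 1 t]] unfolding B_def Re_q by simp
  have B0: "B 0 = 0" by (simp add: B_def prim_t_0)
  have ReZ: "Re (phase c q () t \<xi>) = - \<xi> * B t" for t \<xi>
  proof -
    have "((\<lambda>t. Re (phase c q () t \<xi>) + \<xi> * B t) has_real_derivative 0) (at t)" for t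
      using DERIV_add[OF Re_phase_deriv[OF c q, of "()" \<xi> t] DERIV_cmult[OF B', of \<xi> t]] by (simp add: Re_q)
    then have "Re (phase c q () t \<xi>) + \<xi> * B t = Re (phase c q () 0 \<xi>) + \<xi> * B 0"
      using DERIV_isconst_all by blast
    then show ?thesis by (simp add: B0 prim_t_0)
  qed
  have "integral {0..2 * pi} q = 2 * pi * (\<i> * of_int k)"
    using qk by (simp add: fun_eq_iff[of q] cong: integral_cong) (simp add: scaleR_conv_of_real)
  then have "mean q = \<i> * of_int k" by (simp add: mean_def)
  then have p2: "phase c q () (2 * pi) \<xi> = 2 * pi * of_int k * \<i>" for \<xi>
    by (simp add: phase_2pi[OF c q] c0)
  have res: "exp (phase c q () (2 * pi) \<xi>) = 1" for \<xi>
    unfolding p2 by (simp add: exp_eq_1)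
  have Bc: "continuous_on UNIV B" using B' by (meson DERIV_isCont continuous_at_imp_continuous_on)
  have Bp: "B (t + 2 * pi) = B t" for t unfolding B_def by (subst phase_shift[OF c q]) (simp add: p2)
  obtain K where K: "\<And>t. \<bar>B t\<bar> \<le> K"
    using periodic_bounded[of "\<lambda>t. complex_of_real (B t)"] Bp Bc by (auto intro: continuous_intros)
  have BI: "B t = integral {0..t} (\<lambda>s. Im (c s))" if "0 \<le> t" for t
  proof -
    have "((\<lambda>s. Im (c s)) has_integral (B t - B 0)) {0..t}"
      by (rule fundamental_theorem_of_calculus[OF that has_vector_derivative_at_within])
        (use B' in \<open>simp add: has_real_derivative_iff_has_vector_derivative\<close>)
    then show ?thesis by (simp add: B0 integral_unique)
  qed
  have "{t \<in> {0..2 * pi}. B t < r} = {t \<in> {0..2 * pi}. integral {0..t} (\<lambda>s. Im (c s)) < r}" for r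
    using BI by auto
  then have "connected (cis ` {t \<in> {0..2 * pi}. B t < r})" for r using conn by simp
  note arcs = superlevel_arc[OF Bc Bp this]
  define g where "g = FT (\<lambda>_::unit. f)"
  have g: "cinf rapid g" unfolding g_def by (rule cinf_FT[OF schwartz_cinf[OF f]])
  have gp: "periodic_fam g"
    using f unfolding g_def by (auto intro!: FT_periodic simp: schwartz_def periodic_t_def)
  obtain \<eta> where \<eta>: "cinf moderate (\<lambda>i::unit. \<lambda>t x. \<eta> x)" "\<And>x. x < -1 \<Longrightarrow> \<eta> x = 0" "\<And>x. x > 1 \<Longrightarrow> \<eta> x = (1::complex)"
    using smooth_cutoff_exists by blast
  define g1 where "g1 = (\<lambda>i t \<xi>. \<eta> \<xi> * g i t \<xi>)"
  define g2 where "g2 = (\<lambda>i t \<xi>. (1 + - 1 * \<eta> \<xi>) * g i t \<xi>)"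
  have g1: "cinf rapid g1" unfolding g1_def by (intro cinf_rapid_mult \<eta>(1) g)
  have g2: "cinf rapid g2" unfolding g2_def
    by (intro cinf_rapid_mult cinf_add[OF growth_module_moderate] cinf_mult[OF growth_module_moderate]
        cinf_moderate_const \<eta>(1) g)
  \<comment> \<open>Compatibility holds at each frequency separately, so it survives multiplication
    by any function of \<xi> alone, in particular by the two cutoffs.\<close>
  have comp: "prim_t (\<lambda>i t \<xi>. exp (phase c q i t \<xi>) * (h \<xi> * g i t \<xi>)) () (2 * pi) \<xi> = 0" for h \<xi>
  proof -
    have "prim_t (\<lambda>i t \<xi>. exp (phase c q i t \<xi>) * (h \<xi> * g i t \<xi>)) () (2 * pi) \<xi>
       = h \<xi> * prim_t (\<lambda>i t \<xi>. exp (phase c q i t \<xi>) * g i t \<xi>) () (2 * pi) \<xi>"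
      by (simp add: prim_t_def mult.left_commute[of _ "h \<xi>"])
    then show ?thesis using compatibility[OF c q f orth res[of \<xi>]] by (simp add: g_def)
  qed
  \<comment> \<open>The kernel along an arc behaves like \<open>exp (\<xi> * (B t - B r))\<close>:
    arcs from the maximum serve the part supported in \<open>\<xi> \<ge> -1\<close>, those from the
    minimum the part supported in \<open>\<xi> \<le> 1\<close>.\<close>
  obtain t0 where t0: "\<And>t. \<exists>k::int. \<bar>t - (t0 + 2 * pi * of_int k)\<bar> \<le> 2 * pi \<and>
    (\<forall>r\<in>closed_segment (t0 + 2 * pi * of_int k) t. 1 * (B r - B t) \<ge> 0)"
    using arcs(1) by auto
  obtain t1 where t1: "\<And>t. \<exists>k::int. \<bar>t - (t1 + 2 * pi * of_int k)\<bar> \<le> 2 * pi \<and>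
    (\<forall>r\<in>closed_segment (t1 + 2 * pi * of_int k) t. - 1 * (B r - B t) \<ge> 0)"
    using arcs(2) by auto
  obtain w1 where w1: "cinf rapid w1" "periodic_fam w1"
    "\<And>t \<xi>. ((\<lambda>t. w1 () t \<xi>) has_vector_derivative g1 () t \<xi> - symb c q () t \<xi> * w1 () t \<xi>) (at t)"
    using half_line_solution[OF ReZ K t0 _ res g1] gp \<eta>(2) comp unfolding g1_def by auto
  obtain w2 where w2: "cinf rapid w2" "periodic_fam w2"
    "\<And>t \<xi>. ((\<lambda>t. w2 () t \<xi>) has_vector_derivative g2 () t \<xi> - symb c q () t \<xi> * w2 () t \<xi>) (at t)"
    using half_line_solution[OF ReZ K t1 _ res g2] gp \<eta>(3) comp[of "\<lambda>\<xi>. 1 + - 1 * \<eta> \<xi>"] unfolding g2_def by auto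
  define w where "w = (\<lambda>i t \<xi>. w1 i t \<xi> + w2 i t \<xi>)"
  show "\<exists>u\<in>schwartz. opL c q u = f"
  proof (rule solvable_of_multiplier_solution[OF c q f])
    show "cinf rapid w" unfolding w_def by (rule cinf_add[OF growth_module_rapid w1(1) w2(1)])
    show "periodic_fam w" using w1(2) w2(2) by (simp add: w_def)
    show "((\<lambda>t. w () t \<xi>) has_vector_derivative FT (\<lambda>_. f) () t \<xi> - symb c q () t \<xi> * w () t \<xi>) (at t)" for t \<xi>
      using has_vector_derivative_add[OF w1(3)[of \<xi> t] w2(3)[of \<xi> t]]
      by (simp add: w_def g1_def g2_def g_def[symmetric] algebra_simps)
  qed
qed

end

section \<open>Quasimodes\<close>

text \<open>The factor \<open>exp (- exp (- \<xi>))\<close> tends to \<open>1\<close> as \<open>\<xi>\<close> tends to infinity and beats every exponential as \<open>\<xi>\<close>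
  tends to minus infinity; it serves as an analytic cutoff to positive frequencies. Its derivatives produce
  the powers \<open>exp (- k * \<xi>)\<close>.\<close>

definition wkb :: "(real \<Rightarrow> complex) \<Rightarrow> (real \<Rightarrow> complex) \<Rightarrow> real \<Rightarrow> nat \<Rightarrow> (real \<Rightarrow> complex) \<Rightarrow> 'i \<Rightarrow> tfun" where
  "wkb A Q l k \<theta> i t \<xi> =
    exp (complex_of_real (- (real k * \<xi>) - exp (- \<xi>) - l * \<xi>) - \<i> * complex_of_real \<xi> * A t - Q t) * \<theta> t"

lemma norm_wkb:
  "norm (wkb A Q l k \<theta> i t \<xi>) = exp (- (real k * \<xi>) - exp (- \<xi>) + \<xi> * (Im (A t) - l)) * exp (- Re (Q t)) * norm (\<theta> t)"
  by (simp add: wkb_def norm_mult algebra_simps flip: exp_add)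

text \<open>With \<open>r = s / (N + 1)\<close> one has
  \<open>1 + x \<le> (1 + 1 / r) * exp (r * x)\<close>; the \<open>N\<close>-th power still grows no
  faster than \<open>exp (s * x)\<close>.\<close>

lemma polynomial_exp_bound:
  fixes s :: real
  assumes "s > 0" "x \<ge> 0"
  shows "(1 + x) ^ N * exp (- (s * x)) \<le> (1 + real (Suc N) / s) ^ N"
proof -
  define r where "r = s / real (Suc N)"
  have r: "r > 0" using assms by (simp add: r_def)
  have "1 + x \<le> (1 + 1 / r) * (1 + r * x)"
    using r assms by (simp add: field_simps)
  also have "\<dots> \<le> (1 + 1 / r) * exp (r * x)"
    using r by (intro mult_left_mono exp_ge_add_one_self) auto
  finally have "(1 + x) ^ N \<le> ((1 + 1 / r) * exp (r * x)) ^ N"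
    using assms by (intro power_mono) auto
  also have "\<dots> = (1 + 1 / r) ^ N * exp (real N * (r * x))"
    by (simp add: power_mult_distrib exp_of_nat_mult)
  also have "\<dots> \<le> (1 + 1 / r) ^ N * exp (s * x)"
  proof -
    have "real N * (r * x) \<le> real (Suc N) * (r * x)" using r assms by (intro mult_right_mono) auto
    also have "\<dots> = s * x" by (simp add: r_def)
    finally show ?thesis using r by (intro mult_left_mono) auto
  qed
  finally have "(1 + x) ^ N * exp (- (s * x)) \<le> (1 + 1 / r) ^ N * exp (s * x) * exp (- (s * x))"
    by (intro mult_right_mono) auto
  also have "\<dots> = (1 + 1 / r) ^ N" by (simp add: mult.assoc flip: exp_add)
  finally show ?thesis by (simp add: r_def)
qed

text \<open>The double exponential is beaten down to a Gaussian by
  \<open>exp y \<ge> y^2 / 2\<close>; completing the square yields the constant.\<close>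

lemma double_exp_bound:
  fixes y a :: real
  assumes "y \<ge> 0"
  shows "(1 + y) ^ N * exp (a * y - exp y) \<le> exp ((real N + a)\<^sup>2 / 2)"
proof -
  have "(1 + y) ^ N \<le> exp y ^ N" using assms by (intro power_mono exp_ge_add_one_self) auto
  then have "(1 + y) ^ N \<le> exp (real N * y)" by (simp add: exp_of_nat_mult)
  then have "(1 + y) ^ N * exp (a * y - exp y) \<le> exp (real N * y) * exp (a * y - exp y)"
    by (intro mult_right_mono) auto
  also have "\<dots> = exp ((real N + a) * y - exp y)" by (simp add: algebra_simps flip: exp_add)
  also have "\<dots> \<le> exp ((real N + a)\<^sup>2 / 2)"
  proof -
    have "b * y - y\<^sup>2 / 2 \<le> b\<^sup>2 / 2" for b
      using zero_le_power2[of "b - y"] by (simp add: power2_diff)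
    from this[of "real N + a"] have "(real N + a) * y - y\<^sup>2 / 2 \<le> (real N + a)\<^sup>2 / 2" .
    then show ?thesis using exp_lower_Taylor_quadratic[OF assms] assms by simp
  qed
  finally show ?thesis .
qed

text \<open>For positive \<xi> the decay comes from the gap \<delta> between \<open>Im A\<close> and
  \<open>l\<close> on the support of \<theta>; without a gap only boundedness remains. For negative
  \<xi> the double exponential absorbs every growth.\<close>

lemma wkb_growth:
  fixes A Q \<theta> :: "real \<Rightarrow> complex"
  assumes K: "\<And>t. norm (A t) \<le> K" "\<And>t. norm (Q t) \<le> K" "\<And>t. norm (\<theta> t) \<le> M"
    and van: "\<And>t. Im (A t) > l - \<delta> \<Longrightarrow> \<theta> t = 0" and d: "\<delta> \<ge> 0"
  shows "moderate (wkb A Q l k \<theta>)" and "\<delta> > 0 \<Longrightarrow> rapid (wkb A Q l k \<theta>)"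
proof -
  define D where "D = exp K * M"
  have M0: "0 \<le> M" using order_trans[OF norm_ge_zero K(3)] .
  have right: "norm (wkb A Q l k \<theta> i t \<xi>) \<le> exp (- (\<delta> * \<xi>)) * D" if "\<xi> \<ge> 0" for i t \<xi>
  proof (cases "Im (A t) > l - \<delta>")
    case True
    then show ?thesis using van M0 by (simp add: wkb_def D_def)
  next
    case False
    have "\<xi> * (Im (A t) - l) \<le> \<xi> * (- \<delta>)" using False that by (intro mult_left_mono) auto
    then have "\<xi> * (Im (A t) - l) \<le> - (\<delta> * \<xi>)" by (simp add: mult.commute)
    moreover have "0 \<le> real k * \<xi>" using that by simp
    moreover have "0 < exp (- \<xi>)" by simp
    ultimately have "- (real k * \<xi>) - exp (- \<xi>) + \<xi> * (Im (A t) - l) \<le> - (\<delta> * \<xi>)"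
      by linarith
    moreover have "- Re (Q t) \<le> K" using abs_Re_le_cmod[of "Q t"] K(2)[of t] by linarith
    ultimately show ?thesis unfolding norm_wkb D_def mult.assoc
      using K(3)[of t] by (intro mult_mono) auto
  qed
  define a where "a = real k + K + \<bar>l\<bar>"
  have left: "norm (wkb A Q l k \<theta> i t \<xi>) \<le> exp (a * (- \<xi>) - exp (- \<xi>)) * D" if "\<xi> \<le> 0" for i t \<xi>
  proof -
    have "- (K + \<bar>l\<bar>) \<le> Im (A t) - l" using abs_Im_le_cmod[of "A t"] K(1)[of t] by linarith
    then have "(- \<xi>) * (- (K + \<bar>l\<bar>)) \<le> (- \<xi>) * (Im (A t) - l)" using that by (intro mult_left_mono) auto
    then have "- (real k * \<xi>) - exp (- \<xi>) + \<xi> * (Im (A t) - l) \<le> a * (- \<xi>) - exp (- \<xi>)"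
      by (simp add: a_def algebra_simps)
    moreover have "- Re (Q t) \<le> K" using abs_Re_le_cmod[of "Q t"] K(2)[of t] by linarith
    ultimately show ?thesis unfolding norm_wkb D_def mult.assoc
      using K(3)[of t] by (intro mult_mono) auto
  qed
  have D0: "0 \<le> D" using M0 by (simp add: D_def)
  have left': "norm (wkb A Q l k \<theta> i t \<xi>) * (1 + \<bar>\<xi>\<bar>) ^ N \<le> exp ((real N + a)\<^sup>2 / 2) * D" if "\<xi> \<le> 0" for i t \<xi> N
  proof -
    have "norm (wkb A Q l k \<theta> i t \<xi>) * (1 + \<bar>\<xi>\<bar>) ^ N \<le> exp (a * (- \<xi>) - exp (- \<xi>)) * D * (1 + (- \<xi>)) ^ N"
      using left[OF that] that D0 by (intro mult_mono) auto
    also have "\<dots> = (1 + (- \<xi>)) ^ N * exp (a * (- \<xi>) - exp (- \<xi>)) * D" by (simp only: mult_ac)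
    also have "\<dots> \<le> exp ((real N + a)\<^sup>2 / 2) * D"
      using that D0 by (intro mult_right_mono double_exp_bound) auto
    finally show ?thesis .
  qed
  have "norm (wkb A Q l k \<theta> i t \<xi>) \<le> max D (exp (a\<^sup>2 / 2) * D)" for i t \<xi>
  proof (cases "\<xi> \<ge> 0")
    case True
    have "exp (- (\<delta> * \<xi>)) * D \<le> 1 * D" using True d D0 by (intro mult_right_mono) auto
    then show ?thesis using right[OF True, of i t] by simp
  next
    case False
    then show ?thesis using left'[of \<xi> i t 0] by simp
  qed
  then show "moderate (wkb A Q l k \<theta>)" by (rule moderate_bounded)
  show "rapid (wkb A Q l k \<theta>)" if "\<delta> > 0"
    unfolding rapid_def
  proof
    fix N
    let ?X = "(1 + real (Suc N) / \<delta>) ^ N * D" and ?Y = "exp ((real N + a)\<^sup>2 / 2) * D"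
    have "norm (wkb A Q l k \<theta> i t \<xi>) * (1 + \<bar>\<xi>\<bar>) ^ N \<le> max ?X ?Y" for i t \<xi>
    proof (cases "\<xi> \<ge> 0")
      case True
      have "norm (wkb A Q l k \<theta> i t \<xi>) * (1 + \<bar>\<xi>\<bar>) ^ N \<le> exp (- (\<delta> * \<xi>)) * D * (1 + \<xi>) ^ N"
        using right[OF True, of i t] True D0 by (intro mult_mono) auto
      also have "\<dots> = (1 + \<xi>) ^ N * exp (- (\<delta> * \<xi>)) * D" by (simp only: mult_ac)
      also have "\<dots> \<le> ?X" using True D0 that by (intro mult_right_mono polynomial_exp_bound) auto
      finally show ?thesis by simp
    next
      case False
      then show ?thesis using left'[of \<xi> i t N] by simp
    qed
    then show "\<exists>C. \<forall>i t \<xi>. norm (wkb A Q l k \<theta> i t \<xi>) * (1 + \<bar>\<xi>\<bar>) ^ N \<le> C" by blast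
  qed
qed

text \<open>Up to a factor \<xi>, all terms have the same shape again, with \<open>k\<close> raised
  or a new amplitude built from \<theta> and its derivative. This closure drives the induction in
  \<open>cinf_wkb\<close>.\<close>

lemma wkb_partials:
  assumes A: "\<And>t. (A has_vector_derivative a t) (at t)" and Q: "\<And>t. (Q has_vector_derivative b t) (at t)"
    and th: "\<And>t. (\<theta> has_vector_derivative \<theta>' t) (at t)"
  shows "partials (wkb A Q l k \<theta>)
    (\<lambda>i t \<xi>. wkb A Q l k (\<lambda>t. \<theta>' t - b t * \<theta> t) i t \<xi> + (- \<i> * complex_of_real \<xi>) * wkb A Q l k (\<lambda>t. a t * \<theta> t) i t \<xi>)
    (\<lambda>i t \<xi>. wkb A Q l (Suc k) \<theta> i t \<xi> + wkb A Q l k (\<lambda>t. (complex_of_real (- real k - l) - \<i> * A t) * \<theta> t) i t \<xi>)"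
proof -
  define E where "E t \<xi> = complex_of_real (- (real k * \<xi>) - exp (- \<xi>) - l * \<xi>) - \<i> * complex_of_real \<xi> * A t - Q t" for t \<xi>
  have t: "((\<lambda>t. wkb A Q l k \<theta> i t \<xi>) has_vector_derivative
      (wkb A Q l k (\<lambda>t. \<theta>' t - b t * \<theta> t) i t \<xi> + (- \<i> * complex_of_real \<xi>) * wkb A Q l k (\<lambda>t. a t * \<theta> t) i t \<xi>)) (at t)" for i :: 'a and t \<xi>
  proof -
    have "((\<lambda>t. E t \<xi>) has_vector_derivative (0 - \<i> * complex_of_real \<xi> * a t - b t)) (at t)"
      unfolding E_def by (intro has_vector_derivative_diff has_vector_derivative_const has_vector_derivative_mult_right A Q)
    then have "((\<lambda>t. exp (E t \<xi>)) has_vector_derivative ((0 - \<i> * complex_of_real \<xi> * a t - b t) * exp (E t \<xi>))) (at t)"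
      by (rule field_vector_diff_chain_at[of _ _ _ exp, unfolded o_def]) (auto intro!: derivative_eq_intros)
    from has_vector_derivative_mult[OF this th[of t]] show ?thesis
      unfolding wkb_def E_def[symmetric] by (simp add: algebra_simps)
  qed
  have x: "((\<lambda>\<xi>. wkb A Q l k \<theta> i t \<xi>) has_vector_derivative
      (wkb A Q l (Suc k) \<theta> i t \<xi> + wkb A Q l k (\<lambda>t. (complex_of_real (- real k - l) - \<i> * A t) * \<theta> t) i t \<xi>)) (at \<xi>)" for i :: 'a and t \<xi>
  proof -
    have r: "((\<lambda>\<xi>. - (real k * \<xi>) - exp (- \<xi>) - l * \<xi>) has_real_derivative (- real k + exp (- \<xi>) - l)) (at \<xi>)"
      by (auto intro!: derivative_eq_intros)
    have "((\<lambda>\<xi>. complex_of_real \<xi> * (\<i> * A t)) has_vector_derivative 1 * (\<i> * A t)) (at \<xi>)"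
      by (intro has_vector_derivative_mult_left) (use has_vector_derivative_of_real[of "\<lambda>x. x" 1] in auto)
    then have l: "((\<lambda>\<xi>. \<i> * complex_of_real \<xi> * A t) has_vector_derivative \<i> * A t) (at \<xi>)"
      by (simp add: mult_ac)
    have "((\<lambda>\<xi>. E t \<xi>) has_vector_derivative (complex_of_real (- real k + exp (- \<xi>) - l) - \<i> * A t - 0)) (at \<xi>)"
      unfolding E_def
      by (intro has_vector_derivative_diff has_vector_derivative_const l has_vector_derivative_of_real r)
    then have "((\<lambda>\<xi>. exp (E t \<xi>)) has_vector_derivative
        ((complex_of_real (- real k + exp (- \<xi>) - l) - \<i> * A t - 0) * exp (E t \<xi>))) (at \<xi>)"
      by (rule field_vector_diff_chain_at[of _ _ _ exp, unfolded o_def]) (auto intro!: derivative_eq_intros)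
    from has_vector_derivative_mult_left[OF this, of "\<theta> t"]
    have "((\<lambda>\<xi>. wkb A Q l k \<theta> i t \<xi>) has_vector_derivative
        ((complex_of_real (- real k + exp (- \<xi>) - l) - \<i> * A t) * exp (E t \<xi>) * \<theta> t)) (at \<xi>)"
      unfolding wkb_def E_def[symmetric] by simp
    moreover have e1: "wkb A Q l (Suc k) \<theta> i t \<xi> = complex_of_real (exp (- \<xi>)) * exp (E t \<xi>) * \<theta> t"
    proof -
      have "complex_of_real (- (real (Suc k) * \<xi>) - exp (- \<xi>) - l * \<xi>) - \<i> * complex_of_real \<xi> * A t - Q t
          = complex_of_real (- \<xi>) + E t \<xi>" by (simp add: E_def algebra_simps)
      then show ?thesis unfolding wkb_def by (simp only: exp_add exp_of_real)
    qed
    moreover have e2: "wkb A Q l k (\<lambda>t. (complex_of_real (- real k - l) - \<i> * A t) * \<theta> t) i t \<xi>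
        = (complex_of_real (- real k - l) - \<i> * A t) * exp (E t \<xi>) * \<theta> t"
      unfolding wkb_def E_def[symmetric] by simp
    moreover have "wkb A Q l (Suc k) \<theta> i t \<xi> + wkb A Q l k (\<lambda>t. (complex_of_real (- real k - l) - \<i> * A t) * \<theta> t) i t \<xi>
        = (complex_of_real (- real k + exp (- \<xi>) - l) - \<i> * A t) * exp (E t \<xi>) * \<theta> t"
      unfolding e1 e2 by (simp add: algebra_simps)
    ultimately show ?thesis by simp
  qed
  show ?thesis unfolding partials_def using t x by blast
qed

text \<open>The amplitude varies in the induction. Its vanishing condition refers to an open set,
  hence also holds for its derivative, so the growth bound is available at every order.\<close>

lemma cinf_wkb:
  fixes A Q \<theta> :: "real \<Rightarrow> complex"
  assumes A: "smooth1 A" "\<And>t. A (t + 2 * pi) = A t" and Q: "smooth1 Q" "\<And>t. Q (t + 2 * pi) = Q t"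
    and \<theta>: "smooth1 \<theta>" "\<And>t. \<theta> (t + 2 * pi) = \<theta> t" "\<And>t. Im (A t) > l - \<delta> \<Longrightarrow> \<theta> t = 0"
    and d: "\<delta> \<ge> 0"
  shows "cinf moderate (wkb A Q l k \<theta> :: 'i \<Rightarrow> tfun)" and "\<delta> > 0 \<Longrightarrow> cinf rapid (wkb A Q l k \<theta> :: 'i \<Rightarrow> tfun)"
proof -
  obtain a where a: "smooth1 a" "\<And>t. (A has_vector_derivative a t) (at t)"
    using smooth1_deriv[OF A(1)] by blast
  obtain b where b: "smooth1 b" "\<And>t. (Q has_vector_derivative b t) (at t)"
    using smooth1_deriv[OF Q(1)] by blast
  have ap: "a (t + 2 * pi) = a t" and bp: "b (t + 2 * pi) = b t" for t
    by (rule vector_derivative_periodic; use a b A Q in auto)+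
  obtain K1 where K1: "\<And>t. norm (A t) \<le> K1"
    using periodic_bounded[of A, OF A(2) smooth1_continuous[OF A(1)]] by blast
  obtain K2 where K2: "\<And>t. norm (Q t) \<le> K2"
    using periodic_bounded[of Q, OF Q(2) smooth1_continuous[OF Q(1)]] by blast
  have K: "norm (A t) \<le> max K1 K2" "norm (Q t) \<le> max K1 K2" for t using K1[of t] K2[of t] by auto
  have main: "ck B n (wkb A Q l k \<theta> :: 'i \<Rightarrow> tfun)"
    if B: "growth_module B moderate"
      and bd: "\<And>k \<theta>. smooth1 \<theta> \<Longrightarrow> (\<And>t. \<theta> (t + 2 * pi) = \<theta> t) \<Longrightarrow> (\<And>t. Im (A t) > l - \<delta> \<Longrightarrow> \<theta> t = 0)
        \<Longrightarrow> B (wkb A Q l k \<theta> :: 'i \<Rightarrow> tfun)"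
      and \<theta>: "smooth1 \<theta>" "\<And>t. \<theta> (t + 2 * pi) = \<theta> t" "\<And>t. Im (A t) > l - \<delta> \<Longrightarrow> \<theta> t = 0"
    for B n k \<theta>
    using \<theta>
  proof (induction n arbitrary: k \<theta>)
    have cont: "cont2 (wkb A Q l k \<theta> :: 'i \<Rightarrow> tfun)" if "smooth1 \<theta>" for k \<theta>
    proof -
      have c: "continuous_on UNIV (\<lambda>p::real \<times> real. f (fst p))" if "smooth1 f" for f
        by (rule continuous_on_compose2[OF smooth1_continuous[OF that, of UNIV] continuous_on_fst[OF continuous_on_id]]) auto
      show ?thesis unfolding cont2_def wkb_def
        by (intro allI continuous_intros c that A(1) Q(1))
    qed
    {
      case 0
      then show ?case using bd cont by simp
    next
      case (Suc n)
      obtain \<theta>' where \<theta>': "smooth1 \<theta>'" "\<And>t. (\<theta> has_vector_derivative \<theta>' t) (at t)"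
        using smooth1_deriv[OF Suc.prems(1)] by blast
      have \<theta>'p: "\<theta>' (t + 2 * pi) = \<theta>' t" for t
        by (rule vector_derivative_periodic; use \<theta>' Suc.prems in auto)
      have \<theta>'v: "\<theta>' t = 0" if "Im (A t) > l - \<delta>" for t
      proof -
        have "open {t. Im (A t) > l - \<delta>}"
          by (intro open_Collect_less continuous_intros smooth1_continuous A(1))
        then have "(\<theta> has_vector_derivative 0) (at t)"
          by (rule has_vector_derivative_transform_within_open[OF has_vector_derivative_const[of 0]])
            (use Suc.prems(3) that in auto)
        then show ?thesis using \<theta>'(2) vector_derivative_unique_at by blast
      qed
      show ?case
      proof (rule ck_SucI[OF _ _ wkb_partials[where l=l and k=k, OF a(2) b(2) \<theta>'(2)]])
        show "B (wkb A Q l k \<theta> :: 'i \<Rightarrow> tfun)" using bd Suc.prems by blast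
        show "cont2 (wkb A Q l k \<theta> :: 'i \<Rightarrow> tfun)" by (rule cont[OF Suc.prems(1)])
        have xm: "ck moderate n (\<lambda>i::'i. \<lambda>t \<xi>. - \<i> * complex_of_real \<xi>)"
          by (intro ck_mult[OF growth_module_moderate] ck_moderate_const ck_moderate_x)
        show "ck B n (\<lambda>i t \<xi>. wkb A Q l k (\<lambda>t. \<theta>' t - b t * \<theta> t) i t \<xi> + (- \<i> * complex_of_real \<xi>) * wkb A Q l k (\<lambda>t. a t * \<theta> t) i t \<xi>)"
          by (intro ck_add[OF B] ck_mult[OF B xm] Suc.IH smooth1_diff smooth1_mult \<theta>'(1) a(1) b(1) Suc.prems(1))
            (use \<theta>'p \<theta>'v ap bp Suc.prems in auto)
        show "ck B n (\<lambda>i t \<xi>. wkb A Q l (Suc k) \<theta> i t \<xi> + wkb A Q l k (\<lambda>t. (complex_of_real (- real k - l) - \<i> * A t) * \<theta> t) i t \<xi>)"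
          by (intro ck_add[OF B] Suc.IH smooth1_diff smooth1_mult smooth1_const A(1) Suc.prems(1))
            (use A Suc.prems in auto)
      qed
    }
  qed
  have bdM: "moderate (wkb A Q l k \<theta> :: 'i \<Rightarrow> tfun)" "\<delta> > 0 \<Longrightarrow> rapid (wkb A Q l k \<theta> :: 'i \<Rightarrow> tfun)"
    if \<theta>: "smooth1 \<theta>" "\<And>t. \<theta> (t + 2 * pi) = \<theta> t" "\<And>t. Im (A t) > l - \<delta> \<Longrightarrow> \<theta> t = 0" for k \<theta>
  proof -
    obtain M where M: "\<And>t. norm (\<theta> t) \<le> M"
      using periodic_bounded[of \<theta>, OF \<theta>(2) smooth1_continuous[OF \<theta>(1)]] by blast
    show "moderate (wkb A Q l k \<theta> :: 'i \<Rightarrow> tfun)" "\<delta> > 0 \<Longrightarrow> rapid (wkb A Q l k \<theta> :: 'i \<Rightarrow> tfun)"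
      using wkb_growth[of A "max K1 K2" Q \<theta> M l \<delta> k, OF K M \<theta>(3) d] by blast+
  qed
  show "cinf moderate (wkb A Q l k \<theta> :: 'i \<Rightarrow> tfun)"
    unfolding cinf_def using main[OF growth_module_moderate bdM(1) \<theta>] by blast
  show "cinf rapid (wkb A Q l k \<theta> :: 'i \<Rightarrow> tfun)" if "\<delta> > 0"
    unfolding cinf_def using main[OF growth_module_rapid bdM(2)[OF _ _ _ that] \<theta>] by blast
qed

section \<open>Periodic primitives and bumps\<close>

lemma constant_on_convex:
  fixes f :: "real \<Rightarrow> complex"
  assumes "convex S" "\<And>x. (f has_vector_derivative f' x) (at x)" "\<And>x. x \<in> S \<Longrightarrow> f' x = 0" "x \<in> S" "y \<in> S"
  shows "f x = f y"
proof -
  have "norm (f x - f y) \<le> 0 * norm (x - y)"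
    by (rule vector_mvt_bound[OF assms(1,2)]) (use assms in auto)
  then show ?thesis by simp
qed

lemma smooth_periodicI:
  assumes "smooth1 f" "\<And>t. f (t + 2 * pi) = f t"
  shows "smooth_periodic f"
proof -
  obtain F where F: "F 0 = f" "\<And>n x. (F n has_vector_derivative F (Suc n) x) (at x)"
    using assms(1) by (auto simp: smooth1_def)
  have "((\<lambda>g s. vector_derivative g (at s)) ^^ n) f = F n" for n
    by (induction n) (auto simp: F(1) vector_derivative_at[OF F(2)])
  then show ?thesis using F(2) assms(2) by (auto simp: smooth_periodic_def intro: differentiableI_vector)
qed

lemma smooth_periodic_lincomb:
  assumes f: "smooth_periodic f" and g: "smooth_periodic g"
  shows "smooth_periodic (\<lambda>t. f t - k * g t)" "mean (\<lambda>t. f t - k * g t) = mean f - k * mean g"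
proof -
  note D = smooth_periodicD(1,2)[OF f] smooth_periodicD(1,2)[OF g]
  show "smooth_periodic (\<lambda>t. f t - k * g t)"
    by (intro smooth_periodicI smooth1_diff smooth1_mult smooth1_const D) (simp add: D)
  have i: "f integrable_on {0..2 * pi}" "(\<lambda>t. k * g t) integrable_on {0..2 * pi}"
    by (intro integrable_continuous_real smooth1_continuous smooth1_mult smooth1_const D)+
  show "mean (\<lambda>t. f t - k * g t) = mean f - k * mean g"
    unfolding mean_def Henstock_Kurzweil_Integration.integral_diff[OF i]
    by (simp add: diff_divide_distrib)
qed

text \<open>A primitive of \<open>h\<close> is the phase with \<open>c = 0\<close> and
  \<open>q = h\<close> at frequency 0, so the shift formula of the phase applies.\<close>

lemma antiderivative_shift:
  assumes h: "smooth_periodic h" and H: "\<And>t. (H has_vector_derivative h t) (at t)"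
  shows "H (t + 2 * pi) = H t + 2 * pi * mean h"
proof -
  have z: "smooth_periodic (\<lambda>_. 0)" by (rule smooth_periodicI[OF smooth1_const]) simp
  let ?P = "\<lambda>t. phase (\<lambda>_. 0) h () t 0"
  have "((\<lambda>t. ?P t - H t) has_vector_derivative symb (\<lambda>_. 0) h () t 0 - h t) (at t)" for t
    by (intro has_vector_derivative_diff phase_deriv[OF z h] H)
  from constant_on_convex[OF convex_UNIV this, of t "t + 2 * pi"]
  have "?P t - H t = ?P (t + 2 * pi) - H (t + 2 * pi)" by (simp add: symb_def)
  moreover have "?P (2 * pi) = 2 * pi * mean h"
    unfolding phase_2pi[OF z h] by simp
  ultimately show ?thesis unfolding phase_shift[OF z h, of "()" t] by (simp add: algebra_simps)
qed

lemma periodic_antiderivative: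
  assumes h: "smooth_periodic h" "mean h = 0"
  shows "\<exists>H. smooth1 H \<and> (\<forall>t. H (t + 2 * pi) = H t) \<and> (\<forall>t. (H has_vector_derivative h t) (at t)) \<and> H a = 0"
proof -
  obtain H where H: "smooth1 H" "\<And>t. (H has_vector_derivative h t) (at t)" "H a = 0"
    using smooth1_antiderivative[OF smooth_periodicD(1)[OF h(1)]] by blast
  then show ?thesis using antiderivative_shift[OF h(1) H(2)] h(2) by auto
qed

lemma periodic_bump:
  assumes d: "0 < d" "d < pi"
  shows "\<exists>\<beta>. smooth_periodic \<beta> \<and> mean \<beta> \<noteq> 0 \<and> (\<forall>t. m + d \<le> t \<longrightarrow> t \<le> m - d + 2 * pi \<longrightarrow> \<beta> t = 0)"
proof -
  define b where "b t = flat (cos (t - m) - cos d)" for t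
  have "smooth1 (\<lambda>t. complex_of_real (b t))"
    unfolding b_def by (rule smooth1_compose[OF smooth1_flat])
      (simp, intro smooth1_diff smooth1_const smooth1_cos)
  moreover have "b (t + 2 * pi) = b t" for t
    using cos_periodic[of "t - m"] by (simp add: b_def algebra_simps)
  ultimately have s: "smooth_periodic (\<lambda>t. complex_of_real (b t))"
    and s': "smooth_periodic (\<lambda>t. \<i> * complex_of_real (b t))"
    by (auto intro!: smooth_periodicI smooth1_mult smooth1_const)
  \<comment> \<open>The factor \<i> turns the real bump into an imaginary part, for which positivity
    of the mean is known.\<close>
  have "1 * Im (mean (\<lambda>t. \<i> * complex_of_real (b t))) > 0"
  proof (rule Im_mean_pos[OF s' s', of _ m])
    have "cos d < 1" using cos_monotone_0_pi[of 0 d] d by simp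
    then show "Im (\<i> * complex_of_real (b m)) \<noteq> 0"
      using flat_pos[of "1 - cos d"] by (simp add: b_def)
  qed (auto simp: b_def flat_nonneg)
  then have "mean (\<lambda>t. complex_of_real (b t)) \<noteq> 0" by (auto simp: mean_def)
  moreover have "b t = 0" if "m + d \<le> t" "t \<le> m - d + 2 * pi" for t
    unfolding b_def
  proof (rule flat_0)
    have "cos (t - m) \<le> cos d"
    proof (cases "t - m \<le> pi")
      case True
      then show ?thesis using that d by (intro cos_monotone_0_pi_le) auto
    next
      case False
      then have "cos (2 * pi - (t - m)) \<le> cos d"
        using that d by (intro cos_monotone_0_pi_le) auto
      then show ?thesis by simp
    qed
    then show "cos (t - m) - cos d \<le> 0" by simp
  qed
  ultimately show ?thesis using s by (intro exI[of _ "\<lambda>t. complex_of_real (b t)"]) auto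
qed

text \<open>\<open>Im A\<close> has an interior maximum \<open>l\<close> between a point \<open>p\<close> of increase and a point \<open>m\<close> of decrease. The
  amplitude \<open>\<theta>\<close> rises near \<open>p\<close> and falls near \<open>m\<close>, so that \<open>\<theta>'\<close> lives where \<open>Im A < l\<close>. To obtain periodic
  primitives, \<open>c\<close> and \<open>q\<close> are modified outside the support of \<open>\<theta>\<close>.\<close>

lemma wkb_data_exist:
  assumes c: "smooth_periodic c" and q: "smooth_periodic q"
    and bp: "Im (c p) > 0" and bm': "Im (c m') < 0"
  obtains A Q a b \<theta> \<theta>' l \<delta> t1 where
    "smooth1 A" "\<And>t. A (t + 2 * pi) = A t" "\<And>t. (A has_vector_derivative a t) (at t)"
    "smooth1 Q" "\<And>t. Q (t + 2 * pi) = Q t" "\<And>t. (Q has_vector_derivative b t) (at t)"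
    "smooth1 \<theta>" "\<And>t. \<theta> (t + 2 * pi) = \<theta> t" "\<And>t. (\<theta> has_vector_derivative \<theta>' t) (at t)"
    "smooth1 \<theta>'" "\<And>t. \<theta>' (t + 2 * pi) = \<theta>' t"
    "\<And>t. a t * \<theta> t = c t * \<theta> t" "\<And>t. b t * \<theta> t = q t * \<theta> t"
    "\<And>t. Im (A t) > l \<Longrightarrow> \<theta> t = 0" "\<delta> > 0" "\<And>t. Im (A t) > l - \<delta> \<Longrightarrow> \<theta>' t = 0"
    "Im (A t1) = l" "\<theta> t1 \<noteq> 0"
proof -
  obtain k :: int where k: "m' + 2 * pi * of_int k \<in> {p..<p + 2 * pi}" by (rule periodic_reduce)
  define m where "m = m' + 2 * pi * of_int k"
  have bm: "Im (c m) < 0"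
    using bm' periodic_int[of c, OF smooth_periodicD(2)[OF c]] by (simp add: m_def)
  have pm: "p < m" "m < p + 2 * pi" using k bp bm by (auto simp: m_def[symmetric] order.order_iff_strict)
  obtain C where C: "smooth1 C" "\<And>t. (C has_vector_derivative c t) (at t)" "C p = 0"
    using smooth1_antiderivative[OF smooth_periodicD(1)[OF c]] by blast
  have Cd: "((\<lambda>t. Im (C t)) has_real_derivative Im (c t)) (at t)" for t
    using bounded_linear.has_vector_derivative[OF bounded_linear_Im C(2)[of t]]
    by (simp add: has_real_derivative_iff_has_vector_derivative)
  have Cc: "continuous_on S (\<lambda>t. Im (C t))" for S
    by (intro continuous_intros smooth1_continuous C(1))
  obtain t1 where t1: "t1 \<in> {p..m}" and max: "\<And>t. t \<in> {p..m} \<Longrightarrow> Im (C t) \<le> Im (C t1)"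
    using continuous_attains_sup[of "{p..m}" "\<lambda>t. Im (C t)"] Cc pm by auto
  define l where "l = Im (C t1)"
  have lp: "Im (C p) < l"
  proof -
    obtain d where d: "d > 0" "\<And>h. 0 < h \<Longrightarrow> h < d \<Longrightarrow> Im (C p) < Im (C (p + h))"
      using DERIV_pos_inc_right[OF Cd bp] by blast
    define h where "h = min d (m - p) / 2"
    have "0 < h" "h < d" "p + h \<in> {p..m}" using d pm by (auto simp: h_def min_def field_simps)
    then show ?thesis using d(2)[of h] max[of "p + h"] by (simp add: l_def)
  qed
  have lm: "Im (C m) < l"
  proof -
    obtain d where d: "d > 0" "\<And>h. 0 < h \<Longrightarrow> h < d \<Longrightarrow> Im (C m) < Im (C (m - h))"
      using DERIV_neg_dec_left[OF Cd bm] by blast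
    define h where "h = min d (m - p) / 2"
    have "0 < h" "h < d" "m - h \<in> {p..m}" using d pm by (auto simp: h_def min_def field_simps)
    then show ?thesis using d(2)[of h] max[of "m - h"] by (simp add: l_def)
  qed
  \<comment> \<open>Half of the drop from the maximum to the higher end point, so that
    \<open>Im C\<close> stays below \<open>l - \<delta>\<close> near \<open>p\<close> and
    \<open>m\<close>.\<close>
  define \<delta> where "\<delta> = (l - max (Im (C p)) (Im (C m))) / 2"
  have \<delta>: "\<delta> > 0" and Cp: "Im (C p) < l - \<delta>" and Cm: "Im (C m) < l - \<delta>"
    using lp lm by (auto simp: \<delta>_def max_def field_simps)
  have nbhd: "\<exists>e>0. \<forall>t. \<bar>t - x\<bar> \<le> e \<longrightarrow> Im (C t) < l - \<delta>" if "Im (C x) < l - \<delta>" for x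
  proof -
    have op: "open {t. Im (C t) < l - \<delta>}" by (intro open_Collect_less Cc continuous_intros)
    have "x \<in> {t. Im (C t) < l - \<delta>}" using that by simp
    then have "\<exists>e>0. cball x e \<subseteq> {t. Im (C t) < l - \<delta>}" by (rule iffD1[OF open_contains_cball_eq[OF op, rule_format]])
    then obtain e where e: "e > 0" "cball x e \<subseteq> {t. Im (C t) < l - \<delta>}" by (elim exE conjE)
    then have "Im (C t) < l - \<delta>" if "\<bar>t - x\<bar> \<le> e" for t
      using that subsetD[OF e(2), of t] by (simp add: dist_real_def abs_minus_commute)
    with e(1) show ?thesis by blast
  qed
  obtain e1 where e1: "e1 > 0" "\<And>t. \<bar>t - p\<bar> \<le> e1 \<Longrightarrow> Im (C t) < l - \<delta>" using nbhd[OF Cp] by blast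
  obtain e2 where e2: "e2 > 0" "\<And>t. \<bar>t - m\<bar> \<le> e2 \<Longrightarrow> Im (C t) < l - \<delta>" using nbhd[OF Cm] by blast
  \<comment> \<open>The quarter of the arc from \<open>m\<close> to \<open>p + 2 * pi\<close> keeps
    room outside the neighbourhoods of \<open>p\<close> and \<open>m\<close> for a third
    bump.\<close>
  define e where "e = min (min e1 e2) ((p + 2 * pi - m) / 4)"
  have e: "e > 0" "e \<le> e1" "e \<le> e2" "4 * e \<le> p + 2 * pi - m"
    using e1(1) e2(1) pm by (auto simp: e_def min_def field_simps)
  have near: "Im (C t) < l - \<delta>" if "t \<in> {p - e..p + e} \<union> {m - e..m + e}" for t
    using that e1(2)[of t] e2(2)[of t] e by (auto simp: abs_le_iff)
  have t1pm: "p + e < t1" "t1 < m - e"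
    using near[of t1] t1 e \<delta> by (auto simp: l_def not_le[symmetric])
  have epi: "e < pi" using e pm by linarith
  obtain \<beta>1 where \<beta>1: "smooth_periodic \<beta>1" "mean \<beta>1 \<noteq> 0"
    "\<And>t. p + e \<le> t \<Longrightarrow> t \<le> p - e + 2 * pi \<Longrightarrow> \<beta>1 t = 0"
    using periodic_bump[OF e(1) epi] by blast
  obtain \<beta>2 where \<beta>2: "smooth_periodic \<beta>2" "mean \<beta>2 \<noteq> 0"
    "\<And>t. m + e \<le> t \<Longrightarrow> t \<le> m - e + 2 * pi \<Longrightarrow> \<beta>2 t = 0"
    using periodic_bump[OF e(1) epi] by blast
  have \<beta>2': "\<beta>2 t = 0" if "m + e - 2 * pi \<le> t" "t \<le> m - e" for t
    using \<beta>2(3)[of "t + 2 * pi"] smooth_periodicD(2)[OF \<beta>2(1), of t] that by simp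
  \<comment> \<open>\<open>g\<close> is the midpoint of the arc from \<open>m\<close> to
    \<open>p + 2 * pi\<close>, and \<open>e3\<close> its half-length less \<open>e\<close>: the
    third bump lives between \<open>m + e\<close> and \<open>p - e + 2 * pi\<close>.\<close>
  define g where "g = (m + p) / 2 + pi"
  define e3 where "e3 = (p + 2 * pi - m) / 2 - e"
  have e3: "0 < e3" "e3 < pi" using e pm by (auto simp: e3_def field_simps)
  obtain \<beta>3 where \<beta>3: "smooth_periodic \<beta>3" "mean \<beta>3 \<noteq> 0"
    "\<And>t. g + e3 \<le> t \<Longrightarrow> t \<le> g - e3 + 2 * pi \<Longrightarrow> \<beta>3 t = 0"
    using periodic_bump[OF e3] by blast
  have \<beta>3': "\<beta>3 t = 0" if "p - e \<le> t" "t \<le> m + e" for t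
    using \<beta>3(3)[of "t + 2 * pi"] smooth_periodicD(2)[OF \<beta>3(1), of t] that
    by (simp add: g_def e3_def field_simps)
  \<comment> \<open>The mean of \<open>c\<close> is removed on the support of the third bump, where
    \<theta> will be 0; \<open>q\<close> is treated likewise.\<close>
  define a where "a t = c t - (mean c / mean \<beta>3) * \<beta>3 t" for t
  define b where "b t = q t - (mean q / mean \<beta>3) * \<beta>3 t" for t
  have a: "smooth_periodic a" "mean a = 0" and b: "smooth_periodic b" "mean b = 0"
    using smooth_periodic_lincomb[OF c \<beta>3(1), of "mean c / mean \<beta>3"]
      smooth_periodic_lincomb[OF q \<beta>3(1), of "mean q / mean \<beta>3"] \<beta>3(2)
    unfolding a_def[abs_def] b_def[abs_def] by auto
  obtain A where A: "smooth1 A" "\<And>t. A (t + 2 * pi) = A t" "\<And>t. (A has_vector_derivative a t) (at t)" "A p = 0"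
    using periodic_antiderivative[OF a] by blast
  obtain Q where Q: "smooth1 Q" "\<And>t. Q (t + 2 * pi) = Q t" "\<And>t. (Q has_vector_derivative b t) (at t)"
    using periodic_antiderivative[OF b] by blast
  have AC: "A t = C t" if "t \<in> {p - e..m + e}" for t
  proof -
    have "((\<lambda>t. A t - C t) has_vector_derivative a t - c t) (at t)" for t
      by (intro has_vector_derivative_diff A C)
    from constant_on_convex[OF convex_real_interval(5) this, of "p - e" "m + e" t p]
    show ?thesis using that e pm \<beta>3' A(4) C(3) by (simp add: a_def)
  qed
  define \<beta>1' where "\<beta>1' t = 0 - (- 1 / mean \<beta>1) * \<beta>1 t" for t
  have "smooth_periodic (\<lambda>_. 0)" by (rule smooth_periodicI[OF smooth1_const]) simp
  from smooth_periodic_lincomb[OF this \<beta>1(1), of "- 1 / mean \<beta>1"] \<beta>1(2)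
  have \<beta>1n: "smooth_periodic \<beta>1'" "mean \<beta>1' = 1"
    unfolding \<beta>1'_def[abs_def] by (auto simp: mean_def)
  \<comment> \<open>Two bumps normalised to mean 1, near \<open>p\<close> and with opposite sign
    near \<open>m\<close>: the total mean is 0 and the primitive is periodic.\<close>
  define \<theta>' where "\<theta>' t = \<beta>1' t - (1 / mean \<beta>2) * \<beta>2 t" for t
  have \<theta>'m: "smooth_periodic \<theta>'" "mean \<theta>' = 0"
    using smooth_periodic_lincomb[OF \<beta>1n(1) \<beta>2(1), of "1 / mean \<beta>2"] \<beta>1n(2) \<beta>2(2)
    unfolding \<theta>'_def[abs_def] by auto
  obtain \<theta> where \<theta>: "smooth1 \<theta>" "\<And>t. \<theta> (t + 2 * pi) = \<theta> t" "\<And>t. (\<theta> has_vector_derivative \<theta>' t) (at t)" "\<theta> (p - e) = 0"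
    using periodic_antiderivative[OF \<theta>'m] by blast
  have \<theta>'out: "\<theta>' t = 0" if "t \<in> {m + e..p - e + 2 * pi}" for t
    using that \<beta>1(3)[of t] \<beta>2(3)[of t] pm e by (simp add: \<theta>'_def \<beta>1'_def)
  have \<theta>out: "\<theta> t = 0" if "t \<in> {m + e..p - e + 2 * pi}" for t
  proof -
    have "\<theta> t = \<theta> (p - e + 2 * pi)"
      by (rule constant_on_convex[OF convex_real_interval(5) \<theta>(3) \<theta>'out that]) (use e pm in auto)
    then show ?thesis using \<theta>(2)[of "p - e"] \<theta>(4) by simp
  qed
  \<comment> \<open>Between the two bumps \<theta> has collected the whole integral of the first,
    which is \<open>2 * pi\<close>.\<close>
  have \<theta>t1: "\<theta> t1 \<noteq> 0"
  proof -
    obtain \<Theta> where \<Theta>: "\<And>t. (\<Theta> has_vector_derivative \<beta>1' t) (at t)" "\<Theta> (p - e) = 0"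
      using smooth1_antiderivative[OF smooth_periodicD(1)[OF \<beta>1n(1)]] by blast
    have "\<Theta> t1 = \<Theta> (p - e + 2 * pi)"
      by (rule constant_on_convex[OF convex_real_interval(5)[of "p + e" "p - e + 2 * pi"] \<Theta>(1)])
        (use t1pm e pm \<beta>1(3) in \<open>auto simp: \<beta>1'_def\<close>)
    also have "\<dots> = 2 * pi" using antiderivative_shift[OF \<beta>1n(1) \<Theta>(1), of "p - e"] \<Theta>(2) \<beta>1n(2) by simp
    finally have T: "\<Theta> t1 = 2 * pi" .
    have d: "((\<lambda>t. \<theta> t - \<Theta> t) has_vector_derivative \<theta>' t - \<beta>1' t) (at t)" for t
      by (intro has_vector_derivative_diff \<theta> \<Theta>)
    have "\<theta> t1 - \<Theta> t1 = \<theta> (p - e) - \<Theta> (p - e)"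
      by (rule constant_on_convex[OF convex_real_interval(5)[of "p - e" "m - e"] d])
        (use t1pm e pm \<beta>2' in \<open>auto simp: \<theta>'_def\<close>)
    then show ?thesis using T \<theta>(4) \<Theta>(2) by simp
  qed
  have main: "a t * \<theta> t = c t * \<theta> t \<and> b t * \<theta> t = q t * \<theta> t \<and> (Im (A t) > l \<longrightarrow> \<theta> t = 0)
      \<and> (Im (A t) > l - \<delta> \<longrightarrow> \<theta>' t = 0)" for t
  proof -
    obtain k :: int where k: "t + 2 * pi * of_int k \<in> {p - e..<p - e + 2 * pi}" by (rule periodic_reduce)
    define s where "s = t + 2 * pi * of_int k"
    have per: "f s = f t" if "\<And>t. f (t + 2 * pi) = f t" for f :: "real \<Rightarrow> complex"
      unfolding s_def by (rule periodic_int[of f, OF that])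
    have "a s * \<theta> s = c s * \<theta> s \<and> b s * \<theta> s = q s * \<theta> s \<and> (Im (A s) > l \<longrightarrow> \<theta> s = 0)
      \<and> (Im (A s) > l - \<delta> \<longrightarrow> \<theta>' s = 0)"
    proof (cases "s \<le> m + e")
      case True
      then have s: "s \<in> {p - e..m + e}" using k by (auto simp: s_def)
      have "Im (C s) \<le> l" using near[of s] max[of s] s \<delta> by (force simp: l_def)
      moreover have "\<theta>' s = 0" if "Im (C s) > l - \<delta>"
      proof -
        have "p + e < s" "s < m - e" using near[of s] s that by (auto simp: not_le[symmetric])
        then show ?thesis using \<beta>1(3)[of s] \<beta>2'[of s] e pm by (simp add: \<theta>'_def \<beta>1'_def)
      qed
      ultimately show ?thesis using AC[OF s] \<beta>3'[of s] s by (auto simp: a_def b_def)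
    next
      case False
      then have "s \<in> {m + e..p - e + 2 * pi}" using k by (auto simp: s_def)
      then show ?thesis using \<theta>out \<theta>'out by simp
    qed
    then show ?thesis
      using per[of a, OF smooth_periodicD(2)[OF a(1)]] per[of b, OF smooth_periodicD(2)[OF b(1)]]
        per[of c, OF smooth_periodicD(2)[OF c]] per[of q, OF smooth_periodicD(2)[OF q]] per[of A, OF A(2)]
        per[of \<theta>, OF \<theta>(2)] per[of \<theta>', OF smooth_periodicD(2)[OF \<theta>'m(1)]]
      by simp
  qed
  have m: "a t * \<theta> t = c t * \<theta> t" "b t * \<theta> t = q t * \<theta> t" "Im (A t) > l \<Longrightarrow> \<theta> t = 0"
    "Im (A t) > l - \<delta> \<Longrightarrow> \<theta>' t = 0" for t using main[of t] by simp_all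
  have "Im (A t1) = l" using AC[of t1] t1pm e by (simp add: l_def)
  note facts = A(1-3) Q(1-3) \<theta>(1-3) smooth_periodicD(1,2)[OF \<theta>'m(1)] m \<delta> \<theta>t1 this
  show thesis
    by (rule that[of A a Q b \<theta> \<theta>' l \<delta> t1]) (assumption | rule facts)+
qed

section \<open>Coefficients that change sign\<close>

lemma cinf_rapid_gauss:
  assumes "a > 0"
  shows "cinf rapid (\<lambda>i t x. exp (complex_of_real (- a) * (complex_of_real x * complex_of_real x)))"
proof (rule cinf_exp[OF growth_module_rapid])
  show "cinf moderate (\<lambda>i t x. complex_of_real (- a) * (complex_of_real x * complex_of_real x))"
    by (intro cinf_mult[OF growth_module_moderate] cinf_moderate_const cinf_moderate_x)
  show "rapid (\<lambda>i t x. exp (complex_of_real (- a) * (complex_of_real x * complex_of_real x)))"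
    unfolding rapid_def
  proof
    fix N
    have "norm (exp (complex_of_real (- a) * (complex_of_real x * complex_of_real x))) * (1 + \<bar>x\<bar>) ^ N
        \<le> exp ((real N)\<^sup>2 / (4 * a))" for x
    proof -
      have "(1 + \<bar>x\<bar>) ^ N \<le> exp \<bar>x\<bar> ^ N" by (intro power_mono exp_ge_add_one_self) auto
      then have "(1 + \<bar>x\<bar>) ^ N \<le> exp (real N * \<bar>x\<bar>)" by (simp add: exp_of_nat_mult)
      then have "exp (- (a * (x * x))) * (1 + \<bar>x\<bar>) ^ N \<le> exp (- (a * (x * x))) * exp (real N * \<bar>x\<bar>)"
        by (intro mult_left_mono) auto
      also have "\<dots> = exp (real N * \<bar>x\<bar> - a * \<bar>x\<bar>\<^sup>2)"
        by (simp add: power2_eq_square flip: exp_add)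
      also have "\<dots> \<le> exp ((real N)\<^sup>2 / (4 * a))"
      proof -
        have "0 \<le> (real N - 2 * a * \<bar>x\<bar>)\<^sup>2 / (4 * a)" using assms by simp
        also have "\<dots> = (real N)\<^sup>2 / (4 * a) - (real N * \<bar>x\<bar> - a * \<bar>x\<bar>\<^sup>2)"
          using assms by (simp add: field_simps power2_eq_square)
        finally show ?thesis by simp
      qed
      finally show ?thesis by simp
    qed
    then show "\<exists>C. \<forall>i t x. norm (exp (complex_of_real (- a) * (complex_of_real x * complex_of_real x))) * (1 + \<bar>x\<bar>) ^ N \<le> C"
      by blast
  qed
qed

text \<open>From \<open>1 - exp (- y) \<le> y\<close> the bound \<open>x^2\<close> follows uniformly
  in \<open>n\<close>; this is the source of the rate \<open>1 / (n + 1)\<close> in the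
  approximation. The first \<open>x\<close>-derivative is \<open>2 * x\<close> times the Gaussian,
  whose derivatives are moderate uniformly in \<open>n\<close>.\<close>

lemma cinf_moderate_gauss_defect:
  "cinf moderate (\<lambda>n::nat. \<lambda>t x. complex_of_real (real (Suc n)) *
    (1 - exp (complex_of_real (- (1 / real (Suc n))) * (complex_of_real x * complex_of_real x))))"
  (is "cinf moderate ?f")
proof -
  define G where "G n t x = exp (complex_of_real (- (1 / real (Suc n))) * (complex_of_real x * complex_of_real x))"
    for n :: nat and t x :: real
  have nG: "norm (G n t x) = exp (- (x\<^sup>2 / real (Suc n)))" for n t x
    by (simp add: G_def power2_eq_square)
  have G: "ck moderate m G" for m
    unfolding G_def[abs_def]
  proof (rule ck_exp[OF growth_module_moderate])
    show "moderate (\<lambda>(n::nat) t x. exp (complex_of_real (- (1 / real (Suc n))) * (complex_of_real x * complex_of_real x)))"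
      by (rule moderate_bounded[of _ 1]) (use nG in \<open>simp add: G_def\<close>)
    have "ck moderate m (\<lambda>(n::nat) t x. complex_of_real (- (1 / real (Suc n))))"
    proof (rule ck_const; rule moderate_bounded[of _ 1])
      show "norm (complex_of_real (- (1 / real (Suc n)))) \<le> 1" for n
        by (simp only: norm_of_real) simp
    qed simp
    then show "ck moderate m (\<lambda>(n::nat) t x. complex_of_real (- (1 / real (Suc n))) * (complex_of_real x * complex_of_real x))"
      by (intro ck_mult[OF growth_module_moderate] ck_moderate_x)
  qed
  have f: "?f = (\<lambda>n t x. complex_of_real (real (Suc n)) * (1 - G n t x))" by (simp add: G_def)
  have mod: "moderate ?f"
  proof (rule moderateI[of _ 1 2])
    fix n :: nat and t x :: real
    have "1 - x\<^sup>2 / real (Suc n) \<le> exp (- (x\<^sup>2 / real (Suc n)))"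
      using exp_ge_add_one_self[of "- (x\<^sup>2 / real (Suc n))"] by simp
    then have "real (Suc n) * (1 - exp (- (x\<^sup>2 / real (Suc n)))) \<le> x\<^sup>2"
      by (simp add: field_simps del: of_nat_Suc)
    moreover have "norm (1 - G n t x) = 1 - exp (- (x\<^sup>2 / real (Suc n)))"
    proof -
      have "G n t x = complex_of_real (exp (- (x\<^sup>2 / real (Suc n))))"
        by (simp add: G_def power2_eq_square flip: exp_of_real)
      then have "1 - G n t x = complex_of_real (1 - exp (- (x\<^sup>2 / real (Suc n))))" by simp
      then show ?thesis by (simp only: norm_of_real) simp
    qed
    moreover have "x\<^sup>2 \<le> (1 + \<bar>x\<bar>) ^ 2" by (simp add: power2_eq_square algebra_simps)
    ultimately show "norm (?f n t x) \<le> 1 * (1 + \<bar>x\<bar>) ^ 2"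
      unfolding G_def[symmetric, of n x t] norm_mult by (simp del: of_nat_Suc)
  qed
  have part: "partials ?f (\<lambda>n t x. 0) (\<lambda>n t x. 2 * complex_of_real x * G n t x)"
    unfolding f
  proof -
    have "((\<lambda>x. complex_of_real (real (Suc n)) * (1 - G n t x)) has_vector_derivative 2 * complex_of_real x * G n t x) (at x)" for n t x
    proof -
      have "((\<lambda>x. exp (- (1 / real (Suc n)) * (x * x))) has_real_derivative
          exp (- (1 / real (Suc n)) * (x * x)) * (- (1 / real (Suc n)) * (x + x))) (at x)"
        by (auto intro!: derivative_eq_intros)
      then have "((\<lambda>x. real (Suc n) * (1 - exp (- (1 / real (Suc n)) * (x * x)))) has_real_derivative
          real (Suc n) * (0 - exp (- (1 / real (Suc n)) * (x * x)) * (- (1 / real (Suc n)) * (x + x)))) (at x)"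
        by (intro DERIV_cmult DERIV_diff DERIV_const)
      then have "((\<lambda>x. complex_of_real (real (Suc n) * (1 - exp (- (1 / real (Suc n)) * (x * x))))) has_vector_derivative
          complex_of_real (real (Suc n) * (0 - exp (- (1 / real (Suc n)) * (x * x)) * (- (1 / real (Suc n)) * (x + x))))) (at x)"
        by (rule has_vector_derivative_of_real)
      moreover have "complex_of_real (real (Suc n) * (0 - exp (- (1 / real (Suc n)) * (x * x)) * (- (1 / real (Suc n)) * (x + x))))
          = 2 * complex_of_real x * G n t x" for x
      proof -
        have "real (Suc n) * (0 - exp (- (1 / real (Suc n)) * (x * x)) * (- (1 / real (Suc n)) * (x + x)))
            = 2 * x * exp (- (1 / real (Suc n)) * (x * x))"
          by (simp del: of_nat_Suc)
        then show ?thesis by (simp only: G_def of_real_mult of_real_numeral exp_of_real[symmetric])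
      qed
      moreover have "complex_of_real (real (Suc n) * (1 - exp (- (1 / real (Suc n)) * (x * x))))
          = complex_of_real (real (Suc n)) * (1 - G n t x)" for x
        by (simp only: G_def of_real_mult of_real_diff of_real_1 exp_of_real[symmetric])
      ultimately show ?thesis by (simp only:)
    qed
    then show "partials (\<lambda>n t x. complex_of_real (real (Suc n)) * (1 - G n t x)) (\<lambda>n t x. 0) (\<lambda>n t x. 2 * complex_of_real x * G n t x)"
      by (auto simp: partials_def G_def)
  qed
  have cont: "cont2 ?f"
    unfolding cont2_def by (intro allI continuous_intros)
  have "ck moderate (Suc m) ?f" for m
  proof (rule ck_SucI[OF mod cont part ck_moderate_const])
    show "ck moderate m (\<lambda>n t x. 2 * complex_of_real x * G n t x)"
      by (intro ck_mult[OF growth_module_moderate] ck_moderate_const ck_moderate_x G)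
  qed
  then show ?thesis unfolding cinf_def using ck_SucD by blast
qed

lemma seminorms_bounded_family:
  assumes G: "cinf rapid (G :: nat \<Rightarrow> tfun)"
  shows "\<exists>S. \<forall>n. (\<Sum>\<alpha>\<le>N. \<Sum>\<beta>\<le>N. \<Sum>\<gamma>\<le>N. schwartz_seminorm \<alpha> \<beta> \<gamma> (G n)) \<le> S"
proof -
  have "\<exists>D. \<forall>n. schwartz_seminorm \<alpha> \<beta> \<gamma> (G n) \<le> D" for \<alpha> \<beta> \<gamma>
  proof -
    have "cinf rapid (\<lambda>n. (pdx ^^ \<beta>) (G n))"
      by (induction \<beta>) (use G in \<open>auto intro: cinf_partials(3)\<close>)
    then have "cinf rapid (\<lambda>n. (pdt ^^ \<alpha>) ((pdx ^^ \<beta>) (G n)))"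
      by (induction \<alpha>) (auto intro: cinf_partials(2))
    from rapidD[OF cinf_growth[OF this], of \<gamma>] obtain D where
      D: "\<And>n t x. \<bar>x\<bar> ^ \<gamma> * norm ((pdt ^^ \<alpha>) ((pdx ^^ \<beta>) (G n)) t x) \<le> D" by blast
    have "schwartz_seminorm \<alpha> \<beta> \<gamma> (G n) \<le> D" for n
      unfolding schwartz_seminorm_def
      by (rule cSUP_least) (use D in \<open>auto simp: schwartz_term_def norm_mult norm_power\<close>)
    then show ?thesis by blast
  qed
  then obtain D where D: "\<And>\<alpha> \<beta> \<gamma> n. schwartz_seminorm \<alpha> \<beta> \<gamma> (G n) \<le> D \<alpha> \<beta> \<gamma>" by metis
  show ?thesis
    by (intro exI[of _ "\<Sum>\<alpha>\<le>N. \<Sum>\<beta>\<le>N. \<Sum>\<gamma>\<le>N. D \<alpha> \<beta> \<gamma>"] allI sum_mono D)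
qed

text \<open>The family \<open>G\<close> being bounded in every seminorm, the functions \<open>opL c q (u n)\<close> converge to \<open>f\<close>.\<close>

lemma annihilated_of_approximation:
  assumes fG: "\<And>n. f = (\<lambda>t x. opL c q (u n) t x + complex_of_real (1 / real (Suc n)) * G n t x)"
    and u: "\<And>n. u n \<in> schwartz" "\<And>n. opL c q (u n) \<in> schwartz"
    and G: "cinf rapid G" "\<And>n. G n \<in> schwartz" and v: "v \<in> ker_Lt c q"
  shows "v f = 0"
proof -
  have vt: "v \<in> tempered" and vL: "\<And>\<phi>. \<phi> \<in> schwartz \<Longrightarrow> v (opL c q \<phi>) = 0"
    using v by (auto simp: ker_Lt_def)
  have add: "\<And>f g. f \<in> schwartz \<Longrightarrow> g \<in> schwartz \<Longrightarrow> v (\<lambda>t x. f t x + g t x) = v f + v g"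
    and hom: "\<And>a f. f \<in> schwartz \<Longrightarrow> v (\<lambda>t x. a * f t x) = a * v f"
    using vt unfolding tempered_def by blast+
  obtain C N where C: "\<And>f. f \<in> schwartz \<Longrightarrow> norm (v f) \<le>
      C * (\<Sum>\<alpha>\<le>N. \<Sum>\<beta>\<le>N. \<Sum>\<gamma>\<le>N. schwartz_seminorm \<alpha> \<beta> \<gamma> f)"
    using vt unfolding tempered_def by blast
  obtain S where S: "\<And>n. (\<Sum>\<alpha>\<le>N. \<Sum>\<beta>\<le>N. \<Sum>\<gamma>\<le>N. schwartz_seminorm \<alpha> \<beta> \<gamma> (G n)) \<le> S"
    using seminorms_bounded_family[OF G(1)] by blast
  have "norm (v f) \<le> (\<bar>C\<bar> * S) * (1 / real (Suc n))" for n
  proof -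
    have Gn: "(\<lambda>t x. complex_of_real (1 / real (Suc n)) * G n t x) \<in> schwartz"
    proof (rule cinf_schwartz)
      show "cinf rapid (\<lambda>i::unit. \<lambda>t x. complex_of_real (1 / real (Suc n)) * G n t x)"
        by (rule cinf_rapid_cmult[OF schwartz_cinf[OF G(2)]])
      show "periodic_t (\<lambda>t x. complex_of_real (1 / real (Suc n)) * G n t x)"
        using G(2)[of n] by (simp add: schwartz_def periodic_t_def)
    qed
    have "v f = v (opL c q (u n)) + v (\<lambda>t x. complex_of_real (1 / real (Suc n)) * G n t x)"
      by (subst fG[of n]) (rule add[OF u(2) Gn])
    also have "\<dots> = complex_of_real (1 / real (Suc n)) * v (G n)"
      by (simp only: vL[OF u(1)] hom[OF G(2)] add_0_left)
    finally have "norm (v f) = 1 / real (Suc n) * norm (v (G n))"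
      by (simp only: norm_mult norm_of_real) simp
    moreover have "norm (v (G n)) \<le> \<bar>C\<bar> * S"
    proof -
      let ?S = "\<Sum>\<alpha>\<le>N. \<Sum>\<beta>\<le>N. \<Sum>\<gamma>\<le>N. schwartz_seminorm \<alpha> \<beta> \<gamma> (G n)"
      have "0 \<le> ?S" by (intro sum_nonneg schwartz_seminorm_nonneg G)
      then have "C * ?S \<le> \<bar>C\<bar> * ?S" by (intro mult_right_mono) auto
      also have "\<dots> \<le> \<bar>C\<bar> * S" by (intro mult_left_mono S) auto
      finally show ?thesis using C[OF G(2)] by (rule order_trans[rotated])
    qed
    ultimately show ?thesis using mult_left_mono[of "norm (v (G n))" "\<bar>C\<bar> * S" "1 / real (Suc n)"]
      by (simp add: mult.commute)
  qed
  moreover have "(\<lambda>n. (\<bar>C\<bar> * S) * (1 / real (Suc n))) \<longlonglongrightarrow> 0" by real_asymp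
  ultimately have "norm (v f) \<le> 0" by (intro LIMSEQ_le_const) auto
  then show ?thesis by simp
qed

lemma cinf_rapid_reindex:
  assumes "cinf rapid f"
  shows "cinf rapid (\<lambda>j. f (r j))"
proof -
  have "rapid (\<lambda>j. f (r j))" if "rapid f" for f
    using that unfolding rapid_def by blast
  from ck_reindex[where B=rapid and B'=rapid and r=r, OF this] assms show ?thesis by (simp add: cinf_def)
qed

lemma IFT_schwartz:
  assumes "cinf rapid g" "\<And>t \<xi>. g i (t + 2 * pi) \<xi> = g i t \<xi>"
  shows "IFT g i \<in> schwartz"
proof (rule cinf_schwartz)
  show "cinf rapid (\<lambda>_::unit. IFT g i)"
    by (rule cinf_rapid_reindex[OF cinf_IFT[OF assms(1)]])
  show "periodic_t (IFT g i)" unfolding periodic_t_def using assms(2) by (simp add: IFT_def FT_def)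
qed

theorem not_solvable_sign_change:
  assumes c: "smooth_periodic c" and q: "smooth_periodic q"
    and sgn: "Im (c p) > 0" "Im (c m) < 0"
    and nonres: "mean c \<noteq> 0 \<or> \<not> (\<exists>k::int. mean q = \<i> * of_int k)"
  shows "\<not> globally_solvable c q"
proof
  assume solv: "globally_solvable c q"
  show False
  proof (rule wkb_data_exist[OF c q sgn])
    fix A Q a b \<theta> \<theta>' l \<delta> t1
    assume
      A: "smooth1 A" "\<And>t. A (t + 2 * pi) = A t" "\<And>t. (A has_vector_derivative a t) (at t)" and
      Q: "smooth1 Q" "\<And>t. Q (t + 2 * pi) = Q t" "\<And>t. (Q has_vector_derivative b t) (at t)" and
      \<theta>: "smooth1 \<theta>" "\<And>t. \<theta> (t + 2 * pi) = \<theta> t" "\<And>t. (\<theta> has_vector_derivative \<theta>' t) (at t)" and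
      \<theta>': "smooth1 \<theta>'" "\<And>t. \<theta>' (t + 2 * pi) = \<theta>' t" and
      ac: "\<And>t. a t * \<theta> t = c t * \<theta> t" and bq: "\<And>t. b t * \<theta> t = q t * \<theta> t" and
      van: "\<And>t. Im (A t) > l \<Longrightarrow> \<theta> t = 0" and \<delta>: "\<delta> > 0" and van': "\<And>t. Im (A t) > l - \<delta> \<Longrightarrow> \<theta>' t = 0" and
      t1: "Im (A t1) = l" "\<theta> t1 \<noteq> 0"
    \<comment> \<open>\<open>w\<close> solves the transformed equation with source \<open>g\<close>:
      differentiating the exponential cancels the symbol on the support of \<theta>, and only the
      term with \<theta>' is left.\<close>
    define w where "w = (wkb A Q l 0 \<theta> :: unit \<Rightarrow> tfun)"
    define g where "g = (wkb A Q l 0 \<theta>' :: unit \<Rightarrow> tfun)"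
    have w: "cinf moderate w" unfolding w_def
      by (rule cinf_wkb(1)[OF A(1,2) Q(1,2) \<theta>(1,2), where \<delta>=0]) (use van in auto)
    have g: "cinf rapid g" unfolding g_def by (rule cinf_wkb(2)[OF A(1,2) Q(1,2) \<theta>' van' _ \<delta>]) (use \<delta> in auto)
    have per: "w () (t + 2 * pi) \<xi> = w () t \<xi>" "g () (t + 2 * pi) \<xi> = g () t \<xi>" for t \<xi>
      unfolding w_def g_def wkb_def by (simp_all only: A(2) Q(2) \<theta>(2) \<theta>'(2))
    have ode: "((\<lambda>t. w () t \<xi>) has_vector_derivative g () t \<xi> - symb c q () t \<xi> * w () t \<xi>) (at t)" for t \<xi>
    proof -
      have "wkb A Q l 0 (\<lambda>t. \<theta>' t - b t * \<theta> t) () t \<xi> + (- \<i> * complex_of_real \<xi>) * wkb A Q l 0 (\<lambda>t. a t * \<theta> t) () t \<xi>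
        = g () t \<xi> - symb c q () t \<xi> * w () t \<xi>"
        unfolding ac bq by (simp add: g_def w_def wkb_def symb_def algebra_simps)
      then show ?thesis
        using wkb_partials[where l=l and k=0, OF A(3) Q(3) \<theta>(3), unfolded partials_def, rule_format, of "()" \<xi> t]
        by (simp only: w_def)
    qed
    define f where "f = IFT g ()"
    have f: "f \<in> schwartz" unfolding f_def by (rule IFT_schwartz[OF g]) (rule per(2))
    have FTf: "FT (\<lambda>_::unit. f) = g"
      unfolding f_def using FT_IFT[OF g] by (simp add: unit_abs_eta_conv)
    \<comment> \<open>Multiplication by a Gaussian in \<xi> commutes with the equation in
      \<open>t\<close> and makes the bounded packet rapidly decreasing.\<close>
    define e where "e n x = exp (complex_of_real (- (1 / real (Suc n))) * (complex_of_real x * complex_of_real x))" for n :: nat and x :: real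
    define u where "u n = IFT (\<lambda>i t \<xi>. w i t \<xi> * e n \<xi>) ()" for n
    have we: "cinf rapid (\<lambda>i t \<xi>. w i t \<xi> * e n \<xi>)" for n
      unfolding e_def by (rule cinf_rapid_mult[OF w cinf_rapid_gauss]) simp
    have un: "u n \<in> schwartz" for n
      unfolding u_def by (rule IFT_schwartz[OF we]) (simp add: per)
    have FTu: "FT (\<lambda>_::unit. u n) = (\<lambda>i t \<xi>. w i t \<xi> * e n \<xi>)" for n
      unfolding u_def using FT_IFT[OF we[of n]] by (simp add: unit_abs_eta_conv)
    have Lu: "cinf rapid (\<lambda>_::unit. opL c q (u n))" for n
      by (rule cinf_opL[OF c q schwartz_cinf[OF un]])
    have Luper: "opL c q (u n) \<in> schwartz" for n
    proof (rule cinf_schwartz[OF Lu])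
      have up: "u n (t + 2 * pi) x = u n t x" for t x using un[of n] by (simp add: schwartz_def periodic_t_def)
      have "pdt (u n) (t + 2 * pi) x = pdt (u n) t x" for t x
        by (rule vector_derivative_periodic[of "\<lambda>t. u n t x"])
          (use up cinf_deriv(1)[OF schwartz_cinf[OF un]] in auto)
      moreover have "pdx (u n) (t + 2 * pi) x = pdx (u n) t x" for t x
      proof -
        have "u n (t + 2 * pi) = u n t" by (rule ext) (rule up)
        then show ?thesis by (simp add: pdx_def)
      qed
      ultimately show "periodic_t (opL c q (u n))"
        using up smooth_periodicD(2)[OF c] smooth_periodicD(2)[OF q] by (simp add: periodic_t_def opL_def)
    qed
    have FTLu: "FT (\<lambda>_::unit. opL c q (u n)) () t \<xi> = g () t \<xi> * e n \<xi>" for n t \<xi>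
    proof -
      have "((\<lambda>t. w () t \<xi> * e n \<xi>) has_vector_derivative (g () t \<xi> - symb c q () t \<xi> * w () t \<xi>) * e n \<xi>) (at t)"
        by (rule has_vector_derivative_mult_left[OF ode])
      then have "pdt (FT (\<lambda>_::unit. u n) ()) t \<xi> = (g () t \<xi> - symb c q () t \<xi> * w () t \<xi>) * e n \<xi>"
        unfolding FTu pdt_def by (rule vector_derivative_at)
      then show ?thesis
        unfolding FT_opL[OF c q schwartz_cinf[OF un]] by (simp add: FTu symb_def algebra_simps)
    qed
    \<comment> \<open>Chosen so that \<open>g = g * e n + h n / (n + 1)\<close>; the family
      \<open>h\<close> is bounded in the rapidly decreasing class.\<close>
    define h where "h = (\<lambda>n t \<xi>. complex_of_real (real (Suc n)) * (1 - e n \<xi>) * g () t \<xi>)"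
    have "cinf rapid (\<lambda>n::nat. g ())"
      by (rule cinf_rapid_reindex[OF g])
    then have h: "cinf rapid h"
      unfolding h_def e_def by (rule cinf_rapid_mult[OF cinf_moderate_gauss_defect])
    have hper: "h n (t + 2 * pi) \<xi> = h n t \<xi>" for n t \<xi> by (simp add: h_def per)
    define G where "G = IFT h"
    have G: "cinf rapid G" unfolding G_def by (rule cinf_IFT[OF h])
    have Gs: "G n \<in> schwartz" for n unfolding G_def by (rule IFT_schwartz[OF h]) (rule hper)
    have FTG: "FT (\<lambda>_::unit. G n) () t \<xi> = h n t \<xi>" for n t \<xi>
    proof -
      have "FT (\<lambda>_::unit. G n) () t \<xi> = FT G n t \<xi>" by (simp only: FT_def)
      then show ?thesis by (simp only: G_def FT_IFT[OF h])
    qed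
    have approx: "f = (\<lambda>t x. opL c q (u n) t x + complex_of_real (1 / real (Suc n)) * G n t x)" for n
    proof -
      have G1: "cinf rapid (\<lambda>_::unit. \<lambda>t x. complex_of_real (1 / real (Suc n)) * G n t x)"
        by (rule cinf_rapid_cmult[OF schwartz_cinf[OF Gs]])
      have "(\<lambda>_::unit. f) = (\<lambda>_. \<lambda>t x. opL c q (u n) t x + complex_of_real (1 / real (Suc n)) * G n t x)"
      proof (rule FT_eq_imp_eq[OF schwartz_cinf[OF f] cinf_add[OF growth_module_rapid Lu G1]], intro ext)
        fix i :: unit and t \<xi>
        have "FT (\<lambda>_::unit. \<lambda>t x. opL c q (u n) t x + complex_of_real (1 / real (Suc n)) * G n t x) () t \<xi>
          = g () t \<xi> * e n \<xi> + complex_of_real (1 / real (Suc n)) * h n t \<xi>"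
          unfolding FT_add[OF Lu G1] FTLu by (simp only: FT_tmult FTG)
        also have "\<dots> = g () t \<xi>" by (simp add: h_def field_simps del: of_nat_Suc)
        finally show "FT (\<lambda>_. f) i t \<xi> = FT (\<lambda>_. \<lambda>t x. opL c q (u n) t x + complex_of_real (1 / real (Suc n)) * G n t x) i t \<xi>"
          unfolding unit_eq[of i] FTf by (rule sym)
      qed
      then show ?thesis by (rule fun_cong)
    qed
    have "\<forall>v\<in>ker_Lt c q. v f = 0"
      by (rule ballI, rule annihilated_of_approximation[where u=u and G=G])
        (rule approx un Luper G Gs | assumption)+
    then obtain s where s: "s \<in> schwartz" "opL c q s = f"
      using solv f unfolding globally_solvable_def by blast
    define S where "S = FT (\<lambda>_::unit. s)"
    have Sr: "cinf rapid S" unfolding S_def by (rule cinf_FT[OF schwartz_cinf[OF s(1)]])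
    have Sode: "((\<lambda>t. S () t \<xi>) has_vector_derivative g () t \<xi> - symb c q () t \<xi> * S () t \<xi>) (at t)" for t \<xi>
    proof -
      have "g () t \<xi> = pdt (S ()) t \<xi> + symb c q () t \<xi> * S () t \<xi>"
        using FT_opL[OF c q schwartz_cinf[OF s(1)], of "()" t \<xi>] by (simp add: s(2) FTf S_def symb_def)
      then show ?thesis using cinf_deriv(1)[OF Sr, of "()" \<xi> t] by simp
    qed
    have Sper: "S () (t + 2 * pi) \<xi> = S () t \<xi>" for t \<xi>
      unfolding S_def using s(1) by (intro FT_periodic) (auto simp: schwartz_def periodic_t_def)
    \<comment> \<open>Both functions are periodic solutions of the same equation; their difference
      is homogeneous and is multiplied over one period by a factor other than 1.\<close>
    have agree: "S () t1 \<xi> = w () t1 \<xi>" if nr: "exp (phase c q () (2 * pi) \<xi>) \<noteq> 1" for \<xi>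
    proof -
      have d: "((\<lambda>t. S () t \<xi> - w () t \<xi>) has_vector_derivative - symb c q () t \<xi> * (S () t \<xi> - w () t \<xi>)) (at t)" for t
        using has_vector_derivative_diff[OF Sode[of \<xi> t] ode[of \<xi> t]] by (simp add: algebra_simps)
      have "(S () t1 \<xi> - w () t1 \<xi>) * exp (phase c q () (t1 + 2 * pi) \<xi>) = (S () t1 \<xi> - w () t1 \<xi>) * exp (phase c q () t1 \<xi>)"
        using ode_homogeneous[OF d phase_deriv[OF c q], of "t1 + 2 * pi" t1] by (simp add: Sper per)
      then have "(S () t1 \<xi> - w () t1 \<xi>) * (exp (phase c q () (2 * pi) \<xi>) - 1) * exp (phase c q () t1 \<xi>) = 0"
        unfolding phase_shift[OF c q, of "()" t1] exp_add by (simp add: algebra_simps)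
      then show ?thesis using nr by simp
    qed
    \<comment> \<open>At nonresonant frequencies \<open>S\<close> equals \<open>w\<close>, which does not decay at \<open>t1\<close>.\<close>
    define K where "K = exp (- 1) * (exp (- Re (Q t1)) * norm (\<theta> t1))"
    have K: "K > 0" using t1 by (simp add: K_def)
    \<comment> \<open>For \<open>\<xi> \<ge> 0\<close> the analytic cutoff is at least
      \<open>exp (- 1)\<close>, and at \<open>t1\<close> the growing factor is exactly balanced
      because \<open>Im (A t1) = l\<close>.\<close>
    have w_ge: "K \<le> norm (w () t1 \<xi>)" if "\<xi> \<ge> 0" for \<xi>
    proof -
      have "norm (w () t1 \<xi>) = exp (- exp (- \<xi>)) * (exp (- Re (Q t1)) * norm (\<theta> t1))"
        unfolding w_def norm_wkb t1(1) by simp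
      moreover have "K \<le> exp (- exp (- \<xi>)) * (exp (- Re (Q t1)) * norm (\<theta> t1))"
        unfolding K_def using that by (intro mult_right_mono) auto
      ultimately show ?thesis by simp
    qed
    obtain D where D: "D \<ge> 0" "\<And>t \<xi>. \<bar>\<xi>\<bar> ^ 1 * norm (S () t \<xi>) \<le> D"
      using rapidD[OF cinf_growth[OF Sr], of 1] by blast
    \<comment> \<open>Beyond \<open>X\<close> the lower bound \<open>K\<close> contradicts the decay
      bound \<open>D / \<xi>\<close>, so all these frequencies must be resonant.\<close>
    define X where "X = D / K"
    have X0: "X \<ge> 0" using D K by (simp add: X_def)
    have resX: "exp (phase c q () (2 * pi) \<xi>) = 1" if "\<xi> > X" for \<xi>
    proof (rule ccontr)
      assume "exp (phase c q () (2 * pi) \<xi>) \<noteq> 1"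
      then have "K \<le> norm (S () t1 \<xi>)" using agree w_ge that X0 by simp
      then have "\<xi> * K \<le> \<xi> * norm (S () t1 \<xi>)" using that X0 by (intro mult_left_mono) auto
      also have "\<dots> \<le> D" using D(2)[of \<xi> t1] that X0 by simp
      finally have "\<xi> \<le> X" using K by (simp add: X_def pos_le_divide_eq)
      then show False using that by simp
    qed
    \<comment> \<open>Any point of the open half-line of resonances would do; there the monodromy is
      locally constant.\<close>
    have "((\<lambda>\<xi>. exp (phase c q () (2 * pi) \<xi>) - 1) has_vector_derivative 0) (at (X + 1))"
      by (rule has_vector_derivative_transform_within_open[OF has_vector_derivative_const[of 0], of "{X<..}"])
        (use resX in auto)
    from vector_derivative_unique_at[OF exp_phase_2pi_deriv[OF c q] this]
    have c0: "mean c = 0" by simp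
    have "exp (2 * pi * mean q) = 1"
      using resX[of "X + 1"] unfolding phase_2pi[OF c q] c0 by simp
    then obtain n :: int where n: "Re (mean q) = 0" "2 * pi * Im (mean q) = of_int (2 * n) * pi"
      by (auto simp: exp_eq_1)
    then have "mean q = \<i> * of_int n" by (simp add: complex_eq_iff)
    then show False using nonres c0 by blast
  qed
qed

text \<open>Connectedness on the circle is expressed through the image under \<open>cis\<close>,
  which glues 0 and \<open>2 * pi\<close>. If \<open>mean c = 0\<close>, the integral of
  \<open>Im c\<close> takes the same value at both ends, so the gluing is consistent.\<close>

theorem theorem1p2:
  fixes c q :: "real \<Rightarrow> complex"
  assumes "smooth_periodic c" and "smooth_periodic q"
  shows "(mean c = 0 \<and> (\<exists>k::int. \<forall>t. q t = \<i> * of_int k)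
            \<and> (\<forall>r::real. connected (cis ` {t \<in> {0..2 * pi}. integral {0..t} (\<lambda>s. Im (c s)) < r}))
          \<longrightarrow> globally_solvable c q)
       \<and> ((\<exists>t. Im (c t) \<noteq> 0) \<and> (mean c \<noteq> 0 \<or> \<not> (\<exists>k::int. mean q = \<i> * of_int k))
          \<longrightarrow> (globally_solvable c q \<longleftrightarrow> ((\<forall>t. Im (c t) \<ge> 0) \<or> (\<forall>t. Im (c t) \<le> 0))))"
proof (intro conjI impI)
  assume "mean c = 0 \<and> (\<exists>k::int. \<forall>t. q t = \<i> * of_int k)
    \<and> (\<forall>r::real. connected (cis ` {t \<in> {0..2 * pi}. integral {0..t} (\<lambda>s. Im (c s)) < r}))"
  then obtain k :: int where "mean c = 0" "\<And>t. q t = \<i> * of_int k"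
    "\<And>r. connected (cis ` {t \<in> {0..2 * pi}. integral {0..t} (\<lambda>s. Im (c s)) < r})"
    by auto
  then show "globally_solvable c q" by (rule solvable_connected_sublevels[OF assms])
next
  assume "(\<exists>t. Im (c t) \<noteq> 0) \<and> (mean c \<noteq> 0 \<or> \<not> (\<exists>k::int. mean q = \<i> * of_int k))"
  then obtain t0 where t0: "Im (c t0) \<noteq> 0"
    and nonres: "mean c \<noteq> 0 \<or> \<not> (\<exists>k::int. mean q = \<i> * of_int k)" by blast
  show "globally_solvable c q \<longleftrightarrow> ((\<forall>t. Im (c t) \<ge> 0) \<or> (\<forall>t. Im (c t) \<le> 0))"
  proof
    assume "globally_solvable c q"
    then show "(\<forall>t. Im (c t) \<ge> 0) \<or> (\<forall>t. Im (c t) \<le> 0)"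
      using not_solvable_sign_change[OF assms _ _ nonres] by (meson not_le)
  next
    assume "(\<forall>t. Im (c t) \<ge> 0) \<or> (\<forall>t. Im (c t) \<le> 0)"
    then show "globally_solvable c q"
      using solvable_constant_sign[OF assms _ _ t0, of 1] solvable_constant_sign[OF assms _ _ t0, of "-1"] by auto
  qed
qed

end
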